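(* Let $k,d\in\mathbb{N}=\{0,1,2,\dots\}$. Then $H_{k,d}=\operatorname{im}\chi_{k,d}$; that is, a polynomial $f\in\mathbb{R}[X,T]$ belongs to $H_{k,d}$ if and only if there is a symmetric $d\times d$ matrix $A$ with entries in $\mathbb{R}[X]$ of degree at most $k$ such that $f=\det(TI_d-A)$. In other words, if $f\in\mathbb{R}[X,T]_{(k,d)}$ is $T$-real rooted of degree $d$ in $T$, then $f$ has a symmetric $T$-spectral determinantal representation $TI_d-A$ whose matrix $A$ has entries of degree at most $k$ in $X$.
   Context: A univariate polynomial in $\mathbb{R}[T]$ is real rooted if it is monic and has only real roots (all its complex roots are real). A polynomial $f\in\mathbb{R}[X,T]$ is $T$-real rooted if for every $x\in\mathbb{R}$ the polynomial $f(x,T)\in\mathbb{R}[T]$ is real rooted. For $k,d\in\mathbb{N}$ define $$\mathbb{R}[X,T]_{(k,d)}:=\Big\{\sum_{i=0}^d a_iT^i \;\Big|\; a_i\in\mathbb{R}[X],\ \deg a_i\le k(d-i)\Big\}$$ (with the zero polynomial regarded as satisfying every degree bound). $H_{k,d}$ is the set of $f\in\mathbb{R}[X,T]_{(k,d)}$ that are $T$-real rooted and of degree $d$ in $T$. $S_{k,d}$ is the set of symmetric $d\times d$ matrices over $\mathbb{R}[X]$ all of whose entries have degree at most $k$. The map $\chi_{k,d}$ is defined on $S_{k,d}$ by $\chi_{k,d}(A)=\det(TI_d-A)\in\mathbb{R}[X,T]$. A symmetric $T$-spectral determinantal representation of $f$ (monic of degree $d$ in $T$) is a matrix $TI_d-A$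 with $A\in\mathbb{R}[X]^{d\times d}$ symmetric and $f=\det(TI_d-A)$. *)

theory Defs
  imports Complex_Main "Jordan_Normal_Form.Char_Poly"
begin

text \<open>
  A bivariate polynomial over the reals is an element of type \<open>real poly poly\<close>: the outer
  variable is \<open>T\<close>, the inner one is \<open>X\<close>. So \<open>degree\<close> on this type is the degree in \<open>T\<close>, and
  \<open>[:0, 1:]\<close> is \<open>T\<close>.
\<close>

definition real_rooted :: "real poly \<Rightarrow> bool" where
  "real_rooted p \<longleftrightarrow>
     lead_coeff p = 1 \<and> (\<forall>z :: complex. poly (map_poly complex_of_real p) z = 0 \<longrightarrow> z \<in> \<real>)"

definition specialize_X :: "real \<Rightarrow> real poly poly \<Rightarrow> real poly" where
  "specialize_X x f = map_poly (\<lambda>a. poly a x) f"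

definition T_real_rooted :: "real poly poly \<Rightarrow> bool" where
  "T_real_rooted f \<longleftrightarrow> (\<forall>x :: real. real_rooted (specialize_X x f))"

text \<open>
  Since \<open>degree 0 = 0\<close>, the zero polynomial satisfies every degree bound below.
\<close>

definition weighted_polys :: "nat \<Rightarrow> nat \<Rightarrow> real poly poly set" where
  "weighted_polys k d =
     {(\<Sum>i\<le>d. monom (a i) i) | a :: nat \<Rightarrow> real poly. \<forall>i\<le>d. degree (a i) \<le> k * (d - i)}"

definition H_polys :: "nat \<Rightarrow> nat \<Rightarrow> real poly poly set" where
  "H_polys k d = {f \<in> weighted_polys k d. T_real_rooted f \<and> degree f = d}"

definition S_mats :: "nat \<Rightarrow> nat \<Rightarrow> real poly mat set" where
  "S_mats k d =
     {A \<in> carrier_mat d d. transpose_mat A = A \<and> (\<forall>i<d. \<forall>j<d. degree (A $$ (i, j)) \<le> k)}"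

definition chi_map :: "nat \<Rightarrow> real poly mat \<Rightarrow> real poly poly" where
  "chi_map d A = det ([:0, 1:] \<cdot>\<^sub>m 1\<^sub>m d - map_mat (\<lambda>a. [:a:]) A)"

lemma chi_map_eq_char_poly:
  assumes "A \<in> carrier_mat d d"
  shows "chi_map d A = char_poly A"
proof -
  have "[:0, 1:] \<cdot>\<^sub>m 1\<^sub>m d - map_mat (\<lambda>a. [:a:]) A = char_poly_matrix A"
    using assms by (intro eq_matI) (auto simp: char_poly_matrix_def)
  then show ?thesis
    by (simp add: chi_map_def char_poly_def)
qed

end

theory Submission
  imports "HOL-Analysis.Analysis" Defs
begin

text \<open>
  The proof is a continuity method. The characteristic polynomial map \<open>\<chi>\<close> has closed image, because a
  real symmetric matrix is bounded by the coefficients of its characteristic polynomial; for the same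
  reason the degree bound on \<open>A\<close> is automatic, and it suffices to approximate \<open>f\<close> by points of the
  image with a larger degree bound \<open>K\<close> and a fixed diagonal leading term \<open>X^K D\<close>, \<open>D\<close> with distinct
  entries.

  On matrices \<open>B = X^K D + \<dots>\<close> the derivative of \<open>\<chi>\<close> is a square linear map. If \<open>N\<close> lies in its kernel,
  differentiating \<open>(T - B) adj (T - B) = \<chi>(B)\<close> shows that \<open>q N = [W, B]\<close> for some skew-symmetric \<open>W\<close> and
  \<open>q \<noteq> 0\<close>. If \<open>B(x)\<close> is non-derogatory for all complex \<open>x\<close>, then only the zero skew-symmetric
  matrix commutes with \<open>B(x)\<close>, so \<open>q\<close> can be taken constant, and comparing leading terms gives
  \<open>W = 0\<close>. Hence \<open>\<chi>\<close> is locally surjective at \<open>B\<close>. This applies whenever the curve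
  \<open>\<chi>(B) = 0\<close> has no affine singular points, and also to tridiagonal \<open>B\<close> with nonzero
  constants next to the diagonal.

  The operator \<open>(1 - c (1 + X^2)^m d/dT)^d\<close> makes all roots simple at every real \<open>x\<close>. Applied to
  \<open>s^d f(X, T / s)\<close>, \<open>0 \<le> s \<le> 1\<close>, it gives a path from a product of linear factors,
  which is close to \<open>\<chi>\<close> of a tridiagonal matrix, to a polynomial close to \<open>f\<close>. Singular points over
  non-real \<open>x\<close> have real codimension 6 in a family with 5 real parameters \<open>(s, x, t)\<close>, so a small generic
  perturbation by \<open>a(X) + b(X) T\<close>, \<open>deg a \<le> 3\<close>, \<open>deg b \<le> 1\<close>, removes them along the whole path.
\<close>

hide_const (open) Determinants.det Finite_Cartesian_Product.mat
  Module.smult Module.module Finite_Cartesian_Product.vec Finite_Cartesian_Product.row Finite_Cartesian_Product.column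
no_notation Finite_Cartesian_Product.vec_nth (infixl "$" 90)

subsection \<open>Characteristic polynomials of matrices given by their entries\<close>

text \<open>The fibres of \<chi> are unions of orbits under orthogonal conjugation, so its
  derivative can be injective only after these orbits are cut down. Fixing the leading term
  \<open>X^K D\<close> with distinct entries leaves sign changes only, and the count becomes square:
  K d (d + 1) / 2 lower coefficients of a symmetric matrix against K (d - i) free coefficients of
  T^i for each i < d. The obstacle is that the denominator q may vanish at non-real x, about which
  real rootedness says nothing. Hence two mechanisms. Over real x the simple roots must survive
  perturbation uniformly, also as x tends to infinity; this is why d/dT is multiplied by a power of
  1 + X^2, which has no real zero and can absorb the growth of the coefficients. Over non-real x
  general position does the work: a real perturbation a + b T is subject to conditions at x and at
  its conjugate together, that is, b is interpolated at two points (degree 1) and a with its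
  derivative at two points (degree 3), which gives six independent real conditions.\<close>

definition char_mat :: "nat \<Rightarrow> (nat \<Rightarrow> nat \<Rightarrow> 'a::comm_ring_1) \<Rightarrow> 'a poly mat" where
  "char_mat d B = mat d d (\<lambda>(i, j). (if i = j then [:0, 1:] else 0) - [:B i j:])"

definition char_pol :: "nat \<Rightarrow> (nat \<Rightarrow> nat \<Rightarrow> 'a::comm_ring_1) \<Rightarrow> 'a poly" where
  "char_pol d B = det (char_mat d B)"

lemma char_mat_carrier [simp]: "char_mat d B \<in> carrier_mat d d"
  by (simp add: char_mat_def)

lemma char_mat_index [simp]:
  "i < d \<Longrightarrow> j < d \<Longrightarrow> char_mat d B $$ (i, j) = (if i = j then [:0, 1:] else 0) - [:B i j:]"
  by (simp add: char_mat_def)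

lemma chi_map_eq_char_pol:
  assumes "A \<in> carrier_mat d d"
  shows "chi_map d A = char_pol d (\<lambda>i j. A $$ (i, j))"
proof -
  have "[:0, 1:] \<cdot>\<^sub>m 1\<^sub>m d - map_mat (\<lambda>a. [:a:]) A = char_mat d (\<lambda>i j. A $$ (i, j))"
    using assms by (intro eq_matI) (auto simp: char_mat_def)
  then show ?thesis
    by (simp add: chi_map_def char_pol_def)
qed

lemma char_mat_cong: "(\<And>i j. i < d \<Longrightarrow> j < d \<Longrightarrow> A i j = B i j) \<Longrightarrow> char_mat d A = char_mat d B"
  by (auto simp: char_mat_def)

lemma char_pol_cong: "(\<And>i j. i < d \<Longrightarrow> j < d \<Longrightarrow> A i j = B i j) \<Longrightarrow> char_pol d A = char_pol d B"
  unfolding char_pol_def by (subst char_mat_cong) auto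

lemma det_mat_expand:
  "det (mat n n (\<lambda>(i, j). E i j)) =
     (\<Sum>p \<in> {p. p permutes {0..<n}}. signof p * (\<Prod>i = 0..<n. E i (p i)))"
proof -
  have "det (mat n n (\<lambda>(i, j). E i j)) =
     (\<Sum>p \<in> {p. p permutes {0..<n}}. signof p * (\<Prod>i = 0..<n. mat n n (\<lambda>(i, j). E i j) $$ (i, p i)))"
    by (rule det_def') simp
  also have "\<dots> = (\<Sum>p \<in> {p. p permutes {0..<n}}. signof p * (\<Prod>i = 0..<n. E i (p i)))"
    by (intro sum.cong refl arg_cong2[where f = "(*)"] prod.cong)
       (auto simp: permutes_in_image)
  finally show ?thesis .
qed

text \<open>A cofactor is again a determinant of a matrix given by entries, so the Leibniz formula
  \<open>det_mat_expand\<close> carries differentiability and leading forms over to the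
  adjugate.\<close>

lemma adj_mat_entry:
  assumes "i < n" "j < n"
  shows "adj_mat (mat n n (\<lambda>(i, j). E i j)) $$ (i, j) = (- 1) ^ (j + i) * det (mat (n - 1) (n - 1)
     (\<lambda>(i', j'). E (if i' < j then i' else Suc i') (if j' < i then j' else Suc j')))"
proof -
  have "mat_delete (mat n n (\<lambda>(i, j). E i j)) j i = mat (n - 1) (n - 1)
     (\<lambda>(i', j'). E (if i' < j then i' else Suc i') (if j' < i then j' else Suc j'))"
    by (auto simp: mat_delete_def)
  with assms show ?thesis
    by (simp add: adj_mat_def cofactor_def)
qed

lemma adj_mat_mult_entry:
  assumes "A \<in> carrier_mat n n" "i < n" "j < n"
  shows "(\<Sum>k<n. A $$ (i, k) * adj_mat A $$ (k, j)) = (if i = j then det A else 0)"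
    and "(\<Sum>k<n. adj_mat A $$ (i, k) * A $$ (k, j)) = (if i = j then det A else 0)"
proof -
  have R: "adj_mat A \<in> carrier_mat n n"
    by (rule adj_mat(1)[OF assms(1)])
  have "(A * adj_mat A) $$ (i, j) = (if i = j then det A else 0)"
    unfolding adj_mat(2)[OF assms(1)] using assms by simp
  then show "(\<Sum>k<n. A $$ (i, k) * adj_mat A $$ (k, j)) = (if i = j then det A else 0)"
    using assms R by (simp add: scalar_prod_def atLeast0LessThan)
  have "(adj_mat A * A) $$ (i, j) = (if i = j then det A else 0)"
    unfolding adj_mat(3)[OF assms(1)] using assms by simp
  then show "(\<Sum>k<n. adj_mat A $$ (i, k) * A $$ (k, j)) = (if i = j then det A else 0)"
    using assms R by (simp add: scalar_prod_def atLeast0LessThan)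
qed

text \<open>Matrices are bare index functions, so that associativity is an equation of functions
  without carrier conditions; the identity laws hold for indices below \<open>d\<close>.\<close>

definition mmul :: "nat \<Rightarrow> (nat \<Rightarrow> nat \<Rightarrow> 'a::comm_ring_1) \<Rightarrow> (nat \<Rightarrow> nat \<Rightarrow> 'a) \<Rightarrow> nat \<Rightarrow> nat \<Rightarrow> 'a" where
  "mmul d A B i j = (\<Sum>k<d. A i k * B k j)"

lemma mmul_assoc: "mmul d (mmul d A B) C = mmul d A (mmul d B C)"
proof (intro ext)
  fix i j
  have "mmul d (mmul d A B) C i j = (\<Sum>k<d. \<Sum>l<d. A i l * B l k * C k j)"
    by (simp add: mmul_def sum_distrib_right)
  also have "\<dots> = (\<Sum>l<d. \<Sum>k<d. A i l * B l k * C k j)"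
    by (rule sum.swap)
  also have "\<dots> = mmul d A (mmul d B C) i j"
    by (simp add: mmul_def sum_distrib_left mult.assoc)
  finally show "mmul d (mmul d A B) C i j = mmul d A (mmul d B C) i j" .
qed

fun mpow :: "nat \<Rightarrow> (nat \<Rightarrow> nat \<Rightarrow> 'a::comm_ring_1) \<Rightarrow> nat \<Rightarrow> nat \<Rightarrow> nat \<Rightarrow> 'a" where
  "mpow d B 0 = (\<lambda>i j. if i = j then 1 else 0)"
| "mpow d B (Suc m) = mmul d (mpow d B m) B"

subsection \<open>Differentiation along a line of matrices\<close>

text \<open>Working coefficientwise avoids a topology on polynomials; Cauchy products reduce the
  product rule to the one for real functions.\<close>

definition line_deriv :: "(real \<Rightarrow> real poly poly) \<Rightarrow> real poly poly \<Rightarrow> bool" where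
  "line_deriv g g' \<longleftrightarrow>
     (\<forall>i j. ((\<lambda>s. coeff (coeff (g s) i) j) has_real_derivative coeff (coeff g' i) j) (at 0))"

lemma line_deriv_const: "line_deriv (\<lambda>s. a) 0"
  by (auto simp: line_deriv_def)

lemma line_deriv_add: "line_deriv g g' \<Longrightarrow> line_deriv h h' \<Longrightarrow> line_deriv (\<lambda>s. g s + h s) (g' + h')"
  by (auto simp: line_deriv_def intro!: derivative_intros)

lemma line_deriv_mult:
  assumes "line_deriv g g'" "line_deriv h h'"
  shows "line_deriv (\<lambda>s. g s * h s) (g' * h 0 + g 0 * h')"
proof -
  have "((\<lambda>s. \<Sum>a\<le>i. \<Sum>b\<le>j. coeff (coeff (g s) a) b * coeff (coeff (h s) (i - a)) (j - b))
     has_real_derivative (\<Sum>a\<le>i. \<Sum>b\<le>j. coeff (coeff (g 0) a) b * coeff (coeff h' (i - a)) (j - b)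
        + coeff (coeff g' a) b * coeff (coeff (h 0) (i - a)) (j - b))) (at 0)" for i j
    using assms unfolding line_deriv_def by (intro DERIV_sum DERIV_mult') auto
  then show ?thesis
    by (simp add: line_deriv_def coeff_mult coeff_sum sum.distrib add.commute)
qed

lemma line_deriv_unique: "line_deriv g a \<Longrightarrow> line_deriv g b \<Longrightarrow> a = b"
  unfolding line_deriv_def by (intro poly_eqI) (blast intro: DERIV_unique)

lemma line_deriv_sum: "(\<And>x. x \<in> A \<Longrightarrow> line_deriv (\<lambda>s. g s x) (g' x)) \<Longrightarrow> line_deriv (\<lambda>s. sum (g s) A) (sum g' A)"
  by (induction A rule: infinite_finite_induct) (auto intro: line_deriv_const line_deriv_add)

lemma line_deriv_line: "line_deriv (\<lambda>s. c - [:b + smult s n:]) (- [:n:])"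
proof -
  have "((\<lambda>s. coeff (coeff (c - [:b + smult s n:]) i) j) has_real_derivative
     coeff (coeff (- [:n:]) i) j) (at 0)" for i j
    by (cases i) (auto intro!: derivative_eq_intros)
  then show ?thesis
    by (simp add: line_deriv_def)
qed

text \<open>Differentiating \<open>(T - B - s N) adj (T - B - s N) = char_pol (B + s N)\<close> at \<open>s = 0\<close>.\<close>

lemma line_deriv_adj:
  fixes B N :: "nat \<Rightarrow> nat \<Rightarrow> real poly"
  assumes null: "line_deriv (\<lambda>s. char_pol d (\<lambda>i j. B i j + smult s (N i j))) 0"
  obtains R' where "\<And>i j. i < d \<Longrightarrow> j < d \<Longrightarrow>
    (\<Sum>k<d. char_mat d B $$ (i, k) * R' k j) = (\<Sum>k<d. [:N i k:] * adj_mat (char_mat d B) $$ (k, j))"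
proof -
  let ?M = "\<lambda>s. char_mat d (\<lambda>i j. B i j + smult s (N i j))"
  let ?E = "\<lambda>i j s. (if i = j then [:0, 1:] else 0) - [:B i j + smult s (N i j):]"
  have M: "?M s = mat d d (\<lambda>(i, j). ?E i j s)" for s
    by (simp add: char_mat_def)
  have E: "line_deriv (?E i j) (- [:N i j:])" for i j
    by (rule line_deriv_line)
  \<comment> \<open>\<open>DD\<close> records mere differentiability: the derivative
    \<open>R'\<close> of the adjugate is never computed.\<close>
  define DD where "DD = (\<lambda>g. \<exists>g'. line_deriv g g')"
  define G where "G = (\<lambda>i j s. adj_mat (?M s) $$ (i, j))"
  have DE: "DD (?E i j)" for i j
    unfolding DD_def using E by blast
  have Ddet: "DD (\<lambda>s. det (mat n n (\<lambda>(i, j). e i j s)))" if e: "\<And>i j. DD (e i j)" for e and n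
  proof -
    have "DD (\<lambda>s. \<Prod>i\<in>A. e i (p i) s)" for p and A :: "nat set"
    proof (induction A rule: infinite_finite_induct)
      case (insert x F)
      obtain a b where "line_deriv (e x (p x)) a" "line_deriv (\<lambda>s. \<Prod>i\<in>F. e i (p i) s) b"
        using insert.IH e[of x "p x"] unfolding DD_def by blast
      from line_deriv_mult[OF this] insert.hyps show ?case
        unfolding DD_def by auto
    qed (auto simp: DD_def intro: line_deriv_const)
    then have "\<exists>h. line_deriv (\<lambda>s. \<Prod>i = 0..<n. e i (p i) s) h" for p
      unfolding DD_def .
    then obtain h where "line_deriv (\<lambda>s. \<Prod>i = 0..<n. e i (p i) s) (h p)" for p
      by metis
    then have "line_deriv (\<lambda>s. \<Sum>p \<in> {p. p permutes {0..<n}}. signof p * (\<Prod>i = 0..<n. e i (p i) s))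
       (\<Sum>p \<in> {p. p permutes {0..<n}}. 0 * (\<Prod>i = 0..<n. e i (p i) 0) + signof p * h p)"
      by (intro line_deriv_sum line_deriv_mult line_deriv_const)
    then show ?thesis
      unfolding DD_def det_mat_expand by blast
  qed
  have "DD (G i j)" if "i < d" "j < d" for i j
  proof -
    let ?D = "\<lambda>s. det (mat (d - 1) (d - 1)
      (\<lambda>(i', j'). ?E (if i' < j then i' else Suc i') (if j' < i then j' else Suc j') s))"
    have "DD ?D"
      by (rule Ddet) (rule DE)
    then obtain D' where "line_deriv ?D D'"
      unfolding DD_def by blast
    from line_deriv_mult[OF line_deriv_const this] have "DD (\<lambda>s. (- 1) ^ (j + i) * ?D s)"
      unfolding DD_def by blast
    then show ?thesis
      unfolding G_def M adj_mat_entry[OF that] .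
  qed
  then obtain R' where R': "\<And>i j. i < d \<Longrightarrow> j < d \<Longrightarrow> line_deriv (G i j) (R' i j)"
    unfolding DD_def by metis
  have "(\<Sum>k<d. char_mat d B $$ (i, k) * R' k j) = (\<Sum>k<d. [:N i k:] * adj_mat (char_mat d B) $$ (k, j))"
    if ij: "i < d" "j < d" for i j
  proof -
    have d1: "line_deriv (\<lambda>s. \<Sum>k<d. ?E i k s * G k j s) (\<Sum>k<d. - [:N i k:] * G k j 0 + ?E i k 0 * R' k j)"
      using ij by (intro line_deriv_sum line_deriv_mult E R') auto
    have eq: "(\<lambda>s. \<Sum>k<d. ?E i k s * G k j s) =
       (\<lambda>s. if i = j then char_pol d (\<lambda>i j. B i j + smult s (N i j)) else 0)"
    proof
      fix s
      have "(\<Sum>k<d. ?E i k s * G k j s) = (\<Sum>k<d. ?M s $$ (i, k) * adj_mat (?M s) $$ (k, j))"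
        using ij by (intro sum.cong) (auto simp: G_def)
      also have "\<dots> = (if i = j then det (?M s) else 0)"
        by (rule adj_mat_mult_entry(1)[OF char_mat_carrier ij])
      finally show "(\<Sum>k<d. ?E i k s * G k j s) = (if i = j then char_pol d (\<lambda>i j. B i j + smult s (N i j)) else 0)"
        by (simp only: char_pol_def)
    qed
    have d2: "line_deriv (\<lambda>s. if i = j then char_pol d (\<lambda>i j. B i j + smult s (N i j)) else 0) 0"
      using null by (cases "i = j") (auto simp: line_deriv_const)
    have "(\<Sum>k<d. - [:N i k:] * G k j 0 + ?E i k 0 * R' k j) = 0"
      by (rule line_deriv_unique[OF d1[unfolded eq] d2])
    then have "(\<Sum>k<d. ?E i k 0 * R' k j) = (\<Sum>k<d. [:N i k:] * G k j 0)"
      unfolding sum.distrib minus_mult_left[symmetric] sum_negf by (simp only: neg_eq_iff_add_eq_0 add_eq_0_iff minus_minus)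
    moreover have "(\<Sum>k<d. ?E i k 0 * R' k j) = (\<Sum>k<d. char_mat d B $$ (i, k) * R' k j)"
      by (intro sum.cong) (use ij in auto)
    moreover have "G k j 0 = adj_mat (char_mat d B) $$ (k, j)" for k
      by (simp add: G_def)
    ultimately show ?thesis
      by (simp only:)
  qed
  then show thesis
    by (rule that)
qed

subsection \<open>Evaluating a polynomial matrix at a matrix from the right\<close>

text \<open>The coefficient matrices stand to the left of the powers of \<open>B\<close>. A fixed
  bound \<open>n\<close> instead of a degree makes the value additive in \<open>Q\<close>; it is the
  complete value once \<open>n\<close> exceeds all degrees.\<close>

definition right_eval :: "nat \<Rightarrow> nat \<Rightarrow> (nat \<Rightarrow> nat \<Rightarrow> 'a::comm_ring_1) \<Rightarrow> (nat \<Rightarrow> nat \<Rightarrow> 'a poly) \<Rightarrow> nat \<Rightarrow> nat \<Rightarrow> 'a" where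
  "right_eval d n B Q i j = (\<Sum>m<n. \<Sum>l<d. coeff (Q i l) m * mpow d B m l j)"

lemma mpow_comm:
  assumes "i < d" "j < d"
  shows "mmul d B (mpow d B m) i j = mmul d (mpow d B m) B i j"
  using assms
proof (induction m arbitrary: i j)
  case 0
  then show ?case
    by (simp add: mmul_def if_distrib if_distribR cong: if_cong)
next
  case (Suc m)
  have "mmul d B (mpow d B (Suc m)) i j = mmul d (mmul d B (mpow d B m)) B i j"
    by (simp add: mmul_assoc)
  also have "\<dots> = mmul d (mmul d (mpow d B m) B) B i j"
    using Suc.prems by (auto simp: mmul_def[of d _ B i j] Suc.IH intro!: sum.cong)
  finally show ?case
    by simp
qed

lemma right_eval_pCons:
  assumes "\<And>i l. l < d \<Longrightarrow> degree (Q i l) < n"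
  shows "right_eval d (Suc n) B (\<lambda>i l. pCons 0 (Q i l)) i j = mmul d (right_eval d (Suc n) B Q) B i j"
proof -
  have "right_eval d (Suc n) B (\<lambda>i l. pCons 0 (Q i l)) i j = (\<Sum>m<n. \<Sum>l<d. coeff (Q i l) m * mpow d B (Suc m) l j)"
    unfolding right_eval_def by (subst sum.lessThan_Suc_shift) simp
  also have "\<dots> = (\<Sum>m<Suc n. \<Sum>l<d. coeff (Q i l) m * mpow d B (Suc m) l j)"
    using assms by (simp add: coeff_eq_0)
  also have "\<dots> = (\<Sum>m<Suc n. \<Sum>l<d. \<Sum>k<d. coeff (Q i l) m * mpow d B m l k * B k j)"
    by (simp add: mmul_def sum_distrib_left mult.assoc)
  also have "\<dots> = (\<Sum>m<Suc n. \<Sum>k<d. \<Sum>l<d. coeff (Q i l) m * mpow d B m l k * B k j)"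
    by (subst sum.swap[of _ "{..<d}" "{..<d}"]) simp
  also have "\<dots> = (\<Sum>k<d. \<Sum>m<Suc n. \<Sum>l<d. coeff (Q i l) m * mpow d B m l k * B k j)"
    by (rule sum.swap)
  also have "\<dots> = mmul d (right_eval d (Suc n) B Q) B i j"
    by (simp only: mmul_def right_eval_def sum_distrib_right)
  finally show ?thesis .
qed

lemma right_eval_mult_left:
  "right_eval d n B (\<lambda>i l. \<Sum>k<d. [:C i k:] * Q k l) i j = mmul d C (right_eval d n B Q) i j"
proof -
  have "right_eval d n B (\<lambda>i l. \<Sum>k<d. [:C i k:] * Q k l) i j
      = (\<Sum>m<n. \<Sum>l<d. \<Sum>k<d. C i k * coeff (Q k l) m * mpow d B m l j)"
    by (simp add: right_eval_def coeff_sum sum_distrib_right)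
  also have "\<dots> = (\<Sum>m<n. \<Sum>k<d. \<Sum>l<d. C i k * coeff (Q k l) m * mpow d B m l j)"
    by (subst sum.swap[of _ "{..<d}" "{..<d}"]) simp
  also have "\<dots> = (\<Sum>k<d. \<Sum>m<n. \<Sum>l<d. C i k * coeff (Q k l) m * mpow d B m l j)"
    by (rule sum.swap)
  also have "\<dots> = mmul d C (right_eval d n B Q) i j"
    by (simp only: mmul_def right_eval_def sum_distrib_left mult.assoc)
  finally show ?thesis .
qed

text \<open>Right evaluation does not respect an arbitrary constant factor on the right; it does
  respect \<open>B\<close>, which commutes with its own powers.\<close>

lemma right_eval_mult_right:
  assumes "j < d"
  shows "right_eval d n B (\<lambda>i l. \<Sum>k<d. Q i k * [:B k l:]) i j = mmul d (right_eval d n B Q) B i j"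
proof -
  have "right_eval d n B (\<lambda>i l. \<Sum>k<d. Q i k * [:B k l:]) i j
      = (\<Sum>m<n. \<Sum>l<d. \<Sum>k<d. coeff (Q i k) m * (B k l * mpow d B m l j))"
    by (simp add: right_eval_def coeff_sum sum_distrib_right mult_ac sum_distrib_left)
  also have "\<dots> = (\<Sum>m<n. \<Sum>k<d. \<Sum>l<d. coeff (Q i k) m * (B k l * mpow d B m l j))"
    by (subst sum.swap[of _ "{..<d}" "{..<d}"]) simp
  also have "\<dots> = (\<Sum>m<n. \<Sum>k<d. coeff (Q i k) m * mmul d B (mpow d B m) k j)"
    by (simp only: mmul_def sum_distrib_left)
  also have "\<dots> = (\<Sum>m<n. \<Sum>k<d. coeff (Q i k) m * mmul d (mpow d B m) B k j)"
    using assms by (simp add: mpow_comm)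
  also have "\<dots> = (\<Sum>m<n. \<Sum>k<d. \<Sum>l<d. coeff (Q i k) m * mpow d B m k l * B l j)"
    by (simp add: mmul_def sum_distrib_left mult.assoc)
  also have "\<dots> = (\<Sum>m<n. \<Sum>l<d. \<Sum>k<d. coeff (Q i k) m * mpow d B m k l * B l j)"
    by (subst sum.swap[of _ "{..<d}" "{..<d}"]) simp
  also have "\<dots> = (\<Sum>l<d. \<Sum>m<n. \<Sum>k<d. coeff (Q i k) m * mpow d B m k l * B l j)"
    by (rule sum.swap)
  also have "\<dots> = mmul d (right_eval d n B Q) B i j"
    by (simp only: mmul_def right_eval_def sum_distrib_right)
  finally show ?thesis .
qed

lemma right_eval_diff: "right_eval d n B (\<lambda>i l. Q i l - S i l) i j = right_eval d n B Q i j - right_eval d n B S i j"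
  by (simp add: right_eval_def left_diff_distrib sum_subtractf)

lemma right_eval_cong:
  "(\<And>l. l < d \<Longrightarrow> Q i l = S i l) \<Longrightarrow> right_eval d n B Q i j = right_eval d n B S i j"
  by (simp add: right_eval_def)

lemma char_mat_mult_left:
  assumes "i < d"
  shows "(\<Sum>k<d. char_mat d B $$ (i, k) * Q k j) = pCons 0 (Q i j) - (\<Sum>k<d. [:B i k:] * Q k j)"
proof -
  have "(\<Sum>k<d. char_mat d B $$ (i, k) * Q k j) = (\<Sum>k<d. (if i = k then pCons 0 (Q k j) else 0) - [:B i k:] * Q k j)"
    using assms by (intro sum.cong) (auto simp: left_diff_distrib)
  then show ?thesis
    using assms by (simp add: sum_subtractf)
qed

lemma char_mat_mult_right:
  assumes "j < d"
  shows "(\<Sum>k<d. Q i k * char_mat d B $$ (k, j)) = pCons 0 (Q i j) - (\<Sum>k<d. Q i k * [:B k j:])"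
proof -
  have "(\<Sum>k<d. Q i k * char_mat d B $$ (k, j)) = (\<Sum>k<d. (if k = j then pCons 0 (Q i k) else 0) - Q i k * [:B k j:])"
    using assms by (intro sum.cong) (auto simp: right_diff_distrib mult.commute)
  then show ?thesis
    using assms by (simp add: sum_subtractf)
qed

text \<open>At T = B the product T Q becomes Q(B) B, whereas B Q becomes B Q(B). With T - B on the
  left the value is therefore a commutator instead of zero.\<close>

lemma right_eval_char_mat:
  assumes eq: "\<And>l. l < d \<Longrightarrow> (\<Sum>k<d. char_mat d B $$ (i, k) * Q k l) = W i l"
    and deg: "\<And>i l. l < d \<Longrightarrow> degree (Q i l) < n" and i: "i < d"
  shows "right_eval d (Suc n) B W i j = mmul d (right_eval d (Suc n) B Q) B i j - mmul d B (right_eval d (Suc n) B Q) i j"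
proof -
  have "right_eval d (Suc n) B W i j = right_eval d (Suc n) B (\<lambda>i l. pCons 0 (Q i l) - (\<Sum>k<d. [:B i k:] * Q k l)) i j"
    using eq char_mat_mult_left[OF i, of B Q] by (intro right_eval_cong) simp
  then show ?thesis
    by (simp only: right_eval_diff right_eval_pCons[OF deg] right_eval_mult_left)
qed

text \<open>Extended by zero, so that degree bounds hold for every row index, as
  \<open>right_eval_char_mat\<close> demands.\<close>

definition char_adj :: "nat \<Rightarrow> (nat \<Rightarrow> nat \<Rightarrow> 'a::comm_ring_1) \<Rightarrow> nat \<Rightarrow> nat \<Rightarrow> 'a poly" where
  "char_adj d B i j = (if i < d \<and> j < d then adj_mat (char_mat d B) $$ (i, j) else 0)"

lemma char_mat_char_adj:
  assumes "i < d" "j < d"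
  shows "(\<Sum>k<d. char_mat d B $$ (i, k) * char_adj d B k j) = (if i = j then char_pol d B else 0)"
    and "(\<Sum>k<d. char_adj d B i k * char_mat d B $$ (k, j)) = (if i = j then char_pol d B else 0)"
proof -
  have "(\<Sum>k<d. char_mat d B $$ (i, k) * char_adj d B k j) = (\<Sum>k<d. char_mat d B $$ (i, k) * adj_mat (char_mat d B) $$ (k, j))"
    "(\<Sum>k<d. char_adj d B i k * char_mat d B $$ (k, j)) = (\<Sum>k<d. adj_mat (char_mat d B) $$ (i, k) * char_mat d B $$ (k, j))"
    using assms by (auto simp: char_adj_def intro!: sum.cong)
  then show "(\<Sum>k<d. char_mat d B $$ (i, k) * char_adj d B k j) = (if i = j then char_pol d B else 0)"
    and "(\<Sum>k<d. char_adj d B i k * char_mat d B $$ (k, j)) = (if i = j then char_pol d B else 0)"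
    by (simp_all only: adj_mat_mult_entry[OF char_mat_carrier assms] char_pol_def)
qed

text \<open>Both products of the adjugate with T - B are the same scalar matrix, and the two terms
  with T cancel.\<close>

lemma char_adj_comm:
  assumes "i < d" "j < d"
  shows "(\<Sum>k<d. [:B i k:] * char_adj d B k j) = (\<Sum>k<d. char_adj d B i k * [:B k j:])"
proof -
  have "pCons 0 (char_adj d B i j) - (\<Sum>k<d. [:B i k:] * char_adj d B k j) = pCons 0 (char_adj d B i j) - (\<Sum>k<d. char_adj d B i k * [:B k j:])"
    by (simp only: char_mat_mult_left[OF assms(1), symmetric] char_mat_mult_right[OF assms(2), symmetric] char_mat_char_adj[OF assms])
  then show ?thesis
    by (simp only: diff_left_imp_eq)
qed

lemma right_eval_char_adj_comm:
  assumes "i < d" "j < d"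
  shows "mmul d B (right_eval d n B (char_adj d B)) i j = mmul d (right_eval d n B (char_adj d B)) B i j"
proof -
  have "mmul d B (right_eval d n B (char_adj d B)) i j = right_eval d n B (\<lambda>i l. \<Sum>k<d. [:B i k:] * char_adj d B k l) i j"
    by (simp only: right_eval_mult_left)
  also have "\<dots> = right_eval d n B (\<lambda>i l. \<Sum>k<d. char_adj d B i k * [:B k l:]) i j"
    using assms by (intro right_eval_cong char_adj_comm)
  finally show ?thesis
    using assms by (simp only: right_eval_mult_right)
qed

lemma finite_degree_bound:
  fixes Q :: "nat \<Rightarrow> nat \<Rightarrow> 'a::zero poly"
  obtains n where "\<And>i l. i < d \<Longrightarrow> l < d \<Longrightarrow> degree (Q i l) < n"
proof
  fix i l assume "i < d" "l < d"
  then have "degree (Q i l) \<le> Max ((\<lambda>(i, l). degree (Q i l)) ` ({..<d} \<times> {..<d}))"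
    by (intro Max_ge) auto
  then show "degree (Q i l) < Suc (Max ((\<lambda>(i, l). degree (Q i l)) ` ({..<d} \<times> {..<d})))"
    by simp
qed

text \<open>Evaluate (T - B) adj (T - B) at T = B. The result is the commutator of \<open>B\<close>
  with the evaluated adjugate, and these two commute.\<close>

lemma cayley_hamilton_entry:
  obtains n where "\<And>i j. i < d \<Longrightarrow> j < d \<Longrightarrow> (\<Sum>m<n. coeff (char_pol d B) m * mpow d B m i j) = 0"
    "degree (char_pol d B) < n"
proof -
  obtain n0 where n0: "\<And>i l. i < d \<Longrightarrow> l < d \<Longrightarrow> degree (char_adj d B i l) < n0"
    using finite_degree_bound[of d "char_adj d B"] by blast
  define n where "n = Suc (max n0 (degree (char_pol d B)))"
  have deg: "degree (char_adj d B i l) < n" if "l < d" for i l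
    using n0[of i l] that by (cases "i < d") (auto simp: n_def char_adj_def)
  show thesis
  proof (rule that)
    show "degree (char_pol d B) < Suc n"
      by (simp add: n_def)
    fix i j assume ij: "i < d" "j < d"
    let ?W = "\<lambda>i j. if i = j then char_pol d B else 0"
    have "right_eval d (Suc n) B ?W i j = 0"
      using right_eval_char_mat[where W = ?W and Q = "char_adj d B" and d = d and B = B and i = i and j = j and n = n,
          OF char_mat_char_adj(1)[OF ij(1)] deg ij(1)] right_eval_char_adj_comm[OF ij, of B "Suc n"]
      by simp
    moreover have "right_eval d (Suc n) B ?W i j = (\<Sum>m<Suc n. coeff (char_pol d B) m * mpow d B m i j)"
      unfolding right_eval_def
    proof (rule sum.cong[OF refl])
      fix m
      have "(\<Sum>l<d. coeff (if i = l then char_pol d B else 0) m * mpow d B m l j)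
         = (\<Sum>l<d. if i = l then coeff (char_pol d B) m * mpow d B m l j else 0)"
        by (intro sum.cong) auto
      then show "(\<Sum>l<d. coeff (if i = l then char_pol d B else 0) m * mpow d B m l j) = coeff (char_pol d B) m * mpow d B m i j"
        using ij by simp
    qed
    ultimately show "(\<Sum>m<Suc n. coeff (char_pol d B) m * mpow d B m i j) = 0"
      by simp
  qed
qed

subsection \<open>Graded leading terms\<close>

text \<open>The coefficient \<open>t\<close> may be zero. Unlike a statement about
  \<open>lead_coeff\<close>, this survives sums in which leading terms cancel.\<close>

definition top_coeff :: "nat \<Rightarrow> 'a::comm_ring_1 poly \<Rightarrow> 'a \<Rightarrow> bool" where
  "top_coeff n p t \<longleftrightarrow> degree p \<le> n \<and> coeff p n = t"

lemma top_coeff_0: "top_coeff n 0 0"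
  by (simp add: top_coeff_def)

lemma top_coeff_1: "top_coeff 0 1 1"
  by (simp add: top_coeff_def)

lemma top_coeff_add: "top_coeff n p t \<Longrightarrow> top_coeff n q u \<Longrightarrow> top_coeff n (p + q) (t + u)"
  by (auto simp: top_coeff_def intro: degree_add_le)

lemma top_coeff_uminus: "top_coeff n p t \<Longrightarrow> top_coeff n (- p) (- t)"
  by (auto simp: top_coeff_def)

lemma top_coeff_diff: "top_coeff n p t \<Longrightarrow> top_coeff n q u \<Longrightarrow> top_coeff n (p - q) (t - u)"
  by (auto simp: top_coeff_def intro: degree_diff_le)

lemma top_coeff_mult:
  assumes "top_coeff n p t" "top_coeff m q u"
  shows "top_coeff (n + m) (p * q) (t * u)"
proof -
  have "coeff (p * q) (n + m) = (\<Sum>i\<le>n + m. if i = n then t * u else 0)"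
    unfolding coeff_mult
  proof (intro sum.cong refl)
    fix i assume "i \<in> {..n + m}"
    then show "coeff p i * coeff q (n + m - i) = (if i = n then t * u else 0)"
      using assms by (cases i n rule: linorder_cases) (auto simp: top_coeff_def coeff_eq_0)
  qed
  also have "\<dots> = t * u"
    by simp
  finally show ?thesis
    using assms degree_mult_le[of p q] by (auto simp: top_coeff_def)
qed

lemma top_coeff_sum: "(\<And>x. x \<in> A \<Longrightarrow> top_coeff n (p x) (t x)) \<Longrightarrow> top_coeff n (sum p A) (sum t A)"
  by (induction A rule: infinite_finite_induct) (auto intro: top_coeff_0 top_coeff_add)

lemma top_coeff_prod: "(\<And>x. x \<in> A \<Longrightarrow> top_coeff n (p x) (t x)) \<Longrightarrow> top_coeff (n * card A) (prod p A) (prod t A)"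
proof (induction A rule: infinite_finite_induct)
  case (insert x A)
  then have "top_coeff (n + n * card A) (p x * prod p A) (t x * prod t A)"
    by (intro top_coeff_mult) auto
  with insert.hyps show ?case
    by simp
qed (auto intro: top_coeff_1)

lemma top_coeff_signof: "top_coeff 0 (signof p) (signof p)"
  by (auto simp: sign_def intro: top_coeff_1 top_coeff_uminus)

lemma top_coeff_det:
  assumes "\<And>i j. i < n \<Longrightarrow> j < n \<Longrightarrow> top_coeff K (E i j) (t i j)"
  shows "top_coeff (K * n) (det (mat n n (\<lambda>(i, j). E i j))) (det (mat n n (\<lambda>(i, j). t i j)))"
  unfolding det_mat_expand
proof (rule top_coeff_sum)
  fix p assume "p \<in> {p. p permutes {0..<n}}"
  then have "top_coeff (0 + K * card {0..<n}) (signof p * (\<Prod>i = 0..<n. E i (p i))) (signof p * (\<Prod>i = 0..<n. t i (p i)))"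
    by (intro top_coeff_mult top_coeff_signof top_coeff_prod assms) (auto simp: permutes_in_image)
  then show "top_coeff (K * n) (signof p * (\<Prod>i = 0..<n. E i (p i))) (signof p * (\<Prod>i = 0..<n. t i (p i)))"
    by simp
qed

text \<open>In \<open>top_form K e g h\<close> the variable \<open>T\<close> has weight 1 and \<open>X\<close> has weight \<open>1 / K\<close>: \<open>g\<close> has weighted
  degree at most \<open>e\<close>, and \<open>h\<close> is its leading form at \<open>X = 1\<close>.\<close>

definition top_form :: "nat \<Rightarrow> nat \<Rightarrow> 'a::comm_ring_1 poly poly \<Rightarrow> 'a poly \<Rightarrow> bool" where
  "top_form K e g h \<longleftrightarrow> (\<forall>i>e. coeff g i = 0 \<and> coeff h i = 0) \<and> (\<forall>i\<le>e. top_coeff (K * (e - i)) (coeff g i) (coeff h i))"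

lemma top_form_0: "top_form K e 0 0"
  by (simp add: top_form_def top_coeff_0)

lemma top_form_1: "top_form K 0 1 1"
  by (simp add: top_form_def top_coeff_1)

lemma top_form_add: "top_form K e g h \<Longrightarrow> top_form K e g' h' \<Longrightarrow> top_form K e (g + g') (h + h')"
  by (simp add: top_form_def top_coeff_add)

lemma top_form_diff: "top_form K e g h \<Longrightarrow> top_form K e g' h' \<Longrightarrow> top_form K e (g - g') (h - h')"
  by (simp add: top_form_def top_coeff_diff)

lemma top_form_uminus: "top_form K e g h \<Longrightarrow> top_form K e (- g) (- h)"
  by (simp add: top_form_def top_coeff_uminus)

lemma top_form_mult:
  assumes "top_form K e g h" "top_form K e' g' h'"
  shows "top_form K (e + e') (g * g') (h * h')"
  unfolding top_form_def
proof (intro conjI allI impI)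
  fix i
  have zero: "coeff g a * coeff g' (i - a) = 0" "coeff h a * coeff h' (i - a) = 0"
    if "a > e \<or> i - a > e'" for a
    using assms that by (auto simp: top_form_def)
  show "coeff (g * g') i = 0" "coeff (h * h') i = 0" if "i > e + e'"
  proof -
    have "a > e \<or> i - a > e'" for a
      using that by linarith
    then show "coeff (g * g') i = 0" "coeff (h * h') i = 0"
      unfolding coeff_mult using zero by (auto intro!: sum.neutral)
  qed
  show "top_coeff (K * (e + e' - i)) (coeff (g * g') i) (coeff (h * h') i)" if "i \<le> e + e'"
    unfolding coeff_mult
  proof (rule top_coeff_sum)
    fix a assume a: "a \<in> {..i}"
    show "top_coeff (K * (e + e' - i)) (coeff g a * coeff g' (i - a)) (coeff h a * coeff h' (i - a))"
    proof (cases "a > e \<or> i - a > e'")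
      case True
      with zero[of a] show ?thesis
        by (simp add: top_coeff_0)
    next
      case False
      then have "top_coeff (K * (e - a) + K * (e' - (i - a))) (coeff g a * coeff g' (i - a)) (coeff h a * coeff h' (i - a))"
        using assms by (intro top_coeff_mult) (auto simp: top_form_def)
      moreover have "e - a + (e' - (i - a)) = e + e' - i"
        using False a by auto
      then have "K * (e - a) + K * (e' - (i - a)) = K * (e + e' - i)"
        by (metis distrib_left)
      ultimately show ?thesis
        by simp
    qed
  qed
qed

lemma top_form_sum: "(\<And>x. x \<in> A \<Longrightarrow> top_form K e (g x) (h x)) \<Longrightarrow> top_form K e (sum g A) (sum h A)"
  by (induction A rule: infinite_finite_induct) (auto intro: top_form_0 top_form_add)

lemma top_form_prod: "(\<And>x. x \<in> A \<Longrightarrow> top_form K 1 (g x) (h x)) \<Longrightarrow> top_form K (card A) (prod g A) (prod h A)"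
proof (induction A rule: infinite_finite_induct)
  case (insert x A)
  then have "top_form K (1 + card A) (g x * prod g A) (h x * prod h A)"
    by (intro top_form_mult) auto
  with insert.hyps show ?case
    by simp
qed (auto intro: top_form_1)

lemma top_form_signof: "top_form K 0 (signof p) (signof p)"
  by (auto simp: sign_def intro: top_form_1 top_form_uminus)

lemma top_form_det:
  assumes "\<And>i j. i < n \<Longrightarrow> j < n \<Longrightarrow> top_form K 1 (E i j) (t i j)"
  shows "top_form K n (det (mat n n (\<lambda>(i, j). E i j))) (det (mat n n (\<lambda>(i, j). t i j)))"
  unfolding det_mat_expand
proof (rule top_form_sum)
  fix p assume "p \<in> {p. p permutes {0..<n}}"
  then have "top_form K (0 + card {0..<n}) (signof p * (\<Prod>i = 0..<n. E i (p i))) (signof p * (\<Prod>i = 0..<n. t i (p i)))"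
    by (intro top_form_mult top_form_signof top_form_prod assms) (auto simp: permutes_in_image)
  then show "top_form K n (signof p * (\<Prod>i = 0..<n. E i (p i))) (signof p * (\<Prod>i = 0..<n. t i (p i)))"
    by simp
qed

lemma top_form_char_mat_entry:
  assumes "top_coeff K b t"
  shows "top_form K 1 ((if c then [:0, 1:] else 0) - [:b:]) ((if c then [:0, 1:] else 0) - [:t:])"
proof (rule top_form_diff)
  show "top_form K 1 (if c then [:0, 1:] else 0) (if c then [:0, 1:] else 0)"
    by (auto simp: top_form_def top_coeff_def coeff_pCons split: nat.splits)
  show "top_form K 1 [:b:] [:t:]"
    using assms by (auto simp: top_form_def top_coeff_def coeff_pCons split: nat.splits)
qed

lemma top_form_char_pol:
  assumes "\<And>i j. i < d \<Longrightarrow> j < d \<Longrightarrow> top_coeff K (B i j) (D i j)"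
  shows "top_form K d (char_pol d B) (char_pol d D)"
  unfolding char_pol_def char_mat_def by (intro top_form_det top_form_char_mat_entry assms)

lemma top_form_char_adj:
  assumes "\<And>i j. i < d \<Longrightarrow> j < d \<Longrightarrow> top_coeff K (B i j) (D i j)"
  shows "top_form K (d - 1) (char_adj d B i j) (char_adj d D i j)"
proof (cases "i < d \<and> j < d")
  case True
  have s: "top_form K 0 ((- 1) ^ m) ((- 1) ^ m)" for m
  proof (induction m)
    case (Suc m)
    from top_form_mult[OF top_form_uminus[OF top_form_1] this] show ?case
      by simp
  qed (simp add: top_form_1)
  \<comment> \<open>\<open>u\<close> and \<open>v\<close> skip the deleted row \<open>j\<close> and
    column \<open>i\<close>; the cofactor is a minor of order \<open>d - 1\<close> with entries of
    weight 1.\<close>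
  define u where "u = (\<lambda>k. if k < j then k else Suc k)"
  define v where "v = (\<lambda>k. if k < i then k else Suc k)"
  let ?e = "\<lambda>B i' j'. (if u i' = v j' then [:0, 1:] else 0) - [:B (u i') (v j'):]"
  have "top_form K (d - 1) (det (mat (d - 1) (d - 1) (\<lambda>(i', j'). ?e B i' j')))
    (det (mat (d - 1) (d - 1) (\<lambda>(i', j'). ?e D i' j')))"
    by (intro top_form_det top_form_char_mat_entry assms) (auto simp: u_def v_def)
  from top_form_mult[OF s[of "j + i"] this] True show ?thesis
    unfolding char_adj_def char_mat_def u_def v_def by (simp add: adj_mat_entry)
qed (auto simp: char_adj_def top_form_0)

subsection \<open>Null directions of the characteristic polynomial are commutators\<close>

lemma det_diag:
  "det (mat n n (\<lambda>(i, j). if i = j then a i else 0)) = (\<Prod>i<n. a i)"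
proof -
  have "det (mat n n (\<lambda>(i, j). if i = j then a i else 0))
      = prod_list (diag_mat (mat n n (\<lambda>(i, j). if i = j then a i else 0)))"
    by (rule det_upper_triangular) (auto simp: upper_triangular_def)
  also have "\<dots> = (\<Prod>i<n. a i)"
    by (simp add: diag_mat_def prod.list_conv_set_nth atLeast0LessThan)
  finally show ?thesis .
qed

lemma char_pol_diag: "char_pol d (\<lambda>i j. if i = j then r i else 0) = (\<Prod>i<d. [:- r i, 1:])"
proof -
  have "char_mat d (\<lambda>i j. if i = j then r i else 0) = mat d d (\<lambda>(i, j). if i = j then [:- r i, 1:] else 0)"
    by (auto simp: char_mat_def)
  then show ?thesis
    by (simp only: char_pol_def det_diag)
qed

text \<open>No minors are computed: row \<open>i\<close> of (T - D) adj (T - D) = char_pol I has the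
  single factor T - r i, which cancels.\<close>

lemma char_adj_diag:
  fixes r :: "nat \<Rightarrow> 'a::idom"
  assumes "i < d" "j < d"
  shows "char_adj d (\<lambda>i j. if i = j then r i else 0) i j = (if i = j then \<Prod>k\<in>{..<d} - {i}. [:- r k, 1:] else 0)"
proof -
  define D where "D = (\<lambda>i j. if i = j then r i else 0)"
  define L where "L = [:- r i, 1:]"
  have nz: "L \<noteq> 0"
    by (simp add: L_def)
  have "char_mat d D $$ (i, k) = (if i = k then L else 0)" if "k < d" for k
    using assms that by (simp add: D_def L_def)
  then have "(\<Sum>k<d. char_mat d D $$ (i, k) * char_adj d D k j) = (\<Sum>k<d. if i = k then L * char_adj d D i j else 0)"
    by (intro sum.cong) auto
  also have "\<dots> = L * char_adj d D i j"
    using assms by (simp only: sum.delta'[OF finite_lessThan] lessThan_iff if_True)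
  finally have *: "L * char_adj d D i j = (if i = j then char_pol d D else 0)"
    using char_mat_char_adj(1)[OF assms, of D] by (simp only:)
  show ?thesis
  proof (cases "i = j")
    case True
    have "char_pol d D = L * (\<Prod>k\<in>{..<d} - {i}. [:- r k, 1:])"
      unfolding D_def char_pol_diag L_def using assms by (intro prod.remove) auto
    from *[unfolded if_P[OF True]] this have "L * char_adj d D i j = L * (\<Prod>k\<in>{..<d} - {i}. [:- r k, 1:])"
      by (rule trans)
    then have "char_adj d D i j = (\<Prod>k\<in>{..<d} - {i}. [:- r k, 1:])"
      by (rule mult_left_cancel[OF nz, THEN iffD1])
    then show ?thesis
      unfolding if_P[OF True] D_def .
  next
    case False
    from *[unfolded if_not_P[OF False]] nz have "char_adj d D i j = 0"
      by (metis mult_eq_0_iff)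
    then show ?thesis
      unfolding if_not_P[OF False] D_def .
  qed
qed

lemma top_coeff_mpow:
  assumes "\<And>i j. i < d \<Longrightarrow> j < d \<Longrightarrow> top_coeff K (B i j) (D i j)" and "i < d" "j < d"
  shows "top_coeff (K * m) (mpow d B m i j) (mpow d D m i j)"
  using assms(2,3)
proof (induction m arbitrary: i j)
  case (Suc m)
  have "top_coeff (K * m + K) (mpow d B (Suc m) i j) (mpow d D (Suc m) i j)"
    unfolding mpow.simps mmul_def by (intro top_coeff_sum top_coeff_mult Suc assms) (use Suc.prems in auto)
  then show ?case
    by (simp add: add.commute)
qed (auto intro: top_coeff_0 top_coeff_1)

lemma mpow_diag:
  "i < d \<Longrightarrow> j < d \<Longrightarrow> mpow d (\<lambda>i j. if i = j then r i else 0) m i j = (if i = j then r i ^ m else 0)"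
proof (induction m arbitrary: i j)
  case (Suc m)
  have "mpow d (\<lambda>i j. if i = j then r i else 0) (Suc m) i j = (\<Sum>k<d. if k = j then (if i = j then r i ^ Suc m else 0) else 0)"
    unfolding mpow.simps mmul_def using Suc by (intro sum.cong) auto
  with Suc.prems show ?case
    by simp
qed simp

text \<open>The coefficient of T^m in the adjugate has degree at most K (d - 1 - m) in X, and B^m
  has degree at most K m. The sum is the same for every m, so the top coefficient is the evaluated
  adjugate of the diagonal matrix of leading coefficients.\<close>

lemma top_coeff_right_eval_char_adj:
  fixes B :: "nat \<Rightarrow> nat \<Rightarrow> 'a::idom poly"
  assumes top: "\<And>i j. i < d \<Longrightarrow> j < d \<Longrightarrow> top_coeff K (B i j) (if i = j then r i else 0)"
    and n: "n \<ge> d" and ij: "i < d" "j < d"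
  shows "top_coeff (K * (d - 1)) (right_eval d n B (char_adj d B) i j) (if i = j then \<Prod>k\<in>{..<d} - {i}. (r i - r k) else 0)"
proof -
  define D where "D = (\<lambda>i j. if i = j then r i else 0)"
  have topD: "top_coeff K (B i j) (D i j)" if "i < d" "j < d" for i j
    using top[OF that] by (simp only: D_def)
  have T: "top_form K (d - 1) (char_adj d B i j) (char_adj d D i j)" for i j
    by (rule top_form_char_adj[OF topD])
  have d: "degree (char_adj d D i j) < n"
  proof -
    have "\<forall>m > d - 1. coeff (char_adj d D i j) m = 0"
      using T[of i j] unfolding top_form_def by blast
    then have "degree (char_adj d D i j) \<le> d - 1"
      by (intro degree_le) auto
    with n ij show ?thesis
      by simp
  qed
  have "top_coeff (K * (d - 1)) (right_eval d n B (char_adj d B) i j) (\<Sum>m<n. \<Sum>l<d. coeff (char_adj d D i l) m * mpow d D m l j)"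
    unfolding right_eval_def
  proof (intro top_coeff_sum)
    fix m l assume "m \<in> {..<n}" "l \<in> {..<d}"
    then have l: "l < d" by simp
    show "top_coeff (K * (d - 1)) (coeff (char_adj d B i l) m * mpow d B m l j) (coeff (char_adj d D i l) m * mpow d D m l j)"
    proof (cases "m \<le> d - 1")
      case True
      have "top_coeff (K * (d - 1 - m) + K * m) (coeff (char_adj d B i l) m * mpow d B m l j) (coeff (char_adj d D i l) m * mpow d D m l j)"
        using T[of i l] True
        by (intro top_coeff_mult top_coeff_mpow topD l ij) (auto simp: top_form_def)
      moreover have "K * (d - 1 - m) + K * m = K * (d - 1)"
        using True by (metis add_mult_distrib2 le_add_diff_inverse2)
      ultimately show ?thesis
        by simp
    next
      case False
      then have "coeff (char_adj d B i l) m = 0" "coeff (char_adj d D i l) m = 0"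
        using T[of i l] by (auto simp: top_form_def)
      then show ?thesis
        by (simp add: top_coeff_0)
    qed
  qed
  also have "(\<Sum>m<n. \<Sum>l<d. coeff (char_adj d D i l) m * mpow d D m l j) = (\<Sum>m<n. coeff (char_adj d D i j) m * r j ^ m)"
  proof (intro sum.cong refl)
    fix m
    have "(\<Sum>l<d. coeff (char_adj d D i l) m * mpow d D m l j) = (\<Sum>l<d. if l = j then coeff (char_adj d D i j) m * r j ^ m else 0)"
      using ij by (intro sum.cong) (auto simp: mpow_diag D_def)
    then show "(\<Sum>l<d. coeff (char_adj d D i l) m * mpow d D m l j) = coeff (char_adj d D i j) m * r j ^ m"
      using ij by simp
  qed
  also have "\<dots> = poly (char_adj d D i j) (r j)"
    unfolding poly_altdef using d
    by (intro sum.mono_neutral_right) (auto simp: coeff_eq_0)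
  also have "\<dots> = (if i = j then \<Prod>k\<in>{..<d} - {i}. (r i - r k) else 0)"
    using ij by (simp add: char_adj_diag poly_prod D_def)
  finally show ?thesis .
qed

text \<open>The coefficient in degree K (d - 1) d is the product of all r i - r k with i \<noteq> k,
  up to sign the discriminant of the leading form.\<close>

lemma det_right_eval_char_adj_nonzero:
  fixes B :: "nat \<Rightarrow> nat \<Rightarrow> 'a::idom poly"
  assumes top: "\<And>i j. i < d \<Longrightarrow> j < d \<Longrightarrow> top_coeff K (B i j) (if i = j then r i else 0)"
    and inj: "inj_on r {..<d}" and n: "n \<ge> d"
  shows "det (mat d d (\<lambda>(i, j). right_eval d n B (char_adj d B) i j)) \<noteq> 0"
proof -
  let ?t = "\<lambda>i. \<Prod>k\<in>{..<d} - {i}. (r i - r k)"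
  have "top_coeff (K * (d - 1) * d) (det (mat d d (\<lambda>(i, j). right_eval d n B (char_adj d B) i j)))
    (det (mat d d (\<lambda>(i, j). if i = j then ?t i else 0)))"
    by (intro top_coeff_det top_coeff_right_eval_char_adj top n)
  then have "coeff (det (mat d d (\<lambda>(i, j). right_eval d n B (char_adj d B) i j))) (K * (d - 1) * d) = (\<Prod>i<d. ?t i)"
    unfolding det_diag by (simp add: top_coeff_def)
  moreover have "(\<Prod>i<d. ?t i) \<noteq> 0"
    using inj by (auto simp: inj_on_def)
  ultimately show ?thesis
    by auto
qed

lemma mmul_cong:
  assumes "\<And>k. k < d \<Longrightarrow> A i k = A' i k" "\<And>k. k < d \<Longrightarrow> B k j = B' k j"
  shows "mmul d A B i j = mmul d A' B' i j"
  using assms by (simp add: mmul_def)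

lemma mmul_scal_right: "mmul d A (\<lambda>i j. if i = j then q else 0) i j = (if j < d then A i j * q else 0)"
proof -
  have "mmul d A (\<lambda>i j. if i = j then q else 0) i j = (\<Sum>k<d. if k = j then A i j * q else 0)"
    unfolding mmul_def by (intro sum.cong) auto
  then show ?thesis
    by simp
qed

lemma mmul_scal_left: "mmul d (\<lambda>i j. if i = j then q else 0) A i j = (if i < d then q * A i j else 0)"
proof -
  have "mmul d (\<lambda>i j. if i = j then q else 0) A i j = (\<Sum>k<d. if i = k then q * A i j else 0)"
    unfolding mmul_def by (intro sum.cong) auto
  then show ?thesis
    by simp
qed

text \<open>The adjugate of \<open>P\<close> replaces its inverse. It commutes with \<open>B\<close>
  because A (B P) A = A (P B) A reads q A B = q B A, and \<open>q\<close> cancels.\<close>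

lemma adj_fun:
  fixes d :: nat and P :: "nat \<Rightarrow> nat \<Rightarrow> 'a::idom"
  defines "q \<equiv> det (mat d d (\<lambda>(i, j). P i j))"
  assumes q: "q \<noteq> 0"
    and comm: "\<And>i j. i < d \<Longrightarrow> j < d \<Longrightarrow> mmul d B P i j = mmul d P B i j"
  shows "\<exists>A. \<forall>i<d. \<forall>j<d. mmul d P A i j = (if i = j then q else 0) \<and> mmul d B A i j = mmul d A B i j"
proof -
  define M where "M = mat d d (\<lambda>(i, j). P i j)"
  define A where "A = (\<lambda>i j. adj_mat M $$ (i, j))"
  have M: "M \<in> carrier_mat d d"
    by (simp add: M_def)
  have PA: "mmul d P A i j = (if i = j then q else 0)" if "i < d" "j < d" for i j
    using adj_mat_mult_entry(1)[OF M that] that by (simp add: mmul_def A_def M_def q_def)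
  have AP: "mmul d A P i j = (if i = j then q else 0)" if "i < d" "j < d" for i j
    using adj_mat_mult_entry(2)[OF M that] that by (simp add: mmul_def A_def M_def q_def)
  show ?thesis
  proof (intro exI allI impI conjI)
    fix i j assume ij: "i < d" "j < d"
    show "mmul d P A i j = (if i = j then q else 0)"
      by (rule PA[OF ij])
    have "mmul d (mmul d A (mmul d B P)) A i j = mmul d (mmul d A B) (mmul d P A) i j"
      by (simp add: mmul_assoc)
    also have "\<dots> = mmul d (mmul d A B) (\<lambda>i j. if i = j then q else 0) i j"
      using ij by (intro mmul_cong PA) auto
    also have "\<dots> = q * mmul d A B i j"
      using ij by (simp add: mmul_scal_right)
    finally have 1: "mmul d (mmul d A (mmul d B P)) A i j = q * mmul d A B i j" .
    have "mmul d (mmul d A (mmul d B P)) A i j = mmul d (mmul d A (mmul d P B)) A i j"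
      using ij by (intro mmul_cong comm refl) auto
    also have "\<dots> = mmul d (mmul d A P) (mmul d B A) i j"
      by (simp add: mmul_assoc)
    also have "\<dots> = mmul d (\<lambda>i j. if i = j then q else 0) (mmul d B A) i j"
      using ij by (intro mmul_cong AP) auto
    also have "\<dots> = q * mmul d B A i j"
      using ij by (simp add: mmul_scal_left)
    finally show "mmul d B A i j = mmul d A B i j"
      using 1 q by simp
  qed
qed

text \<open>Substituting \<open>T = B\<close> from the right in \<open>(T - B) R' = N adj (T - B)\<close> gives \<open>N P = Y B - B Y\<close>, where
  \<open>P\<close> commutes with \<open>B\<close>. The leading term of \<open>P\<close> is diagonal with entries \<open>h'(r i)\<close>, so \<open>P\<close> is
  invertible over the rational functions.\<close>

lemma null_direction_commutator:
  fixes B N :: "nat \<Rightarrow> nat \<Rightarrow> real poly"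
  assumes null: "line_deriv (\<lambda>s. char_pol d (\<lambda>i j. B i j + smult s (N i j))) 0"
    and top: "\<And>i j. i < d \<Longrightarrow> j < d \<Longrightarrow> top_coeff K (B i j) (if i = j then r i else 0)"
    and inj: "inj_on r {..<d}"
  obtains q Z where "q \<noteq> 0"
    "\<And>i j. i < d \<Longrightarrow> j < d \<Longrightarrow> q * N i j = mmul d Z B i j - mmul d B Z i j"
proof -
  obtain R' where R': "\<And>i j. i < d \<Longrightarrow> j < d \<Longrightarrow>
    (\<Sum>k<d. char_mat d B $$ (i, k) * R' k j) = (\<Sum>k<d. [:N i k:] * adj_mat (char_mat d B) $$ (k, j))"
    using line_deriv_adj[OF null] by blast
  define R where "R = (\<lambda>i j. if i < d \<and> j < d then R' i j else 0)"
  have R: "(\<Sum>k<d. char_mat d B $$ (i, k) * R k j) = (\<Sum>k<d. [:N i k:] * char_adj d B k j)"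
    if "i < d" "j < d" for i j
  proof -
    have "(\<Sum>k<d. char_mat d B $$ (i, k) * R k j) = (\<Sum>k<d. char_mat d B $$ (i, k) * R' k j)"
      "(\<Sum>k<d. [:N i k:] * adj_mat (char_mat d B) $$ (k, j)) = (\<Sum>k<d. [:N i k:] * char_adj d B k j)"
      using that by (auto simp: R_def char_adj_def intro!: sum.cong)
    with R'[OF that] show ?thesis
      by simp
  qed
  obtain n0 where n0: "\<And>i l. i < d \<Longrightarrow> l < d \<Longrightarrow> degree (R i l) < n0"
    using finite_degree_bound[of d R] by blast
  define n where "n = Suc (max n0 d)"
  have deg: "degree (R i l) < n" if "l < d" for i l
    using n0[of i l] that by (cases "i < d") (auto simp: n_def R_def)
  define P where "P = right_eval d (Suc n) B (char_adj d B)"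
  define Y where "Y = right_eval d (Suc n) B R"
  have NP: "mmul d N P i j = mmul d Y B i j - mmul d B Y i j" if "i < d" "j < d" for i j
  proof -
    have "mmul d N P i j = right_eval d (Suc n) B (\<lambda>i l. \<Sum>k<d. [:N i k:] * char_adj d B k l) i j"
      by (simp only: P_def right_eval_mult_left)
    also have "\<dots> = mmul d Y B i j - mmul d B Y i j"
      unfolding Y_def by (rule right_eval_char_mat) (use R deg that in auto)
    finally show ?thesis .
  qed
  have BP: "mmul d B P i j = mmul d P B i j" if "i < d" "j < d" for i j
    unfolding P_def by (rule right_eval_char_adj_comm[OF that])
  define q where "q = det (mat d d (\<lambda>(i, j). P i j))"
  have q: "q \<noteq> 0"
    unfolding q_def P_def by (rule det_right_eval_char_adj_nonzero[OF top inj]) (auto simp: n_def)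
  obtain A where A: "\<forall>i<d. \<forall>j<d. mmul d P A i j = (if i = j then q else 0) \<and> mmul d B A i j = mmul d A B i j"
    using adj_fun[of d P, folded q_def, OF q BP] by blast
  then have PA: "mmul d P A i j = (if i = j then q else 0)" and AB: "mmul d B A i j = mmul d A B i j"
    if "i < d" "j < d" for i j
    using that by blast+
  \<comment> \<open>The commutator is taken with Z = Y A: from q N = N P A = (Y B - B Y) A, moving
    \<open>A\<close> past \<open>B\<close> gives (Y A) B - B (Y A).\<close>
  show thesis
  proof (rule that[OF q])
    fix i j assume ij: "i < d" "j < d"
    have "q * N i j = mmul d N (\<lambda>i j. if i = j then q else 0) i j"
      using ij by (simp add: mmul_scal_right)
    also have "\<dots> = mmul d N (mmul d P A) i j"
      using ij by (intro mmul_cong PA[symmetric]) auto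
    also have "\<dots> = mmul d (mmul d N P) A i j"
      by (simp add: mmul_assoc)
    also have "\<dots> = mmul d (\<lambda>i j. mmul d Y B i j - mmul d B Y i j) A i j"
      using ij by (intro mmul_cong NP) auto
    also have "\<dots> = mmul d (mmul d Y B) A i j - mmul d (mmul d B Y) A i j"
      by (simp add: mmul_def[of d _ A] left_diff_distrib sum_subtractf)
    also have "mmul d (mmul d Y B) A i j = mmul d Y (mmul d A B) i j"
      unfolding mmul_assoc using ij by (intro mmul_cong AB) auto
    finally show "q * N i j = mmul d (mmul d Y A) B i j - mmul d B (mmul d Y A) i j"
      by (simp add: mmul_assoc)
  qed
qed

text \<open>As \<open>B\<close> and \<open>N\<close> are symmetric, transposing q N = Z B - B Z
  gives q N = B Z^T - Z^T B. The sum of the two equations has the skew matrix Z - Z^T and the factor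
  \<open>q + q\<close>.\<close>

lemma null_direction_skew:
  fixes B N :: "nat \<Rightarrow> nat \<Rightarrow> real poly"
  assumes null: "line_deriv (\<lambda>s. char_pol d (\<lambda>i j. B i j + smult s (N i j))) 0"
    and top: "\<And>i j. i < d \<Longrightarrow> j < d \<Longrightarrow> top_coeff K (B i j) (if i = j then r i else 0)"
    and inj: "inj_on r {..<d}"
    and sym: "\<And>i j. B i j = B j i" "\<And>i j. N i j = N j i"
  obtains q W where "q \<noteq> 0" "\<And>i j. W i j = - W j i"
    "\<And>i j. i < d \<Longrightarrow> j < d \<Longrightarrow> q * N i j = mmul d W B i j - mmul d B W i j"
proof -
  obtain q Z where q: "q \<noteq> 0" and Z: "\<And>i j. i < d \<Longrightarrow> j < d \<Longrightarrow> q * N i j = mmul d Z B i j - mmul d B Z i j"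
    using null_direction_commutator[OF null top inj] by blast
  define W where "W = (\<lambda>i j. Z i j - Z j i)"
  show thesis
  proof (rule that)
    show "q + q \<noteq> 0"
      using q by (simp add: mult_2[symmetric] del: mult_2)
    show "W i j = - W j i" for i j
      by (simp add: W_def)
    fix i j assume ij: "i < d" "j < d"
    have B: "B j k = B k j" for k
      by (rule sym(1))
    have "mmul d W B i j - mmul d B W i j = (mmul d Z B i j - mmul d B Z i j) + (mmul d Z B j i - mmul d B Z j i)"
      by (simp add: mmul_def W_def left_diff_distrib right_diff_distrib sum_subtractf mult.commute sym(1)[of _ i] sym(1)[of _ j])
    also have "\<dots> = q * N i j + q * N j i"
      using Z[OF ij] Z[OF ij(2,1)] by simp
    finally show "(q + q) * N i j = mmul d W B i j - mmul d B W i j"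
      by (simp add: distrib_right sym(2)[of j i])
  qed
qed

section \<open>Skew matrices commuting with a symmetric matrix, and cancellation of
  denominators\<close>

lemma char_pol_char_poly: "char_pol d B = char_poly (mat d d (\<lambda>(i, j). B i j))"
proof -
  have "char_mat d B = char_poly_matrix (mat d d (\<lambda>(i, j). B i j))"
    by (auto simp: char_mat_def char_poly_matrix_def)
  then show ?thesis
    by (simp add: char_pol_def char_poly_def)
qed

lemma char_pol_monic: "degree (char_pol d B) = d" "coeff (char_pol d B) d = 1"
  using degree_monic_char_poly[of "mat d d (\<lambda>(i, j). B i j)" d] by (simp_all add: char_pol_char_poly)

text \<open>Take a polynomial \<open>p\<close> of minimal degree with \<open>W p(B) = 0\<close> and a root \<open>z\<close> of it,
  \<open>p = (T - z) g\<close>; then \<open>W g(B)\<close> is skew and consists of eigenvectors for \<open>z\<close>.\<close>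

lemma skew_commuting_zero:
  fixes B W :: "nat \<Rightarrow> nat \<Rightarrow> complex"
  assumes sym: "\<And>i j. i < d \<Longrightarrow> j < d \<Longrightarrow> B i j = B j i"
    and skew: "\<And>i j. i < d \<Longrightarrow> j < d \<Longrightarrow> W i j = - W j i"
    and comm: "\<And>i j. i < d \<Longrightarrow> j < d \<Longrightarrow> mmul d W B i j = mmul d B W i j"
    and reg: "\<And>z S. (\<And>i j. i < d \<Longrightarrow> j < d \<Longrightarrow> S i j = - S j i) \<Longrightarrow>
      (\<And>i j. i < d \<Longrightarrow> j < d \<Longrightarrow> mmul d B S i j = z * S i j) \<Longrightarrow> \<forall>i<d. \<forall>j<d. S i j = 0"
    and ab: "a < d" "b < d"
  shows "W a b = 0"
proof (rule ccontr)
  assume Wab: "W a b \<noteq> 0"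
  \<comment> \<open>\<open>V m\<close> is W B^m. It stays skew because \<open>W\<close> commutes
    with the symmetric matrix \<open>B\<close>.\<close>
  define V where "V = (\<lambda>m. mmul d W (mpow d B m))"
  have V0: "V 0 i j = W i j" if "j < d" for i j
    using that by (simp add: V_def mmul_scal_right)
  have VS: "V (Suc m) = mmul d (V m) B" for m
    by (simp add: V_def mmul_assoc)
  have V: "V m i j = - V m j i \<and> mmul d (V m) B i j = mmul d B (V m) i j" if "i < d" "j < d" for m i j
    using that
  proof (induction m arbitrary: i j)
    case 0
    have "mmul d (V 0) B i j = mmul d W B i j" "mmul d B (V 0) i j = mmul d B W i j"
      using 0 V0 by (auto intro!: mmul_cong)
    then show ?case
      using 0 V0[of j i] V0[of i j] skew[OF 0] comm[OF 0] by simp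
  next
    case (Suc m)
    have "mmul d (V m) B i j = - mmul d B (V m) j i"
    proof -
      have "mmul d (V m) B i j = (\<Sum>k<d. - (B j k * V m k i))"
        unfolding mmul_def
      proof (intro sum.cong refl)
        fix k assume "k \<in> {..<d}"
        then show "V m i k * B k j = - (B j k * V m k i)"
          using Suc.IH[of i k] Suc.prems sym[of k j] by simp
      qed
      then show ?thesis
        by (simp add: mmul_def sum_negf)
    qed
    then have 1: "V (Suc m) i j = - V (Suc m) j i"
      using Suc.IH[OF Suc.prems(2,1)] by (simp add: VS)
    have "mmul d (V (Suc m)) B i j = mmul d (mmul d B (V m)) B i j"
      unfolding VS by (rule mmul_cong) (use Suc.IH[THEN conjunct2] Suc.prems in blast)+
    also have "\<dots> = mmul d B (V (Suc m)) i j"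
      by (simp add: VS mmul_assoc)
    finally show ?case
      using 1 by simp
  qed
  \<comment> \<open>\<open>act p\<close> is the matrix W p(B).\<close>
  define act where "act = (\<lambda>p i j. \<Sum>m\<le>degree p. coeff p m * V m i j)"
  have act: "act p i j = (\<Sum>m<n. coeff p m * V m i j)" if "degree p < n" for p n i j
    unfolding act_def using that by (intro sum.mono_neutral_left) (auto simp: coeff_eq_0)
  define Q where "Q = (\<lambda>p. p \<noteq> 0 \<and> (\<forall>i<d. \<forall>j<d. act p i j = 0))"
  have "Q (char_pol d B)"
  proof -
    obtain n where n: "\<And>i j. i < d \<Longrightarrow> j < d \<Longrightarrow> (\<Sum>m<n. coeff (char_pol d B) m * mpow d B m i j) = 0"
      "degree (char_pol d B) < n"
      using cayley_hamilton_entry[of d B] by blast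
    have "act (char_pol d B) i j = 0" if "i < d" "j < d" for i j
    proof -
      have "act (char_pol d B) i j = (\<Sum>m<n. \<Sum>k<d. W i k * (coeff (char_pol d B) m * mpow d B m k j))"
        unfolding act[OF n(2)] V_def mmul_def by (simp add: sum_distrib_left mult_ac)
      also have "\<dots> = (\<Sum>k<d. W i k * (\<Sum>m<n. coeff (char_pol d B) m * mpow d B m k j))"
        by (subst sum.swap) (simp add: sum_distrib_left)
      also have "\<dots> = 0"
        using n(1) that by simp
      finally show ?thesis .
    qed
    moreover have "char_pol d B \<noteq> 0"
      using char_pol_monic(2)[of d B] by auto
    ultimately show ?thesis
      by (simp add: Q_def)
  qed
  then obtain p where p: "Q p" and min: "\<And>g. degree g < degree p \<Longrightarrow> \<not> Q g"
    using ex_has_least_nat[of Q "char_pol d B" degree] by (metis leD)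
  have "degree p \<noteq> 0"
  proof
    assume d0: "degree p = 0"
    then have "act p a b = coeff p 0 * W a b"
      using V0 ab by (simp add: act_def)
    moreover have "coeff p 0 \<noteq> 0"
      using p d0 leading_coeff_neq_0[of p] by (simp add: Q_def)
    ultimately show False
      using p Wab ab by (auto simp: Q_def)
  qed
  then have "\<not> constant (poly p)"
    by (simp add: constant_degree)
  then obtain z where "poly p z = 0"
    using fundamental_theorem_of_algebra by blast
  then obtain g where g: "p = [:- z, 1:] * g"
    by (auto simp: poly_eq_0_iff_dvd)
  have g0: "g \<noteq> 0"
    using p g by (auto simp: Q_def)
  have dg: "degree p = Suc (degree g)"
    unfolding g using g0 by (subst degree_mult_eq) auto
  define n where "n = Suc (degree g)"
  let ?S = "act g"
  have S: "?S i j = (\<Sum>m<n. coeff g m * V m i j)" for i j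
    by (rule act) (simp add: n_def)
  have "act p i j = mmul d ?S B i j - z * ?S i j" for i j
  proof -
    have "act p i j = (\<Sum>m<Suc n. coeff p m * V m i j)"
      by (rule act) (simp add: n_def dg)
    also have "\<dots> = (\<Sum>m<Suc n. coeff (pCons 0 g) m * V m i j) - (\<Sum>m<Suc n. z * coeff g m * V m i j)"
      unfolding sum_subtractf[symmetric] by (intro sum.cong refl) (simp add: g algebra_simps)
    also have "(\<Sum>m<Suc n. coeff (pCons 0 g) m * V m i j) = (\<Sum>m<n. coeff g m * V (Suc m) i j)"
      by (subst sum.lessThan_Suc_shift) simp
    also have "(\<Sum>m<Suc n. z * coeff g m * V m i j) = z * ?S i j"
      by (simp add: S sum_distrib_left mult.assoc n_def coeff_eq_0 distrib_left)
    also have "(\<Sum>m<n. coeff g m * V (Suc m) i j) = mmul d ?S B i j"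
      unfolding VS mmul_def S sum_distrib_left sum_distrib_right by (subst sum.swap) (simp add: mult.assoc)
    finally show ?thesis .
  qed
  then have SB: "mmul d ?S B i j = z * ?S i j" if "i < d" "j < d" for i j
    using p that by (simp add: Q_def)
  have "\<forall>i<d. \<forall>j<d. ?S i j = 0"
  proof (rule reg)
    fix i j assume ij: "i < d" "j < d"
    have "?S i j = (\<Sum>m<n. - (coeff g m * V m j i))"
      unfolding S using V[OF ij, THEN conjunct1] by (intro sum.cong refl) simp
    then show "?S i j = - ?S j i"
      by (simp add: S sum_negf)
    have "mmul d B ?S i j = (\<Sum>m<n. coeff g m * mmul d B (V m) i j)"
      unfolding mmul_def S sum_distrib_left by (subst sum.swap) (simp add: mult_ac)
    also have "\<dots> = (\<Sum>m<n. coeff g m * mmul d (V m) B i j)"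
      using V[OF ij, THEN conjunct2] by simp
    also have "\<dots> = mmul d ?S B i j"
      unfolding mmul_def S sum_distrib_left sum_distrib_right by (subst sum.swap) (simp add: mult_ac)
    finally show "mmul d B ?S i j = z * ?S i j"
      using SB ij by simp
  qed
  then have "Q g"
    using g0 by (simp add: Q_def)
  with min[of g] dg show False
    by simp
qed

text \<open>This says that every eigenspace of every B(x) has dimension at most one: the columns of
  \<open>S\<close> are eigenvectors, a nonzero skew matrix has rank at least 2, and independent
  eigenvectors u, v yield the skew matrix u v^T - v u^T. The skew form is what the commutator
  argument and the recurrence for tridiagonal matrices use directly.\<close>

definition nonderogatory :: "nat \<Rightarrow> (nat \<Rightarrow> nat \<Rightarrow> complex poly) \<Rightarrow> bool" where
  "nonderogatory d B \<longleftrightarrow> (\<forall>x z S. (\<forall>i<d. \<forall>j<d. S i j = - S j i) \<longrightarrow>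
     (\<forall>i<d. \<forall>j<d. (\<Sum>k<d. poly (B i k) x * S k j) = z * S i j) \<longrightarrow> (\<forall>i<d. \<forall>j<d. S i j = 0))"

text \<open>At a root \<open>x\<close> of the denominator \<open>q\<close> the skew matrix \<open>W(x)\<close> commutes with \<open>B(x)\<close>, hence vanishes,
  and \<open>X - x\<close> cancels.\<close>

lemma commutator_integral:
  fixes B N :: "nat \<Rightarrow> nat \<Rightarrow> complex poly"
  assumes sym: "\<And>i j. B i j = B j i" and reg: "nonderogatory d B"
    and q: "q \<noteq> 0" and skew: "\<And>i j. i < d \<Longrightarrow> j < d \<Longrightarrow> W i j = - W j i"
    and eq: "\<And>i j. i < d \<Longrightarrow> j < d \<Longrightarrow> q * N i j = mmul d W B i j - mmul d B W i j"
  shows "\<exists>W. (\<forall>i<d. \<forall>j<d. W i j = - W j i) \<and> (\<forall>i<d. \<forall>j<d. N i j = mmul d W B i j - mmul d B W i j)"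
  using q skew eq
proof (induction "degree q" arbitrary: q W rule: less_induct)
  case less
  show ?case
  proof (cases "degree q = 0")
    case True
    then obtain c where c: "q = [:c:]"
      by (meson degree_eq_zeroE)
    with less.prems(1) have c0: "c \<noteq> 0"
      by simp
    define W' where "W' = (\<lambda>i j. smult (1 / c) (W i j))"
    have "W' i j = - W' j i" if "i < d" "j < d" for i j
      using less.prems(2)[OF that] by (simp add: W'_def)
    moreover have "N i j = mmul d W' B i j - mmul d B W' i j" if "i < d" "j < d" for i j
    proof -
      have "N i j = smult (1 / c) (q * N i j)"
        using c0 by (simp add: c)
      also have "\<dots> = mmul d W' B i j - mmul d B W' i j"
        unfolding less.prems(3)[OF that] by (simp add: mmul_def W'_def smult_diff_right smult_sum2)
      finally show ?thesis .
    qed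
    ultimately show ?thesis
      by blast
  next
    case False
    then have "\<not> constant (poly q)"
      by (simp add: constant_degree)
    then obtain x where x: "poly q x = 0"
      using fundamental_theorem_of_algebra by blast
    have W0: "poly (W a b) x = 0" if "a < d" "b < d" for a b
    proof (rule skew_commuting_zero[where B = "\<lambda>i j. poly (B i j) x" and W = "\<lambda>i j. poly (W i j) x" and d = d])
      show "poly (B i j) x = poly (B j i) x" for i j
        by (simp add: sym)
      show "poly (W i j) x = - poly (W j i) x" if "i < d" "j < d" for i j
        using less.prems(2)[OF that] by simp
      show "mmul d (\<lambda>i j. poly (W i j) x) (\<lambda>i j. poly (B i j) x) i j
          = mmul d (\<lambda>i j. poly (B i j) x) (\<lambda>i j. poly (W i j) x) i j" if "i < d" "j < d" for i j
        using arg_cong[OF less.prems(3)[OF that], of "\<lambda>p. poly p x"] x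
        by (simp add: mmul_def poly_sum)
    next
      fix z S
      assume "\<And>i j. i < d \<Longrightarrow> j < d \<Longrightarrow> S i j = - S j i"
        "\<And>i j. i < d \<Longrightarrow> j < d \<Longrightarrow> mmul d (\<lambda>i j. poly (B i j) x) S i j = z * S i j"
      then show "\<forall>i<d. \<forall>j<d. S i j = 0"
        using reg unfolding nonderogatory_def mmul_def by blast
    qed (use that in auto)
    define L where "L = [:- x, 1:]"
    have L0: "L \<noteq> 0"
      by (simp add: L_def)
    obtain q' where q': "q = L * q'"
      using x unfolding poly_eq_0_iff_dvd L_def by (elim dvdE)
    \<comment> \<open>The division is exact because W(x) = 0, and both sides of the commutator
      equation lose one factor X - x.\<close>
    define V where "V = (\<lambda>i j. W i j div L)"
    have V: "W i j = L * V i j" if "i < d" "j < d" for i j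
      using W0[OF that] unfolding poly_eq_0_iff_dvd V_def L_def by (metis dvd_mult_div_cancel)
    show ?thesis
    proof (rule less.hyps)
      show q0': "q' \<noteq> 0"
        using less.prems(1) q' by auto
      show "degree q' < degree q"
        unfolding q' using q0' L0 by (subst degree_mult_eq) (auto simp: L_def)
      fix i j assume ij: "i < d" "j < d"
      have "L * V i j = L * (- V j i)"
        using less.prems(2)[OF ij] V[OF ij] V[OF ij(2,1)] by simp
      then show "V i j = - V j i"
        by (rule mult_left_cancel[OF L0, THEN iffD1])
      have "mmul d W B i j = L * mmul d V B i j" "mmul d B W i j = L * mmul d B V i j"
        unfolding mmul_def sum_distrib_left using ij by (auto intro!: sum.cong simp: V mult_ac)
      with less.prems(3)[OF ij] have "L * (q' * N i j) = L * (mmul d V B i j - mmul d B V i j)"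
        by (simp only: q' mult.assoc right_diff_distrib)
      then show "q' * N i j = mmul d V B i j - mmul d B V i j"
        by (rule mult_left_cancel[OF L0, THEN iffD1])
    qed
  qed
qed

text \<open>If \<open>W a b\<close> has the maximal degree m among the entries of \<open>W\<close>,
  with coefficient w, the coefficient of X^(m + K) in the commutator is w (r b - r a). It vanishes
  by the degree bound on \<open>N\<close>, so a = b; but diagonal entries of a skew matrix are
  zero.\<close>

lemma commutator_degree:
  fixes B N W :: "nat \<Rightarrow> nat \<Rightarrow> complex poly"
  assumes top: "\<And>i j. i < d \<Longrightarrow> j < d \<Longrightarrow> top_coeff K (B i j) (if i = j then r i else 0)"
    and inj: "inj_on r {..<d}"
    and skew: "\<And>i j. i < d \<Longrightarrow> j < d \<Longrightarrow> W i j = - W j i"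
    and eq: "\<And>i j. i < d \<Longrightarrow> j < d \<Longrightarrow> N i j = mmul d W B i j - mmul d B W i j"
    and deg: "\<And>i j. i < d \<Longrightarrow> j < d \<Longrightarrow> degree (N i j) < K"
    and ij: "i < d" "j < d"
  shows "N i j = 0"
proof -
  have "W i j = 0" if ij: "i < d" "j < d" for i j
  proof (rule ccontr)
    assume Wij: "W i j \<noteq> 0"
    define m where "m = Max ((\<lambda>(i, j). degree (W i j)) ` {(i, j). i < d \<and> j < d \<and> W i j \<noteq> 0})"
    have fin: "finite {(i, j). i < d \<and> j < d \<and> W i j \<noteq> 0}"
      by (rule finite_subset[of _ "{..<d} \<times> {..<d}"]) auto
    have ne: "{(i, j). i < d \<and> j < d \<and> W i j \<noteq> 0} \<noteq> {}"
      using Wij ij by auto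
    have le: "degree (W i j) \<le> m" if "i < d" "j < d" for i j
      using that fin unfolding m_def by (cases "W i j = 0") (auto intro!: Max_ge)
    have "m \<in> (\<lambda>(i, j). degree (W i j)) ` {(i, j). i < d \<and> j < d \<and> W i j \<noteq> 0}"
      unfolding m_def by (rule Max_in) (use fin ne in auto)
    then obtain a b where ab: "a < d" "b < d" "W a b \<noteq> 0" "degree (W a b) = m"
      by auto
    define w where "w = (\<lambda>i j. coeff (W i j) m)"
    have W: "top_coeff m (W i j) (w i j)" if "i < d" "j < d" for i j
      using le[OF that] by (simp add: top_coeff_def w_def)
    have "top_coeff (m + K) (mmul d W B a b - mmul d B W a b) (w a b * r b - r a * w a b)"
    proof (rule top_coeff_diff)
      have "top_coeff (m + K) (mmul d W B a b) (\<Sum>k<d. w a k * (if k = b then r k else 0))"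
        unfolding mmul_def by (intro top_coeff_sum top_coeff_mult W top) (use ab in auto)
      moreover have "(\<Sum>k<d. w a k * (if k = b then r k else 0)) = (\<Sum>k<d. if k = b then w a b * r b else 0)"
        by (intro sum.cong) auto
      ultimately show "top_coeff (m + K) (mmul d W B a b) (w a b * r b)"
        using ab(2) by simp
      have "top_coeff (K + m) (mmul d B W a b) (\<Sum>k<d. (if a = k then r a else 0) * w k b)"
        unfolding mmul_def by (intro top_coeff_sum top_coeff_mult W top) (use ab in auto)
      moreover have "(\<Sum>k<d. (if a = k then r a else 0) * w k b) = (\<Sum>k<d. if a = k then r a * w a b else 0)"
        by (intro sum.cong) auto
      ultimately show "top_coeff (m + K) (mmul d B W a b) (r a * w a b)"
        using ab(1) by (simp add: add.commute)
    qed
    moreover have "coeff (N a b) (m + K) = 0"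
      using deg[OF ab(1,2)] by (simp add: coeff_eq_0)
    ultimately have "w a b * r b - r a * w a b = 0"
      unfolding eq[OF ab(1,2)] top_coeff_def by simp
    then have "w a b * (r b - r a) = 0"
      by (simp add: algebra_simps)
    moreover have "w a b \<noteq> 0"
      using ab(3,4) by (auto simp: w_def)
    ultimately have "a = b"
      using inj ab by (auto simp: inj_on_def)
    then have "W a b = 0"
      using skew[OF ab(1,2)] by (simp add: eq_neg_iff_add_eq_0)
    with ab show False
      by simp
  qed
  then show ?thesis
    using eq[OF ij] ij by (simp add: mmul_def)
qed

abbreviation cpoly :: "real poly \<Rightarrow> complex poly" where
  "cpoly \<equiv> map_poly complex_of_real"

text \<open>Injectivity of the derivative of \<open>char_pol\<close> at \<open>B\<close>. The
  passage to complex coefficients is forced by the denominator \<open>q\<close>, whose roots may all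
  be non-real.\<close>

theorem null_direction_zero:
  fixes B N :: "nat \<Rightarrow> nat \<Rightarrow> real poly"
  assumes null: "line_deriv (\<lambda>s. char_pol d (\<lambda>i j. B i j + smult s (N i j))) 0"
    and top: "\<And>i j. i < d \<Longrightarrow> j < d \<Longrightarrow> top_coeff K (B i j) (if i = j then r i else 0)"
    and inj: "inj_on r {..<d}"
    and sym: "\<And>i j. B i j = B j i" "\<And>i j. N i j = N j i"
    and deg: "\<And>i j. i < d \<Longrightarrow> j < d \<Longrightarrow> degree (N i j) < K"
    and reg: "nonderogatory d (\<lambda>i j. cpoly (B i j))"
    and ij: "i < d" "j < d"
  shows "N i j = 0"
proof -
  interpret ch: map_poly_inj_idom_hom complex_of_real ..
  obtain q W where q: "q \<noteq> 0" and skew: "\<And>i j. W i j = - W j i"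
    and eq: "\<And>i j. i < d \<Longrightarrow> j < d \<Longrightarrow> q * N i j = mmul d W B i j - mmul d B W i j"
    using null_direction_skew[OF null top inj sym] by blast
  let ?c = "\<lambda>M i j. cpoly (M i j)"
  have "\<exists>W. (\<forall>i<d. \<forall>j<d. W i j = - W j i) \<and> (\<forall>i<d. \<forall>j<d. ?c N i j = mmul d W (?c B) i j - mmul d (?c B) W i j)"
  proof (rule commutator_integral[OF _ reg, where q = "cpoly q" and W = "?c W"])
    show "cpoly (B i j) = cpoly (B j i)" for i j
      by (simp add: sym(1)[of i j])
    show "cpoly q \<noteq> 0"
      using q by simp
    show "cpoly (W i j) = - cpoly (W j i)" for i j
      by (subst skew) (simp add: ch.hom_uminus)
    show "cpoly q * cpoly (N i j) = mmul d (?c W) (?c B) i j - mmul d (?c B) (?c W) i j" if "i < d" "j < d" for i j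
      using arg_cong[OF eq[OF that], of cpoly]
      by (simp add: mmul_def ch.hom_mult ch.hom_sum ch.hom_minus)
  qed
  then obtain V where V: "\<And>i j. i < d \<Longrightarrow> j < d \<Longrightarrow> V i j = - V j i"
    "\<And>i j. i < d \<Longrightarrow> j < d \<Longrightarrow> ?c N i j = mmul d V (?c B) i j - mmul d (?c B) V i j"
    by blast
  have "cpoly (N i j) = 0"
  proof (rule commutator_degree[OF _ _ V _ ij])
    show "top_coeff K (cpoly (B i j)) (if i = j then complex_of_real (r i) else 0)" if "i < d" "j < d" for i j
      using top[OF that] by (auto simp: top_coeff_def split: if_splits)
    show "inj_on (\<lambda>i. complex_of_real (r i)) {..<d}"
      using inj by (auto simp: inj_on_def)
    show "degree (cpoly (N i j)) < K" if "i < d" "j < d" for i j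
      using deg[OF that] by simp
  qed
  then show ?thesis
    by simp
qed

subsection \<open>A local surjectivity theorem for polynomial maps in coordinates\<close>

text \<open>The number of coordinates depends on \<open>d\<close> and \<open>K\<close> and cannot be
  a type, so points are functions on the naturals of which the first \<open>n\<close> values
  count.\<close>

inductive polyfun :: "nat \<Rightarrow> ((nat \<Rightarrow> real) \<Rightarrow> real) \<Rightarrow> bool" for n where
  polyfun_const: "polyfun n (\<lambda>x. c)"
| polyfun_coord: "i < n \<Longrightarrow> polyfun n (\<lambda>x. x i)"
| polyfun_add: "polyfun n F \<Longrightarrow> polyfun n G \<Longrightarrow> polyfun n (\<lambda>x. F x + G x)"
| polyfun_mult: "polyfun n F \<Longrightarrow> polyfun n G \<Longrightarrow> polyfun n (\<lambda>x. F x * G x)"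

lemma polyfun_sum: "(\<And>i. i \<in> A \<Longrightarrow> polyfun n (F i)) \<Longrightarrow> polyfun n (\<lambda>x. \<Sum>i\<in>A. F i x)"
  by (induction A rule: infinite_finite_induct) (auto intro: polyfun.intros)

lemma continuous_on_polyfun: "polyfun n F \<Longrightarrow> continuous_on A F"
proof (induction rule: polyfun.induct)
  case (polyfun_coord i)
  then show ?case
    by (intro continuous_on_subset[OF continuous_on_product_coordinates]) simp
qed (auto intro!: continuous_intros)

lemma polyfun_derivative:
  assumes "polyfun n F"
  obtains J where "\<And>j. polyfun n (J j)"
    "\<And>x v t. ((\<lambda>s. F (\<lambda>k. x k + s * v k)) has_real_derivative
        (\<Sum>j<n. J j (\<lambda>k. x k + t * v k) * v j)) (at t)"
  using assms
proof (induction arbitrary: thesis rule: polyfun.induct)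
  case (polyfun_const c)
  show ?case
    by (rule polyfun_const[of "\<lambda>j x. 0"]) (auto intro: polyfun.intros)
next
  case (polyfun_coord i)
  have *: "(\<Sum>j<n. (if j = i then 1 else 0) * v j) = v i" for v :: "nat \<Rightarrow> real"
  proof -
    have "(\<Sum>j<n. (if j = i then 1 else 0) * v j) = (\<Sum>j<n. if j = i then v i else 0)"
      by (intro sum.cong) auto
    then show ?thesis
      using polyfun_coord(1) by simp
  qed
  show ?case
    by (rule polyfun_coord(2)[of "\<lambda>j x. if j = i then 1 else 0"])
       (auto intro: polyfun.intros intro!: derivative_eq_intros simp: *)
next
  case (polyfun_add F G)
  obtain J where J: "\<And>j. polyfun n (J j)" "\<And>x v t. ((\<lambda>s. F (\<lambda>k. x k + s * v k)) has_real_derivative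
        (\<Sum>j<n. J j (\<lambda>k. x k + t * v k) * v j)) (at t)"
    using polyfun_add.IH(1) by blast
  obtain J' where J': "\<And>j. polyfun n (J' j)" "\<And>x v t. ((\<lambda>s. G (\<lambda>k. x k + s * v k)) has_real_derivative
        (\<Sum>j<n. J' j (\<lambda>k. x k + t * v k) * v j)) (at t)"
    using polyfun_add.IH(2) by blast
  show ?case
  proof (rule polyfun_add.prems[of "\<lambda>j x. J j x + J' j x"])
    show "polyfun n (\<lambda>x. J j x + J' j x)" for j
      using J(1) J'(1) by (intro polyfun.intros)
    show "((\<lambda>s. F (\<lambda>k. x k + s * v k) + G (\<lambda>k. x k + s * v k)) has_real_derivative
      (\<Sum>j<n. (J j (\<lambda>k. x k + t * v k) + J' j (\<lambda>k. x k + t * v k)) * v j)) (at t)" for x v t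
      using DERIV_add[OF J(2)[of x v t] J'(2)[of x v t]] by (simp add: sum.distrib distrib_right)
  qed
next
  case (polyfun_mult F G)
  obtain J where J: "\<And>j. polyfun n (J j)" "\<And>x v t. ((\<lambda>s. F (\<lambda>k. x k + s * v k)) has_real_derivative
        (\<Sum>j<n. J j (\<lambda>k. x k + t * v k) * v j)) (at t)"
    using polyfun_mult.IH(1) by blast
  obtain J' where J': "\<And>j. polyfun n (J' j)" "\<And>x v t. ((\<lambda>s. G (\<lambda>k. x k + s * v k)) has_real_derivative
        (\<Sum>j<n. J' j (\<lambda>k. x k + t * v k) * v j)) (at t)"
    using polyfun_mult.IH(2) by blast
  show ?case
  proof (rule polyfun_mult.prems[of "\<lambda>j x. J j x * G x + F x * J' j x"])
    show "polyfun n (\<lambda>x. J j x * G x + F x * J' j x)" for j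
      using J(1) J'(1) polyfun_mult.hyps by (intro polyfun.intros)
    show "((\<lambda>s. F (\<lambda>k. x k + s * v k) * G (\<lambda>k. x k + s * v k)) has_real_derivative
      (\<Sum>j<n. (J j (\<lambda>k. x k + t * v k) * G (\<lambda>k. x k + t * v k)
         + F (\<lambda>k. x k + t * v k) * J' j (\<lambda>k. x k + t * v k)) * v j)) (at t)" for x v t
      using DERIV_mult'[OF J(2)[of x v t] J'(2)[of x v t]]
      by (simp add: sum.distrib distrib_right sum_distrib_left sum_distrib_right distrib_left mult_ac add.commute)
  qed
qed

lemma polyfun_near:
  assumes "polyfun n F" "e > 0"
  shows "\<exists>\<delta>>0. \<forall>x. (\<forall>k<n. \<bar>x k - a k\<bar> \<le> \<delta>) \<longrightarrow> \<bar>F x - F a\<bar> < e"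
proof -
  define B where "B = (\<lambda>\<delta>. {x :: nat \<Rightarrow> real. \<forall>k<n. \<bar>x k - a k\<bar> \<le> \<delta>})"
  \<comment> \<open>The filter of boxes in the first \<open>n\<close> coordinates, with the others
    left free. Convergence along it follows by induction from the limit rules.\<close>
  define N where "N = (INF \<delta>\<in>{0<..}. principal (B \<delta>))"
  have ev: "eventually P N \<longleftrightarrow> (\<exists>\<delta>>0. \<forall>x\<in>B \<delta>. P x)" for P
  proof -
    have "eventually P N \<longleftrightarrow> (\<exists>b\<in>{0<..}. eventually P (principal (B b)))"
      unfolding N_def
    proof (rule eventually_INF_base)
      fix c d :: real assume "c \<in> {0<..}" "d \<in> {0<..}"
      then show "\<exists>x\<in>{0<..}. principal (B x) \<le> inf (principal (B c)) (principal (B d))"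
        by (intro bexI[of _ "min c d"]) (auto simp: B_def)
    qed auto
    then show ?thesis
      by (auto simp: eventually_principal)
  qed
  have "(F \<longlongrightarrow> F a) N"
    using assms(1)
  proof (induction rule: polyfun.induct)
    case (polyfun_coord i)
    show ?case
    proof (rule tendstoI)
      fix e :: real assume "e > 0"
      then show "eventually (\<lambda>x. dist (x i) (a i) < e) N"
        unfolding ev using polyfun_coord by (intro exI[of _ "e / 2"]) (auto simp: B_def dist_real_def)
    qed
  qed (auto intro: tendsto_intros)
  from tendstoD[OF this assms(2)] show ?thesis
    unfolding ev B_def dist_real_def by auto
qed

text \<open>With the coordinates from \<open>n\<close> on frozen this is a product of compact sets,
  and Tychonoff's theorem applies.\<close>

lemma compact_coordinate_box:
  "compact {x :: nat \<Rightarrow> real. (\<forall>k<n. \<bar>x k - a k\<bar> \<le> \<delta>) \<and> (\<forall>k\<ge>n. x k = a k)}"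
proof -
  define S where "S = (\<lambda>k. if k < n then {a k - \<delta>..a k + \<delta>} else {a k})"
  have "{x :: nat \<Rightarrow> real. (\<forall>k<n. \<bar>x k - a k\<bar> \<le> \<delta>) \<and> (\<forall>k\<ge>n. x k = a k)} = PiE UNIV S"
  proof (rule Set.set_eqI)
    fix x :: "nat \<Rightarrow> real"
    have "\<bar>x k - a k\<bar> \<le> \<delta> \<longleftrightarrow> x k \<in> {a k - \<delta>..a k + \<delta>}" for k
      by auto
    then have "x \<in> PiE UNIV S \<longleftrightarrow> (\<forall>k. if k < n then \<bar>x k - a k\<bar> \<le> \<delta> else x k = a k)"
      unfolding PiE_UNIV_domain Pi_iff S_def by (simp add: if_distrib cong: if_cong)
    also have "\<dots> \<longleftrightarrow> (\<forall>k<n. \<bar>x k - a k\<bar> \<le> \<delta>) \<and> (\<forall>k\<ge>n. x k = a k)"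
      by (meson not_less)
    finally show "x \<in> {x. (\<forall>k<n. \<bar>x k - a k\<bar> \<le> \<delta>) \<and> (\<forall>k\<ge>n. x k = a k)} \<longleftrightarrow> x \<in> PiE UNIV S"
      by simp
  qed
  moreover have "compactin (product_topology (\<lambda>k. euclidean) UNIV) (PiE UNIV S)"
    unfolding compactin_PiE by (auto simp: S_def)
  ultimately show ?thesis
    by (simp add: euclidean_product_topology)
qed

text \<open>A minimiser of the distance to the target over a small box is an interior point, and its gradient
  vanishes only if the target is attained.\<close>

lemma local_surj_normalized:
  fixes F :: "nat \<Rightarrow> (nat \<Rightarrow> real) \<Rightarrow> real"
  assumes n: "n > 0" and F: "\<And>i. i < n \<Longrightarrow> polyfun n (F i)"
    and J: "\<And>i j. i < n \<Longrightarrow> polyfun n (J i j)"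
    and der: "\<And>i x v t. i < n \<Longrightarrow> ((\<lambda>s. F i (\<lambda>k. x k + s * v k)) has_real_derivative
        (\<Sum>j<n. J i j (\<lambda>k. x k + t * v k) * v j)) (at t)"
    and id: "\<And>i j. i < n \<Longrightarrow> j < n \<Longrightarrow> J i j a = (if i = j then 1 else 0)"
  shows "\<exists>e>0. \<forall>y. (\<forall>i<n. \<bar>y i - F i a\<bar> < e) \<longrightarrow> (\<exists>x. \<forall>i<n. F i x = y i)"
proof -
  \<comment> \<open>On the box every row and every column of J - I then has absolute sum at most
    1/4; rows enter the mean value estimate \<open>mv\<close>, columns the final estimate.\<close>
  define c where "c = 1 / (4 * real n)"
  have c: "c > 0" "real n * c = 1 / 4"
    using n by (auto simp: c_def)
  define I where "I = (\<lambda>(i::nat) j. if i = j then 1 else 0 :: real)"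
  have "\<forall>i\<in>{..<n}. \<forall>j\<in>{..<n}. \<exists>\<delta>>0. \<forall>x. (\<forall>k<n. \<bar>x k - a k\<bar> \<le> \<delta>) \<longrightarrow> \<bar>J i j x - J i j a\<bar> < c"
    using polyfun_near[OF J c(1)] by blast
  then obtain D where D: "\<And>i j. i < n \<Longrightarrow> j < n \<Longrightarrow> D i j > 0"
    "\<And>i j x. i < n \<Longrightarrow> j < n \<Longrightarrow> (\<forall>k<n. \<bar>x k - a k\<bar> \<le> D i j) \<Longrightarrow> \<bar>J i j x - J i j a\<bar> < c"
    by (metis lessThan_iff)
  define \<delta> where "\<delta> = Min ((\<lambda>(i, j). D i j) ` ({..<n} \<times> {..<n}))"
  have fin: "finite ((\<lambda>(i, j). D i j) ` ({..<n} \<times> {..<n}))" "(\<lambda>(i, j). D i j) ` ({..<n} \<times> {..<n}) \<noteq> {}"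
    using n by auto
  have \<delta>: "\<delta> > 0"
    unfolding \<delta>_def using Min_gr_iff[OF fin] D(1) by auto
  have \<delta>_le: "\<delta> \<le> D i j" if "i < n" "j < n" for i j
    unfolding \<delta>_def by (rule Min_le[OF fin(1)]) (use that in auto)
  have near: "\<bar>J i j x - I i j\<bar> \<le> c" if "i < n" "j < n" "\<forall>k<n. \<bar>x k - a k\<bar> \<le> \<delta>" for i j x
  proof -
    have "\<bar>J i j x - J i j a\<bar> < c"
      by (rule D(2)) (use that \<delta>_le[of i j] in fastforce)+
    then show ?thesis
      using that id[of i j] by (simp add: I_def)
  qed
  have Isum: "(\<Sum>j<n. I i j * v j) = v i" "(\<Sum>j<n. v j * I j i) = v i" if "i < n" for i v
  proof -
    have "(\<Sum>j<n. I i j * v j) = (\<Sum>j<n. if i = j then v i else 0)"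
      by (rule sum.cong) (auto simp: I_def)
    moreover have "(\<Sum>j<n. v j * I j i) = (\<Sum>j<n. if j = i then v i else 0)"
      by (rule sum.cong) (auto simp: I_def)
    ultimately show "(\<Sum>j<n. I i j * v j) = v i" "(\<Sum>j<n. v j * I j i) = v i"
      using that by simp_all
  qed
  define C where "C = {x :: nat \<Rightarrow> real. (\<forall>k<n. \<bar>x k - a k\<bar> \<le> \<delta>) \<and> (\<forall>k\<ge>n. x k = a k)}"
  have "compact C"
    unfolding C_def by (rule compact_coordinate_box)
  have aC: "a \<in> C"
    using \<delta> by (simp add: C_def)
  have mv: "\<bar>F i x - F i a - (x i - a i)\<bar> \<le> \<delta> / 4" if i: "i < n" and x: "x \<in> C" for i x
  proof -
    define v where "v = (\<lambda>k. x k - a k)"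
    have "\<exists>t>0. t < 1 \<and> F i (\<lambda>k. a k + 1 * v k) - F i (\<lambda>k. a k + 0 * v k)
        = (1 - 0) * (\<Sum>j<n. J i j (\<lambda>k. a k + t * v k) * v j)"
      using der[OF i] by (intro MVT2) auto
    then obtain t where t: "0 < t" "t < 1" "F i (\<lambda>k. a k + 1 * v k) - F i (\<lambda>k. a k + 0 * v k)
        = (\<Sum>j<n. J i j (\<lambda>k. a k + t * v k) * v j)"
      by auto
    have vb: "\<bar>v k\<bar> \<le> \<delta>" if "k < n" for k
      using x that by (simp add: C_def v_def)
    have nb: "\<forall>k<n. \<bar>a k + t * v k - a k\<bar> \<le> \<delta>"
    proof (intro allI impI)
      fix k assume k: "k < n"
      have "\<bar>a k + t * v k - a k\<bar> = t * \<bar>v k\<bar>"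
        using t by (simp add: abs_mult)
      also have "\<dots> \<le> 1 * \<bar>v k\<bar>"
        using t by (intro mult_right_mono) auto
      finally show "\<bar>a k + t * v k - a k\<bar> \<le> \<delta>"
        using vb[OF k] by simp
    qed
    have "F i x - F i a - (x i - a i) = (\<Sum>j<n. J i j (\<lambda>k. a k + t * v k) * v j) - (\<Sum>j<n. I i j * v j)"
      unfolding Isum[OF i] t(3)[symmetric] by (simp add: v_def)
    also have "\<dots> = (\<Sum>j<n. (J i j (\<lambda>k. a k + t * v k) - I i j) * v j)"
      by (simp add: sum_subtractf left_diff_distrib)
    also have "\<bar>\<dots>\<bar> \<le> (\<Sum>j<n. \<bar>(J i j (\<lambda>k. a k + t * v k) - I i j) * v j\<bar>)"
      by (rule sum_abs)
    also have "\<dots> \<le> (\<Sum>j<n. c * \<delta>)"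
      unfolding abs_mult using c \<delta> by (intro sum_mono mult_mono near[OF i _ nb] vb) auto
    also have "\<dots> = \<delta> / 4"
      using c(2) by simp
    finally show ?thesis .
  qed
  \<comment> \<open>Two inequalities are wanted: e \<le> \<delta> / 4 and n e^2 < (\<delta> / 2)^2.
    On the boundary of the box some component is at least 3 \<delta> / 4 - e \<ge> \<delta> / 2 away
    from the target, while the squared distance at \<open>a\<close> is below (\<delta> / 2)^2; hence
    the minimiser is interior.\<close>
  define e where "e = \<delta> / (4 * (real n + 1))"
  have e: "e > 0"
    using \<delta> by (simp add: e_def)
  have e4: "e \<le> \<delta> / 4"
    using \<delta> by (simp add: e_def field_simps)
  have ne: "real n * e ^ 2 < (\<delta> / 2) ^ 2"
  proof -
    have "real n * e ^ 2 = (real n * e) * e"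
      by (simp add: power2_eq_square)
    also have "\<dots> \<le> (\<delta> / 4) * (\<delta> / 4)"
    proof (rule mult_mono)
      have "real n * e \<le> (real n + 1) * e"
        using e by simp
      also have "\<dots> = \<delta> / 4"
        by (simp add: e_def field_simps)
      finally show "real n * e \<le> \<delta> / 4" .
    qed (use e4 \<delta> e in auto)
    also have "\<dots> < (\<delta> / 2) ^ 2"
      using \<delta> by (simp add: power2_eq_square)
    finally show ?thesis .
  qed
  show ?thesis
  proof (intro exI[of _ e] conjI e allI impI)
    fix y assume y: "\<forall>i<n. \<bar>y i - F i a\<bar> < e"
    define \<Phi> where "\<Phi> = (\<lambda>x. \<Sum>i<n. (F i x - y i)\<^sup>2)"
    have "continuous_on C \<Phi>"
      unfolding \<Phi>_def by (intro continuous_intros continuous_on_polyfun[OF F]) auto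
    then obtain x where x: "x \<in> C" and min: "\<And>z. z \<in> C \<Longrightarrow> \<Phi> x \<le> \<Phi> z"
      using continuous_attains_inf[OF \<open>compact C\<close>, of \<Phi>] aC by blast
    have "\<Phi> a \<le> (\<Sum>i<n. e\<^sup>2)"
      unfolding \<Phi>_def
    proof (rule sum_mono)
      fix i assume "i \<in> {..<n}"
      then have "\<bar>F i a - y i\<bar> \<le> \<bar>e\<bar>"
        using y e by (auto simp: abs_minus_commute less_imp_le)
      then show "(F i a - y i)\<^sup>2 \<le> e\<^sup>2"
        by (simp only: abs_le_square_iff)
    qed
    then have \<Phi>x: "\<Phi> x < (\<delta> / 2)\<^sup>2"
      using min[OF aC] ne by simp
    have interior: "\<bar>x k - a k\<bar> < \<delta>" if k: "k < n" for k
    proof (rule ccontr)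
      assume "\<not> \<bar>x k - a k\<bar> < \<delta>"
      then have "\<bar>F k x - F k a\<bar> \<ge> 3 * \<delta> / 4"
        using mv[OF k x] by linarith
      then have "\<bar>F k x - y k\<bar> \<ge> \<delta> / 2"
        using y[rule_format, OF k] e4 by linarith
      then have "(\<delta> / 2)\<^sup>2 \<le> (F k x - y k)\<^sup>2"
        using \<delta> abs_le_square_iff[of "\<delta> / 2" "F k x - y k"] by simp
      also have "\<dots> \<le> \<Phi> x"
        unfolding \<Phi>_def using k by (intro member_le_sum) auto
      finally show False
        using \<Phi>x by simp
    qed
    have grad: "(\<Sum>i<n. (F i x - y i) * J i j x) = 0" if j: "j < n" for j
    proof -
      define v where "v = (\<lambda>k. if k = j then 1 else 0 :: real)"
      have Jv: "(\<Sum>l<n. f l * v l) = f j" for f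
      proof -
        have "(\<Sum>l<n. f l * v l) = (\<Sum>l<n. if l = j then f j else 0)"
          by (intro sum.cong) (auto simp: v_def)
        then show ?thesis
          using j by simp
      qed
      have "((\<lambda>s. \<Phi> (\<lambda>k. x k + s * v k)) has_real_derivative
        (\<Sum>i<n. 2 * (F i x - y i) * (\<Sum>l<n. J i l x * v l))) (at 0)"
        unfolding \<Phi>_def
      proof (rule DERIV_sum)
        fix i assume "i \<in> {..<n}"
        then have "((\<lambda>s. F i (\<lambda>k. x k + s * v k)) has_real_derivative (\<Sum>l<n. J i l x * v l)) (at 0)"
          using der[of i x v 0] by simp
        from DERIV_power[OF DERIV_diff[OF this DERIV_const[of "y i"]], of 2]
        show "((\<lambda>s. (F i (\<lambda>k. x k + s * v k) - y i)\<^sup>2) has_real_derivative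
          2 * (F i x - y i) * (\<Sum>l<n. J i l x * v l)) (at 0)"
          by (rule DERIV_cong) (simp add: algebra_simps)
      qed
      moreover have "\<forall>s. \<bar>0 - s\<bar> < \<delta> - \<bar>x j - a j\<bar> \<longrightarrow> \<Phi> (\<lambda>k. x k + 0 * v k) \<le> \<Phi> (\<lambda>k. x k + s * v k)"
      proof (intro allI impI)
        fix s assume s: "\<bar>0 - s\<bar> < \<delta> - \<bar>x j - a j\<bar>"
        have "(\<lambda>k. x k + s * v k) \<in> C"
          unfolding C_def
        proof (intro CollectI conjI allI impI)
          fix k assume "k < n"
          then show "\<bar>x k + s * v k - a k\<bar> \<le> \<delta>"
            using s interior[of k] by (cases "k = j") (auto simp: v_def)
        next
          fix k assume "k \<ge> n"
          then show "x k + s * v k = a k"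
            using x j by (auto simp: C_def v_def)
        qed
        from min[OF this] show "\<Phi> (\<lambda>k. x k + 0 * v k) \<le> \<Phi> (\<lambda>k. x k + s * v k)"
          by simp
      qed
      ultimately have "(\<Sum>i<n. 2 * (F i x - y i) * (\<Sum>l<n. J i l x * v l)) = 0"
        using interior[OF j] by (intro DERIV_local_min[where d = "\<delta> - \<bar>x j - a j\<bar>"]) auto
      then have "2 * (\<Sum>i<n. (F i x - y i) * J i j x) = 0"
        unfolding Jv by (simp only: sum_distrib_left mult.assoc)
      then show ?thesis
        by simp
    qed
    \<comment> \<open>By the vanishing gradient, the largest residual is minus the sum of all
      residuals weighted by a column of J - I, so m \<le> m / 4.\<close>
    define m where "m = Max ((\<lambda>i. \<bar>F i x - y i\<bar>) ` {..<n})"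
    have "m \<in> (\<lambda>i. \<bar>F i x - y i\<bar>) ` {..<n}"
      unfolding m_def using n by (intro Max_in) auto
    then obtain p where p: "p < n" "\<bar>F p x - y p\<bar> = m"
      by auto
    have le_m: "\<bar>F i x - y i\<bar> \<le> m" if "i < n" for i
      unfolding m_def using that by (intro Max_ge) auto
    have "F p x - y p = - (\<Sum>i<n. (F i x - y i) * (J i p x - I i p))"
      using grad[OF p(1)] Isum(2)[OF p(1), of "\<lambda>i. F i x - y i"]
      by (simp add: right_diff_distrib sum_subtractf)
    then have "m \<le> (\<Sum>i<n. \<bar>(F i x - y i) * (J i p x - I i p)\<bar>)"
      using p(2) sum_abs[of "\<lambda>i. (F i x - y i) * (J i p x - I i p)" "{..<n}"] by simp
    also have "\<dots> \<le> (\<Sum>i<n. m * c)"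
      unfolding abs_mult using c x p le_m[OF p(1)] by (intro sum_mono mult_mono le_m near) (auto simp: C_def)
    also have "\<dots> = m * (real n * c)"
      by simp
    also have "\<dots> = m / 4"
      unfolding c(2) by simp
    finally have "m \<le> 0"
      by simp
    then have "F i x = y i" if "i < n" for i
      using le_m[OF that] by simp
    then show "\<exists>x. \<forall>i<n. F i x = y i"
      by blast
  qed
qed

text \<open>The Jacobian at \<open>a\<close> is square, so injectivity makes it invertible.
  Composing with the inverse leads to the case of an identity Jacobian.\<close>

theorem local_surjectivity:
  fixes F :: "nat \<Rightarrow> (nat \<Rightarrow> real) \<Rightarrow> real"
  assumes F: "\<And>i. i < n \<Longrightarrow> polyfun n (F i)"
    and inj: "\<And>v. (\<And>i. i < n \<Longrightarrow> ((\<lambda>s. F i (\<lambda>k. a k + s * v k)) has_real_derivative 0) (at 0)) \<Longrightarrow> \<forall>j<n. v j = 0"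
  shows "\<exists>e>0. \<forall>y. (\<forall>i<n. \<bar>y i - F i a\<bar> < e) \<longrightarrow> (\<exists>x. \<forall>i<n. F i x = y i)"
proof (cases "n = 0")
  case True
  then show ?thesis
    by (intro exI[of _ 1]) auto
next
  case False
  then have n: "n > 0" by simp
  have "\<forall>i\<in>{..<n}. \<exists>J. (\<forall>j. polyfun n (J j)) \<and> (\<forall>x v t. ((\<lambda>s. F i (\<lambda>k. x k + s * v k)) has_real_derivative
        (\<Sum>j<n. J j (\<lambda>k. x k + t * v k) * v j)) (at t))"
  proof
    fix i assume "i \<in> {..<n}"
    then have "polyfun n (F i)"
      by (intro F) simp
    then show "\<exists>J. (\<forall>j. polyfun n (J j)) \<and> (\<forall>x v t. ((\<lambda>s. F i (\<lambda>k. x k + s * v k)) has_real_derivative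
        (\<Sum>j<n. J j (\<lambda>k. x k + t * v k) * v j)) (at t))"
      by (rule polyfun_derivative) blast
  qed
  from bchoice[OF this] obtain J where J0: "\<forall>i\<in>{..<n}. (\<forall>j. polyfun n (J i j)) \<and> (\<forall>x v t. ((\<lambda>s. F i (\<lambda>k. x k + s * v k)) has_real_derivative
        (\<Sum>j<n. J i j (\<lambda>k. x k + t * v k) * v j)) (at t))"
    by blast
  then have J: "\<And>i j. i < n \<Longrightarrow> polyfun n (J i j)"
    by blast
  have der: "\<And>i x v t. i < n \<Longrightarrow> ((\<lambda>s. F i (\<lambda>k. x k + s * v k)) has_real_derivative
        (\<Sum>j<n. J i j (\<lambda>k. x k + t * v k) * v j)) (at t)"
    using J0 by blast
  define A where "A = mat n n (\<lambda>(i, j). J i j a)"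
  have A: "A \<in> carrier_mat n n"
    by (simp add: A_def)
  have detA: "det A \<noteq> 0"
  proof
    assume "det A = 0"
    then obtain v where v: "v \<in> carrier_vec n" "v \<noteq> 0\<^sub>v n" "A *\<^sub>v v = 0\<^sub>v n"
      using det_0_iff_vec_prod_zero_field[OF A] by blast
    have "\<forall>j<n. vec_index v j = 0"
    proof (rule inj)
      fix i assume i: "i < n"
      have "(\<Sum>j<n. J i j a * vec_index v j) = vec_index (A *\<^sub>v v) i"
        using i v(1) by (simp add: A_def scalar_prod_def atLeast0LessThan)
      also have "\<dots> = 0"
        using v(3) i by simp
      finally show "((\<lambda>s. F i (\<lambda>k. a k + s * vec_index v k)) has_real_derivative 0) (at 0)"
        using der[OF i, of a "vec_index v" 0] by simp
    qed
    then have "v = 0\<^sub>v n"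
      using v(1) by auto
    with v(2) show False
      by simp
  qed
  define M where "M = (\<lambda>i j. adj_mat A $$ (i, j) / det A)"
  have MJ: "(\<Sum>k<n. M i k * J k j a) = (if i = j then 1 else 0)" if "i < n" "j < n" for i j
  proof -
    have "(\<Sum>k<n. M i k * J k j a) = (\<Sum>k<n. adj_mat A $$ (i, k) * A $$ (k, j)) / det A"
      unfolding sum_divide_distrib using that by (intro sum.cong) (auto simp: M_def A_def)
    then show ?thesis
      using adj_mat_mult_entry(2)[OF A that] detA by simp
  qed
  have JM: "(\<Sum>k<n. J i k a * M k j) = (if i = j then 1 else 0)" if "i < n" "j < n" for i j
  proof -
    have "(\<Sum>k<n. J i k a * M k j) = (\<Sum>k<n. A $$ (i, k) * adj_mat A $$ (k, j)) / det A"
      unfolding sum_divide_distrib using that by (intro sum.cong) (auto simp: M_def A_def)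
    then show ?thesis
      using adj_mat_mult_entry(1)[OF A that] detA by simp
  qed
  define G where "G = (\<lambda>i x. \<Sum>k<n. M i k * F k x)"
  have "\<exists>e>0. \<forall>y. (\<forall>i<n. \<bar>y i - G i a\<bar> < e) \<longrightarrow> (\<exists>x. \<forall>i<n. G i x = y i)"
  proof (rule local_surj_normalized[where J = "\<lambda>i j x. \<Sum>k<n. M i k * J k j x"])
    show "polyfun n (G i)" for i
      unfolding G_def by (intro polyfun_sum polyfun.intros F) auto
    show "polyfun n (\<lambda>x. \<Sum>k<n. M i k * J k j x)" for i j
      by (intro polyfun_sum polyfun.intros J) auto
    show "((\<lambda>s. G i (\<lambda>k. x k + s * v k)) has_real_derivative
        (\<Sum>j<n. (\<Sum>k<n. M i k * J k j (\<lambda>k. x k + t * v k)) * v j)) (at t)" for i x v t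
    proof -
      have "((\<lambda>s. G i (\<lambda>k. x k + s * v k)) has_real_derivative
        (\<Sum>k<n. M i k * (\<Sum>j<n. J k j (\<lambda>k. x k + t * v k) * v j))) (at t)"
        unfolding G_def by (intro DERIV_sum DERIV_cmult der) auto
      also have "(\<Sum>k<n. M i k * (\<Sum>j<n. J k j (\<lambda>k. x k + t * v k) * v j))
         = (\<Sum>j<n. (\<Sum>k<n. M i k * J k j (\<lambda>k. x k + t * v k)) * v j)"
        unfolding sum_distrib_left sum_distrib_right by (subst sum.swap) (simp add: mult.assoc)
      finally show ?thesis .
    qed
  qed (use n MJ in auto)
  then obtain e where e: "e > 0" "\<And>y. (\<forall>i<n. \<bar>y i - G i a\<bar> < e) \<Longrightarrow> \<exists>x. \<forall>i<n. G i x = y i"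
    by blast
  \<comment> \<open>\<open>S\<close> exceeds every absolute row sum of the inverse Jacobian, so a
    tolerance e / S for \<open>F\<close> becomes a tolerance e for \<open>G\<close>.\<close>
  define S where "S = 1 + (\<Sum>i<n. \<Sum>k<n. \<bar>M i k\<bar>)"
  have S: "S > 0"
    unfolding S_def by (smt (verit) sum_nonneg abs_ge_zero)
  show ?thesis
  proof (intro exI[of _ "e / S"] conjI allI impI)
    show "e / S > 0"
      using e S by simp
    fix y assume y: "\<forall>i<n. \<bar>y i - F i a\<bar> < e / S"
    define z where "z = (\<lambda>i. \<Sum>k<n. M i k * y k)"
    have "\<forall>i<n. \<bar>z i - G i a\<bar> < e"
    proof (intro allI impI)
      fix i assume i: "i < n"
      have "z i - G i a = (\<Sum>k<n. M i k * (y k - F k a))"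
        by (simp add: z_def G_def right_diff_distrib sum_subtractf)
      also have "\<bar>\<dots>\<bar> \<le> (\<Sum>k<n. \<bar>M i k * (y k - F k a)\<bar>)"
        by (rule sum_abs)
      also have "\<dots> \<le> (\<Sum>k<n. \<bar>M i k\<bar> * (e / S))"
        unfolding abs_mult using y by (intro sum_mono mult_left_mono) (auto simp: less_imp_le)
      also have "\<dots> = (\<Sum>k<n. \<bar>M i k\<bar>) * (e / S)"
        by (simp only: sum_distrib_right)
      also have "\<dots> < S * (e / S)"
      proof (rule mult_strict_right_mono)
        have "(\<Sum>k<n. \<bar>M i k\<bar>) \<le> (\<Sum>i<n. \<Sum>k<n. \<bar>M i k\<bar>)"
          using i by (intro member_le_sum[of i "{..<n}" "\<lambda>i. \<Sum>k<n. \<bar>M i k\<bar>"] sum_nonneg) auto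
        then show "(\<Sum>k<n. \<bar>M i k\<bar>) < S"
          by (simp add: S_def)
      qed (use e S in simp)
      also have "\<dots> = e"
        using S by simp
      finally show "\<bar>z i - G i a\<bar> < e" .
    qed
    then obtain x where x: "\<forall>i<n. G i x = z i"
      using e(2) by blast
    have inv: "w i = (\<Sum>l<n. J i l a * (\<Sum>k<n. M l k * w k))" if "i < n" for i and w :: "nat \<Rightarrow> real"
    proof -
      have "(\<Sum>l<n. J i l a * (\<Sum>k<n. M l k * w k)) = (\<Sum>k<n. (\<Sum>l<n. J i l a * M l k) * w k)"
        unfolding sum_distrib_left sum_distrib_right by (subst sum.swap) (simp add: mult.assoc)
      also have "\<dots> = (\<Sum>k<n. if i = k then w i else 0)"
        using JM[OF that] by (intro sum.cong) auto
      finally show ?thesis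
        using that by simp
    qed
    have "F i x = y i" if "i < n" for i
      using inv[OF that, of "\<lambda>k. F k x"] inv[OF that, of y] x by (simp add: G_def z_def)
    then show "\<exists>x. \<forall>i<n. F i x = y i"
      by blast
  qed
qed

subsection \<open>Non-derogatory matrices\<close>

text \<open>For \<open>F\<close> in \<open>\<complex>[X][T]\<close>, the value \<open>F(x, t)\<close> is \<open>poly (poly F [:t:]) x\<close>.\<close>

definition singular :: "complex poly poly \<Rightarrow> complex \<Rightarrow> complex \<Rightarrow> bool" where
  "singular F x t \<longleftrightarrow> poly (poly F [:t:]) x = 0 \<and> poly (poly (pderiv F) [:t:]) x = 0 \<and>
     poly (pderiv (poly F [:t:])) x = 0"

lemma singular_add: "singular F x t \<Longrightarrow> singular G x t \<Longrightarrow> singular (F + G) x t"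
  by (simp add: singular_def pderiv_add)

lemma singular_mult: "singular F x t \<Longrightarrow> singular (F * G) x t"
  by (simp add: singular_def pderiv_mult)

lemma singular_mult2:
  "poly (poly F [:t:]) x = 0 \<Longrightarrow> poly (poly G [:t:]) x = 0 \<Longrightarrow> singular (F * G) x t"
  by (simp add: singular_def pderiv_mult)

lemma singular_0: "singular 0 x t"
  by (simp add: singular_def)

lemma singular_sum: "(\<And>i. i \<in> A \<Longrightarrow> singular (F i) x t) \<Longrightarrow> singular (sum F A) x t"
  by (induction A rule: infinite_finite_induct) (auto intro: singular_add singular_0)

lemma det_only_identity:
  assumes "\<And>p. p permutes {0..<n} \<Longrightarrow> p \<noteq> id \<Longrightarrow> \<exists>i<n. E i (p i) = 0"
  shows "det (mat n n (\<lambda>(i, j). E i j)) = (\<Prod>i = 0..<n. E i i)"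
proof -
  have "det (mat n n (\<lambda>(i, j). E i j)) = (\<Sum>p \<in> {id}. signof p * (\<Prod>i = 0..<n. E i (p i)))"
    unfolding det_mat_expand
  proof (rule sum.mono_neutral_right)
    show "\<forall>p\<in>{p. p permutes {0..<n}} - {id}. signof p * (\<Prod>i = 0..<n. E i (p i)) = 0"
    proof
      fix p assume p: "p \<in> {p. p permutes {0..<n}} - {id}"
      then obtain i where "i < n" "E i (p i) = 0"
        using assms by blast
      then have "(\<Prod>i = 0..<n. E i (p i)) = 0"
        by (intro prod_zero) auto
      then show "signof p * (\<Prod>i = 0..<n. E i (p i)) = 0"
        by simp
    qed
  qed (auto simp: finite_permutations permutes_id)
  then show ?thesis
    by simp
qed

text \<open>Replacing columns \<open>a\<close> and \<open>b\<close> of the identity matrix by columns \<open>b\<close> and \<open>a\<close> of \<open>S\<close> gives an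
  invertible matrix \<open>Z\<close> such that two columns of \<open>(T - B) Z\<close> vanish at the point \<open>(x, z)\<close>.\<close>

lemma singular_of_skew_eigen:
  fixes B :: "nat \<Rightarrow> nat \<Rightarrow> complex poly" and S :: "nat \<Rightarrow> nat \<Rightarrow> complex"
  assumes skew: "\<And>i j. i < d \<Longrightarrow> j < d \<Longrightarrow> S i j = - S j i"
    and eig: "\<And>i j. i < d \<Longrightarrow> j < d \<Longrightarrow> (\<Sum>k<d. poly (B i k) x * S k j) = z * S i j"
    and ab: "a < d" "b < d" "S a b \<noteq> 0"
  shows "singular (char_pol d B) x z"
proof -
  have diag: "S i i = 0" if "i < d" for i
    using skew[OF that that] by simp
  have neq: "a \<noteq> b"
    using diag ab by auto
  define Z where "Z = (\<lambda>i j. [:[:if j = a then S i b else if j = b then S i a else if i = j then 1 else 0:]:])"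
  have detZ: "det (mat d d (\<lambda>(i, j). Z i j)) = (\<Prod>i = 0..<d. Z i i)"
  proof (rule det_only_identity, rule ccontr)
    fix p assume p: "p permutes {0..<d}" "p \<noteq> id" and "\<not> (\<exists>i<d. Z i (p i) = 0)"
    then have nz: "Z i (p i) \<noteq> 0" if "i < d" for i
      using that by blast
    \<comment> \<open>Row \<open>a\<close> of \<open>Z\<close> has no entry off the diagonal,
      because \<open>S a a\<close> is zero; the same holds for row \<open>b\<close>. The other
      columns are those of the identity.\<close>
    have "p a = a"
      using nz[OF ab(1)] diag[OF ab(1)] neq by (auto simp: Z_def split: if_splits)
    have "p b = b"
      using nz[OF ab(2)] diag[OF ab(2)] neq by (auto simp: Z_def split: if_splits)
    have "p i = i" for i
    proof (cases "i < d \<and> i \<noteq> a \<and> i \<noteq> b")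
      case True
      have "inj p"
        using p(1) permutes_inj by blast
      then have "p i \<noteq> a" "p i \<noteq> b"
        using True \<open>p a = a\<close> \<open>p b = b\<close> by (metis injD)+
      then show ?thesis
        using nz[of i] True by (auto simp: Z_def split: if_splits)
    next
      case False
      then show ?thesis
        using \<open>p a = a\<close> \<open>p b = b\<close> p(1) permutes_not_in[OF p(1), of i] by auto
    qed
    then show False
      using p(2) by auto
  qed
  define c where "c = (\<Prod>i = 0..<d. if i = a then S a b else if i = b then S b a else 1)"
  have c: "c \<noteq> 0"
    using ab skew[OF ab(1,2)] by (auto simp: c_def)
  have "(\<Prod>i\<in>A. [:[:f i:]:]) = [:[:prod f A:]:]" for f :: "nat \<Rightarrow> complex" and A
    by (induction A rule: infinite_finite_induct) (auto simp: one_pCons)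
  then have Zc: "(\<Prod>i = 0..<d. Z i i) = [:[:c:]:]"
    unfolding Z_def c_def using neq by (auto intro!: prod.cong)
  define E where "E = (\<lambda>i j. \<Sum>k<d. char_mat d B $$ (i, k) * Z k j)"
  have Mc: "char_mat d B * mat d d (\<lambda>(i, j). Z i j) = mat d d (\<lambda>(i, j). E i j)"
    using carrier_matD[OF char_mat_carrier[of d B]]
    by (intro eq_matI) (simp_all add: E_def scalar_prod_def atLeast0LessThan)
  have "char_pol d B * [:[:c:]:] = det (mat d d (\<lambda>(i, j). E i j))"
    unfolding Mc[symmetric] char_pol_def by (subst det_mult[of _ d]) (auto simp: detZ Zc)
  also have "singular \<dots> x z"
    unfolding det_mat_expand
  proof (rule singular_sum)
    fix p assume "p \<in> {p. p permutes {0..<d}}"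
    then have p: "p permutes {0..<d}"
      by simp
    have val: "poly (poly (E i j) [:z:]) x = 0" if "i < d" "j = a \<or> j = b" for i j
    proof -
      have j: "\<exists>l<d. \<forall>k. Z k j = [:[:S k l:]:]"
        using that(2) ab neq by (auto simp: Z_def)
      then obtain l where l: "l < d" "\<And>k. Z k j = [:[:S k l:]:]"
        by blast
      have "poly (poly (E i j) [:z:]) x = (\<Sum>k<d. (if i = k then z * S k l else 0) - poly (B i k) x * S k l)"
        unfolding E_def poly_sum l(2) using that(1) by (intro sum.cong) (auto simp: algebra_simps)
      also have "\<dots> = 0"
        using eig[OF that(1) l(1)] that(1) by (simp add: sum_subtractf)
      finally show ?thesis .
    qed
    \<comment> \<open>Each Leibniz term takes one factor from column \<open>a\<close> and one from
      column \<open>b\<close>. Both vanish at the point, so their product has vanishing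
      1-jet.\<close>
    obtain i1 where i1: "i1 < d" "p i1 = a"
      using permutes_image[OF p] ab(1) by (metis atLeastLessThan_iff imageE le0)
    obtain i2 where i2: "i2 < d" "p i2 = b"
      using permutes_image[OF p] ab(2) by (metis atLeastLessThan_iff imageE le0)
    have "i1 \<noteq> i2"
      using i1 i2 neq by auto
    then have "(\<Prod>i = 0..<d. E i (p i)) = E i1 a * (E i2 b * (\<Prod>i\<in>{0..<d} - {i1} - {i2}. E i (p i)))"
      using i1 i2 by (subst prod.remove[of _ i1], simp, simp, subst prod.remove[of _ i2]) auto
    then have "signof p * (\<Prod>i = 0..<d. E i (p i)) = (E i1 a * E i2 b) * (signof p * (\<Prod>i\<in>{0..<d} - {i1} - {i2}. E i (p i)))"
      by (simp add: mult_ac)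
    moreover have "singular (E i1 a * E i2 b) x z"
      by (rule singular_mult2) (use val i1 i2 in auto)
    ultimately show "singular (signof p * (\<Prod>i = 0..<d. E i (p i))) x z"
      by (metis singular_mult)
  qed
  finally have "singular (char_pol d B * [:[:c:]:]) x z" .
  then show ?thesis
    using c by (simp add: singular_def pderiv_smult)
qed

lemma nonderogatory_if_nonsingular:
  assumes "\<And>x z. \<not> singular (char_pol d B) x z"
  shows "nonderogatory d B"
  unfolding nonderogatory_def
proof (intro allI impI, rule ccontr)
  fix x z S a b
  assume *: "\<forall>i<d. \<forall>j<d. S i j = - S j i" "\<forall>i<d. \<forall>j<d. (\<Sum>k<d. poly (B i k) x * S k j) = z * S i j"
    "a < d" "b < d" "S a b \<noteq> 0"
  have "singular (char_pol d B) x z"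
    by (rule singular_of_skew_eigen[of d S B x z a b]) (use * in blast)+
  with assms show False
    by blast
qed

text \<open>Since s \<noteq> 0, the three-term recurrence determines an eigenvector by its first
  entry, whatever the diagonal.\<close>

lemma nonderogatory_tridiagonal:
  fixes s :: complex
  assumes s: "s \<noteq> 0"
  shows "nonderogatory d (\<lambda>i j. if i = j then q i else if j = Suc i \<or> i = Suc j then [:s:] else 0)"
  unfolding nonderogatory_def
proof (intro allI impI)
  fix x z :: complex and S :: "nat \<Rightarrow> nat \<Rightarrow> complex" and a b
  assume skew: "\<forall>i<d. \<forall>j<d. S i j = - S j i"
    and eig: "\<forall>i<d. \<forall>j<d. (\<Sum>k<d. poly (if i = k then q i else if k = Suc i \<or> i = Suc k then [:s:] else 0) x * S k j) = z * S i j"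
    and ab: "a < d" "b < d"
  have row: "poly (q i) x * S i j + s * S (Suc i) j + (if i = 0 then 0 else s * S (i - 1) j) = z * S i j"
    if "Suc i < d" "j < d" for i j
  proof -
    have "(\<Sum>k<d. poly (if i = k then q i else if k = Suc i \<or> i = Suc k then [:s:] else 0) x * S k j)
       = (\<Sum>k<d. (if k = i then poly (q i) x * S i j else 0) + (if k = Suc i then s * S (Suc i) j else 0)
            + (if k = i - 1 then if i = 0 then 0 else s * S (i - 1) j else 0))"
      by (intro sum.cong) auto
    also have "\<dots> = poly (q i) x * S i j + s * S (Suc i) j + (if i = 0 then 0 else s * S (i - 1) j)"
      using that by (simp add: sum.distrib)
    finally show ?thesis
      using eig that by auto
  qed
  \<comment> \<open>The recurrence has coefficients that do not depend on the column, so every row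
    of \<open>S\<close> is a multiple of row 0.\<close>
  have ratio: "\<exists>c. \<forall>j<d. S i j = c * S 0 j" if "i < d" for i
    using that
  proof (induction i rule: less_induct)
    case (less i)
    show ?case
    proof (cases i)
      case 0
      then show ?thesis
        by (intro exI[of _ 1]) auto
    next
      case (Suc m)
      obtain c1 where c1: "\<forall>j<d. S m j = c1 * S 0 j"
        using less.IH[of m] less.prems Suc by auto
      obtain c2 where c2: "m = 0 \<or> (\<forall>j<d. S (m - 1) j = c2 * S 0 j)"
        using less.IH[of "m - 1"] less.prems Suc by fastforce
      have "S (Suc m) j = ((z - poly (q m) x) * c1 - (if m = 0 then 0 else s * c2)) / s * S 0 j" if "j < d" for j
      proof -
        have "s * S (Suc m) j = (z - poly (q m) x) * S m j - (if m = 0 then 0 else s * S (m - 1) j)"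
          using row[of m j] less.prems Suc that by (auto simp: algebra_simps)
        also have "\<dots> = ((z - poly (q m) x) * c1 - (if m = 0 then 0 else s * c2)) * S 0 j"
          using c1 c2 that by (auto simp: algebra_simps)
        finally show ?thesis
          using s by (simp add: field_simps)
      qed
      then show ?thesis
        using Suc by blast
    qed
  qed
  have d: "0 < d"
    using ab by simp
  \<comment> \<open>Now \<open>S 0 0\<close> is zero, so column 0 vanishes; by skewness row 0
    vanishes, and with it every row.\<close>
  have "S 0 0 = - S 0 0"
    using skew d by blast
  then have S00: "S 0 0 = 0"
    by simp
  have "S 0 j = 0" if "j < d" for j
  proof -
    obtain c where "\<forall>k<d. S j k = c * S 0 k"
      using ratio \<open>j < d\<close> by blast
    then have "S j 0 = 0"
      using S00 d by simp
    then show ?thesis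
      using skew d that by (metis neg_equal_0_iff_equal)
  qed
  moreover obtain c where "\<forall>k<d. S a k = c * S 0 k"
    using ratio ab by blast
  ultimately show "S a b = 0"
    using ab by simp
qed

subsection \<open>Symmetric matrices with a given characteristic polynomial\<close>

text \<open>If w^(2 m) = 0, its diagonal entries are sums of squares of the entries of w^m, so w^m =
  0. Starting from the exponent 2^d \<ge> d this halves down to 1. An ordered domain is assumed
  because the lemma is applied to matrices over the reals and over real polynomials.\<close>

lemma nilpotent_symmetric_zero:
  fixes w :: "nat \<Rightarrow> nat \<Rightarrow> 'a::linordered_idom"
  assumes sym: "\<And>i j. i < d \<Longrightarrow> j < d \<Longrightarrow> w i j = w j i" and nil: "char_pol d w = monom 1 d"
    and ij: "i < d" "j < d"
  shows "w i j = 0"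
proof -
  have sympow: "mpow d w m i j = mpow d w m j i" if "i < d" "j < d" for m i j
    using that
  proof (induction m arbitrary: i j)
    case (Suc m)
    have "mpow d w (Suc m) i j = (\<Sum>k<d. w j k * mpow d w m k i)"
      unfolding mpow.simps mmul_def
    proof (intro sum.cong refl)
      fix k assume "k \<in> {..<d}"
      then show "mpow d w m i k * w k j = w j k * mpow d w m k i"
        using Suc.IH[of i k] Suc.prems sym[of k j] by simp
    qed
    also have "\<dots> = mpow d w (Suc m) j i"
      using mpow_comm[OF Suc.prems(2,1), of w m] by (simp add: mmul_def)
    finally show ?case .
  qed simp
  have addpow: "mmul d (mpow d w m) (mpow d w n) i j = mpow d w (m + n) i j" if "i < d" "j < d" for m n i j
    using that
  proof (induction n arbitrary: i j)
    case 0
    then show ?case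
      by (simp add: mmul_scal_right)
  next
    case (Suc n)
    have "mmul d (mpow d w m) (mpow d w (Suc n)) i j = mmul d (mmul d (mpow d w m) (mpow d w n)) w i j"
      by (simp add: mmul_assoc)
    also have "\<dots> = mmul d (mpow d w (m + n)) w i j"
      by (rule mmul_cong) (use Suc in auto)
    finally show ?case
      by simp
  qed
  define Z where "Z = (\<lambda>m. \<forall>i<d. \<forall>j<d. mpow d w m i j = 0)"
  have Zd: "Z d"
  proof -
    obtain n where n: "\<And>i j. i < d \<Longrightarrow> j < d \<Longrightarrow> (\<Sum>m<n. coeff (char_pol d w) m * mpow d w m i j) = 0"
      "degree (char_pol d w) < n"
      using cayley_hamilton_entry[of d w] by blast
    have "d < n"
      using n(2) char_pol_monic(1)[of d w] by simp
    moreover have "coeff (char_pol d w) m * mpow d w m i j = (if m = d then mpow d w d i j else 0)" for m i j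
      by (simp add: nil)
    ultimately show ?thesis
      using n(1) by (simp add: Z_def)
  qed
  have Zmono: "Z (m + n)" if "Z m" for m n
    unfolding Z_def
  proof (intro allI impI)
    fix i j assume "i < d" "j < d"
    then show "mpow d w (m + n) i j = 0"
      using addpow[of i j m n] that by (simp add: Z_def mmul_def)
  qed
  have half: "Z m" if "Z (m + m)" for m
    unfolding Z_def
  proof (intro allI impI)
    fix i j assume ij: "i < d" "j < d"
    have "(\<Sum>k<d. mpow d w m i k * mpow d w m i k) = mmul d (mpow d w m) (mpow d w m) i i"
      unfolding mmul_def using sympow ij by (intro sum.cong) auto
    also have "\<dots> = 0"
      using addpow[of i i m m] ij that by (simp add: Z_def)
    finally have "\<forall>k\<in>{..<d}. mpow d w m i k * mpow d w m i k = 0"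
      by (subst (asm) sum_nonneg_eq_0_iff) auto
    then show "mpow d w m i j = 0"
      using ij by auto
  qed
  have "Z 1" if "Z (2 ^ s)" for s
    using that
  proof (induction s)
    case (Suc s)
    from Suc.prems have "Z (2 ^ s + 2 ^ s)"
      by (simp only: power_Suc mult_2)
    then show ?case
      by (rule Suc.IH[OF half])
  qed simp
  moreover have "Z (2 ^ d)"
    using Zmono[OF Zd, of "2 ^ d - d"] less_exp[of d] by simp
  ultimately have "Z 1" .
  then show ?thesis
    using ij by (simp add: Z_def mmul_scal_left One_nat_def)
qed

text \<open>If the maximal degree \<open>m\<close> exceeded \<open>k\<close>, the coefficients of \<open>X^m\<close> would form a nonzero nilpotent
  symmetric matrix.\<close>

lemma degree_bound_automatic:
  fixes A :: "nat \<Rightarrow> nat \<Rightarrow> real poly"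
  assumes sym: "\<And>i j. i < d \<Longrightarrow> j < d \<Longrightarrow> A i j = A j i"
    and deg: "\<And>i. i \<le> d \<Longrightarrow> degree (coeff (char_pol d A) i) \<le> k * (d - i)"
    and ij: "i < d" "j < d"
  shows "degree (A i j) \<le> k"
proof (rule ccontr)
  assume nle: "\<not> degree (A i j) \<le> k"
  define m where "m = Max ((\<lambda>(i, j). degree (A i j)) ` ({..<d} \<times> {..<d}))"
  have le: "degree (A i j) \<le> m" if "i < d" "j < d" for i j
    unfolding m_def using that by (intro Max_ge) auto
  have "m \<in> (\<lambda>(i, j). degree (A i j)) ` ({..<d} \<times> {..<d})"
    unfolding m_def using ij by (intro Max_in) auto
  then obtain a b where ab: "a < d" "b < d" "degree (A a b) = m"
    by auto
  have mk: "m > k"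
    using nle le[OF ij] by simp
  define w where "w = (\<lambda>i j. coeff (A i j) m)"
  have top_form: "top_form m d (char_pol d A) (char_pol d w)"
    by (intro top_form_char_pol) (auto simp: top_coeff_def w_def le)
  have "char_pol d w = monom 1 d"
  proof (rule poly_eqI)
    fix l
    consider "l > d" | "l = d" | "l < d"
      by linarith
    then show "coeff (char_pol d w) l = coeff (monom 1 d) l"
    proof cases
      case 1
      then show ?thesis
        using char_pol_monic(1)[of d w] by (simp add: coeff_eq_0)
    next
      case 2
      then show ?thesis
        using char_pol_monic(2)[of d w] by simp
    next
      case 3
      have "degree (coeff (char_pol d A) l) \<le> k * (d - l)"
        using deg 3 by simp
      also have "\<dots> < m * (d - l)"
        using 3 mk by simp
      finally have "coeff (coeff (char_pol d A) l) (m * (d - l)) = 0"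
        by (rule coeff_eq_0)
      then show ?thesis
        using top_form 3 by (auto simp: top_form_def top_coeff_def)
    qed
  qed
  then have "w a b = 0"
    using ab sym by (intro nilpotent_symmetric_zero[of d w]) (auto simp: w_def)
  then have "A a b = 0"
    using ab by (auto simp: w_def)
  with ab mk show False
    by simp
qed

section \<open>Coefficientwise limits and closedness of the image\<close>

definition coeff_lim :: "(nat \<Rightarrow> real poly poly) \<Rightarrow> real poly poly \<Rightarrow> bool" where
  "coeff_lim g G \<longleftrightarrow> (\<forall>i j. (\<lambda>n. coeff (coeff (g n) i) j) \<longlonglongrightarrow> coeff (coeff G i) j)"

lemma coeff_lim_const: "coeff_lim (\<lambda>n. G) G"
  by (simp add: coeff_lim_def)

lemma coeff_lim_add: "coeff_lim g G \<Longrightarrow> coeff_lim h H \<Longrightarrow> coeff_lim (\<lambda>n. g n + h n) (G + H)"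
  by (auto simp: coeff_lim_def intro!: tendsto_intros)

lemma coeff_lim_mult: "coeff_lim g G \<Longrightarrow> coeff_lim h H \<Longrightarrow> coeff_lim (\<lambda>n. g n * h n) (G * H)"
  by (auto simp: coeff_lim_def coeff_mult coeff_sum intro!: tendsto_intros)

lemma coeff_lim_sum: "(\<And>x. x \<in> A \<Longrightarrow> coeff_lim (\<lambda>n. g n x) (G x)) \<Longrightarrow> coeff_lim (\<lambda>n. sum (g n) A) (sum G A)"
  by (induction A rule: infinite_finite_induct) (auto intro: coeff_lim_const coeff_lim_add)

lemma coeff_lim_prod: "(\<And>x. x \<in> A \<Longrightarrow> coeff_lim (\<lambda>n. g n x) (G x)) \<Longrightarrow> coeff_lim (\<lambda>n. prod (g n) A) (prod G A)"
  by (induction A rule: infinite_finite_induct) (auto intro: coeff_lim_const coeff_lim_mult)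

lemma coeff_lim_unique: "coeff_lim g G \<Longrightarrow> coeff_lim g H \<Longrightarrow> G = H"
  unfolding coeff_lim_def by (intro poly_eqI) (blast intro: LIMSEQ_unique)

lemma coeff_lim_subseq: "coeff_lim g G \<Longrightarrow> strict_mono r \<Longrightarrow> coeff_lim (\<lambda>n. g (r n)) G"
  unfolding coeff_lim_def using LIMSEQ_subseq_LIMSEQ[unfolded o_def] by blast

lemma coeff_lim_char_pol:
  assumes "\<And>i j e. i < d \<Longrightarrow> j < d \<Longrightarrow> (\<lambda>n. coeff (A n i j) e) \<longlonglongrightarrow> coeff (B i j) e"
  shows "coeff_lim (\<lambda>n. char_pol d (A n)) (char_pol d B)"
proof -
  have entry: "coeff_lim (\<lambda>n. (if i = j then [:0, 1:] else 0) - [:A n i j:]) ((if i = j then [:0, 1:] else 0) - [:B i j:])"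
    if "i < d" "j < d" for i j
  proof -
    have c: "coeff (coeff (E - [:b:]) a) e = coeff (coeff E a) e - (if a = 0 then coeff b e else 0)"
      for E :: "real poly poly" and b a e
      by (cases a) auto
    have "(\<lambda>n. coeff (coeff (E - [:A n i j:]) a) e) \<longlonglongrightarrow> coeff (coeff (E - [:B i j:]) a) e"
      for E :: "real poly poly" and a e
      unfolding c by (intro tendsto_intros) (use assms[OF that] in auto)
    then show ?thesis
      unfolding coeff_lim_def by blast
  qed
  show ?thesis
    unfolding char_pol_def char_mat_def det_mat_expand
    by (intro coeff_lim_sum coeff_lim_mult coeff_lim_const coeff_lim_prod entry) (auto simp: permutes_in_image)
qed

lemma convergent_subseq_family:
  fixes g :: "nat \<Rightarrow> 'i \<Rightarrow> real"
  assumes "finite I" "\<And>i n. i \<in> I \<Longrightarrow> \<bar>g n i\<bar> \<le> M"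
  shows "\<exists>r. strict_mono (r :: nat \<Rightarrow> nat) \<and> (\<forall>i\<in>I. convergent (\<lambda>n. g (r n) i))"
  using assms
proof (induction I rule: finite_induct)
  case empty
  show ?case
    by (intro exI[of _ id]) (auto simp: strict_mono_def)
next
  case (insert x I)
  then obtain r where r: "strict_mono r" "\<And>i. i \<in> I \<Longrightarrow> convergent (\<lambda>n. g (r n) i)"
    by auto
  have "bounded (range (\<lambda>n. g (r n) x))"
    using insert.prems by (intro boundedI[of _ M]) auto
  then obtain l s where s: "strict_mono (s :: nat \<Rightarrow> nat)" "((\<lambda>n. g (r n) x) \<circ> s) \<longlonglongrightarrow> l"
    using bounded_imp_convergent_subsequence by blast
  have "convergent (\<lambda>n. g ((r \<circ> s) n) i)" if "i \<in> insert x I" for i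
  proof (cases "i = x")
    case True
    with s(2) show ?thesis
      by (auto simp: convergent_def o_def)
  next
    case False
    then have "convergent ((\<lambda>n. g (r n) i) \<circ> s)"
      using that r(2) s(1) by (intro convergent_subseq_convergent) auto
    then show ?thesis
      by (simp add: o_def)
  qed
  with strict_mono_o[OF r(1) s(1)] show ?case
    by blast
qed

lemma bounded_matrices_limit:
  fixes A :: "nat \<Rightarrow> nat \<Rightarrow> nat \<Rightarrow> real poly"
  assumes deg: "\<And>n i j. i < d \<Longrightarrow> j < d \<Longrightarrow> degree (A n i j) \<le> K"
    and bd: "\<And>n i j e. i < d \<Longrightarrow> j < d \<Longrightarrow> \<bar>coeff (A n i j) e\<bar> \<le> M"
  obtains r B where "strict_mono (r :: nat \<Rightarrow> nat)"
    "\<And>i j e. i < d \<Longrightarrow> j < d \<Longrightarrow> (\<lambda>n. coeff (A (r n) i j) e) \<longlonglongrightarrow> coeff (B i j) e"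
proof -
  let ?I = "{..<d} \<times> {..<d} \<times> {..K}"
  have "\<exists>r. strict_mono (r :: nat \<Rightarrow> nat) \<and> (\<forall>p\<in>?I. convergent (\<lambda>n. (\<lambda>n (i, j, e). coeff (A n i j) e) (r n) p))"
    by (rule convergent_subseq_family) (use bd in auto)
  then obtain r where r: "strict_mono r"
    "\<And>i j e. i < d \<Longrightarrow> j < d \<Longrightarrow> e \<le> K \<Longrightarrow> convergent (\<lambda>n. coeff (A (r n) i j) e)"
    by auto
  define B where "B = (\<lambda>i j. \<Sum>e\<le>K. monom (lim (\<lambda>n. coeff (A (r n) i j) e)) e)"
  show thesis
  proof (rule that[OF r(1), of B])
    fix i j e assume ij: "i < d" "j < d"
    have B: "coeff (B i j) e = (if e \<le> K then lim (\<lambda>n. coeff (A (r n) i j) e) else 0)"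
      by (simp add: B_def coeff_sum)
    show "(\<lambda>n. coeff (A (r n) i j) e) \<longlonglongrightarrow> coeff (B i j) e"
    proof (cases "e \<le> K")
      case True
      then show ?thesis
        using r(2)[OF ij] by (simp add: B convergent_LIMSEQ_iff)
    next
      case False
      then have "coeff (A (r n) i j) e = 0" for n
        using deg[OF ij, of "r n"] by (intro coeff_eq_0) simp
      then show ?thesis
        using False by (simp add: B)
    qed
  qed
qed

text \<open>Homogeneity, det (c T - c A) = c^d det (T - A), in a form without division; it serves
  for real scalars and for constant polynomials.\<close>

lemma coeff_char_pol_smult:
  "coeff (char_pol d (\<lambda>i j. c * A i j)) i * c ^ i = c ^ d * coeff (char_pol d A) i"
proof -
  define C where "C = [:c:]"
  have "char_pol d (\<lambda>i j. c * A i j) \<circ>\<^sub>p [:0, c:] = C ^ d * char_pol d A"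
  proof -
    have pc: "(\<Sum>p\<in>S. g p) \<circ>\<^sub>p q = (\<Sum>p\<in>S. g p \<circ>\<^sub>p q)" for g q and S :: "(nat \<Rightarrow> nat) set"
      by (induction S rule: infinite_finite_induct) (auto simp: pcompose_add)
    have pp: "(\<Prod>p\<in>S. g p) \<circ>\<^sub>p q = (\<Prod>p\<in>S. g p \<circ>\<^sub>p q)" for g q and S :: "nat set"
      by (induction S rule: infinite_finite_induct) (auto simp: pcompose_mult pcompose_1)
    have sg: "signof p \<circ>\<^sub>p q = signof p" for p :: "nat \<Rightarrow> nat" and q
      by (auto simp: sign_def pcompose_1 pcompose_uminus)
    have entry: "((if i = j then [:0, 1:] else 0) - [:c * A i j:]) \<circ>\<^sub>p [:0, c:]
       = C * ((if i = j then [:0, 1:] else 0) - [:A i j:])" for i j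
      by (simp add: C_def pcompose_diff pcompose_pCons algebra_simps)
    show ?thesis
      unfolding char_pol_def char_mat_def det_mat_expand pc pcompose_mult sg pp entry
      by (simp add: prod.distrib sum_distrib_left mult_ac)
  qed
  from arg_cong[OF this, of "\<lambda>p. coeff p i"] show ?thesis
    by (simp add: coeff_pcompose_linear poly_const_pow C_def mult.commute)
qed


text \<open>An unbounded sequence, rescaled to norm 1, would converge to a nonzero symmetric matrix with
  characteristic polynomial \<open>T^d\<close>.\<close>

lemma char_pol_limit:
  fixes A :: "nat \<Rightarrow> nat \<Rightarrow> nat \<Rightarrow> real poly"
  assumes sym: "\<And>n i j. i < d \<Longrightarrow> j < d \<Longrightarrow> A n i j = A n j i"
    and deg: "\<And>n i j. i < d \<Longrightarrow> j < d \<Longrightarrow> degree (A n i j) \<le> K"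
    and lim: "coeff_lim (\<lambda>n. char_pol d (A n)) f"
  obtains r B where "strict_mono (r :: nat \<Rightarrow> nat)"
    "\<And>i j e. i < d \<Longrightarrow> j < d \<Longrightarrow> (\<lambda>n. coeff (A (r n) i j) e) \<longlonglongrightarrow> coeff (B i j) e"
    "char_pol d B = f"
proof -
  define I where "I = {..<d} \<times> {..<d} \<times> {..K}"
  have finI: "finite I"
    by (simp add: I_def)
  \<comment> \<open>The norm used for rescaling: the sum of the absolute values of all
    coefficients.\<close>
  define \<rho> where "\<rho> = (\<lambda>n. \<Sum>(i, j, e)\<in>I. \<bar>coeff (A n i j) e\<bar>)"
  have le_\<rho>: "\<bar>coeff (A n i j) e\<bar> \<le> \<rho> n" if "i < d" "j < d" for n i j e
  proof (cases "e \<le> K")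
    case True
    have "(\<lambda>(i, j, e). \<bar>coeff (A n i j) e\<bar>) (i, j, e) \<le> \<rho> n"
      unfolding \<rho>_def using True that finI by (intro member_le_sum) (auto simp: I_def)
    then show ?thesis
      by simp
  next
    case False
    then have "coeff (A n i j) e = 0"
      using deg[OF that, of n] by (intro coeff_eq_0) simp
    moreover have "\<rho> n \<ge> 0"
      unfolding \<rho>_def by (intro sum_nonneg) auto
    ultimately show ?thesis
      by simp
  qed
  have "\<exists>M. \<forall>n. \<rho> n \<le> M"
  proof (rule ccontr)
    assume unb: "\<not> (\<exists>M. \<forall>n. \<rho> n \<le> M)"
    have ex: "\<exists>p. \<rho> p > real (n + 1) \<and> p > m" for n m
    proof (rule ccontr)
      assume *: "\<not> (\<exists>p. \<rho> p > real (n + 1) \<and> p > m)"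
      have "\<rho> p \<le> max (real (n + 1)) (Max (\<rho> ` {..m}))" for p
      proof (cases "p \<le> m")
        case True
        then have "\<rho> p \<le> Max (\<rho> ` {..m})"
          by (intro Max_ge) auto
        then show ?thesis
          by simp
      next
        case False
        with * have "\<rho> p \<le> real (n + 1)"
          by (auto simp: not_less)
        then show ?thesis
          by (rule max.coboundedI1)
      qed
      with unb show False
        by blast
    qed
    have "\<exists>p. \<forall>n. \<rho> (p n) > real (n + 1) \<and> p (Suc n) > p n"
    proof (rule dependent_nat_choice)
      show "\<exists>p. \<rho> p > real (0 + 1)"
        using ex[of 0 0] by blast
      show "\<exists>q. \<rho> q > real (Suc n + 1) \<and> q > p" for p n
        using ex[of "Suc n" p] by blast
    qed
    then obtain p where p: "\<And>n. \<rho> (p n) > real (n + 1) \<and> p (Suc n) > p n"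
      by blast
    have pm: "strict_mono p"
      using p by (simp add: strict_mono_Suc_iff)
    define c where "c = (\<lambda>n. 1 / \<rho> (p n))"
    have \<rho>pos: "\<rho> (p n) > 0" for n
      using p[of n] by (meson le_less_trans of_nat_0_le_iff)
    have c0: "c \<longlonglongrightarrow> 0"
    proof (rule tendsto_sandwich[OF _ _ tendsto_const LIMSEQ_inverse_real_of_nat])
      show "\<forall>\<^sub>F n in sequentially. 0 \<le> c n"
        using \<rho>pos by (simp add: c_def less_imp_le)
      show "\<forall>\<^sub>F n in sequentially. c n \<le> inverse (real (Suc n))"
        using p \<rho>pos by (simp add: c_def inverse_eq_divide frac_le less_imp_le)
    qed
    define w where "w = (\<lambda>n i j. [:c n:] * A (p n) i j)"
    have w_le: "\<bar>coeff (w n i j) e\<bar> \<le> 1" if "i < d" "j < d" for n i j e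
      using le_\<rho>[OF that, of "p n" e] \<rho>pos[of n] by (simp add: w_def c_def abs_mult)
    have wdeg: "degree (w n i j) \<le> K" if "i < d" "j < d" for n i j
      using deg[OF that, of "p n"] by (simp add: w_def)
    obtain r W where r: "strict_mono (r :: nat \<Rightarrow> nat)"
      and W: "\<And>i j e. i < d \<Longrightarrow> j < d \<Longrightarrow> (\<lambda>n. coeff (w (r n) i j) e) \<longlonglongrightarrow> coeff (W i j) e"
      using bounded_matrices_limit[of d w K 1, OF wdeg w_le] by blast
    have c0r: "(\<lambda>n. c (r n)) \<longlonglongrightarrow> 0"
      using LIMSEQ_subseq_LIMSEQ[OF c0 r] by (simp add: o_def)
    have lim': "coeff_lim (\<lambda>n. char_pol d (A (p (r n)))) f"
      using coeff_lim_subseq[OF coeff_lim_subseq[OF lim pm] r] .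
    have cW: "coeff_lim (\<lambda>n. char_pol d (w (r n))) (char_pol d W)"
      by (rule coeff_lim_char_pol) (rule W)
    \<comment> \<open>For i < d the coefficient of T^i is scaled by c^(d - i), which tends to 0,
      while the unscaled coefficients converge.\<close>
    have nil: "char_pol d W = monom 1 d"
    proof (rule coeff_lim_unique[OF cW])
      have "(\<lambda>n. coeff (coeff (char_pol d (w (r n))) i) j) \<longlonglongrightarrow> coeff (coeff (monom 1 d) i) j" for i j
      proof -
        consider "i > d" | "i = d" | "i < d"
          by linarith
        then show ?thesis
        proof cases
          case 1
          then have "coeff (char_pol d (w (r n))) i = 0" for n
            using char_pol_monic(1)[of d "w (r n)"] by (intro coeff_eq_0) simp
          then show ?thesis
            using 1 by simp
        next
          case 2
          then show ?thesis
            by (simp add: char_pol_monic)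
        next
          case 3
          have eq: "coeff (char_pol d (w (r n))) i = [:c (r n) ^ (d - i):] * coeff (char_pol d (A (p (r n)))) i" for n
          proof -
            define q where "q = [:c (r n):]"
            have q0: "q \<noteq> 0"
              using \<rho>pos[of "r n"] by (simp add: q_def c_def)
            have "coeff (char_pol d (w (r n))) i * q ^ i = q ^ (d - i) * q ^ i * coeff (char_pol d (A (p (r n)))) i"
              using coeff_char_pol_smult[of d q "A (p (r n))" i] 3 by (simp add: w_def q_def power_add[symmetric])
            then have "coeff (char_pol d (w (r n))) i = q ^ (d - i) * coeff (char_pol d (A (p (r n)))) i"
              using q0 by simp
            then show ?thesis
              by (simp add: q_def poly_const_pow)
          qed
          have "(\<lambda>n. c (r n) ^ (d - i) * coeff (coeff (char_pol d (A (p (r n)))) i) j) \<longlonglongrightarrow> 0 ^ (d - i) * coeff (coeff f i) j"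
            using lim' by (intro tendsto_intros c0r) (simp add: coeff_lim_def)
          then show ?thesis
            using 3 by (simp add: eq zero_power)
        qed
      qed
      then show "coeff_lim (\<lambda>n. char_pol d (w (r n))) (monom 1 d)"
        unfolding coeff_lim_def by blast
    qed
    have symW: "W i j = W j i" if "i < d" "j < d" for i j
    proof (rule poly_eqI)
      fix e
      have "(\<lambda>n. coeff (w (r n) i j) e) = (\<lambda>n. coeff (w (r n) j i) e)"
        using sym[OF that] by (simp add: w_def)
      from W[OF that, of e, unfolded this] W[OF that(2,1), of e]
      show "coeff (W i j) e = coeff (W j i) e"
        by (rule LIMSEQ_unique)
    qed
    have W0: "W i j = 0" if "i < d" "j < d" for i j
      by (rule nilpotent_symmetric_zero[OF symW nil that])
    \<comment> \<open>The norms converge too: they are constantly 1, while the limit matrix is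
      zero.\<close>
    have "(\<lambda>n. \<Sum>(i, j, e)\<in>I. \<bar>coeff (w (r n) i j) e\<bar>) \<longlonglongrightarrow> (\<Sum>(i, j, e)\<in>I. \<bar>coeff (W i j) e\<bar>)"
      unfolding case_prod_beta by (intro tendsto_intros W) (auto simp: I_def)
    also have "(\<Sum>(i, j, e)\<in>I. \<bar>coeff (W i j) e\<bar>) = 0"
      using W0 by (intro sum.neutral) (auto simp: I_def)
    also have "(\<lambda>n. \<Sum>(i, j, e)\<in>I. \<bar>coeff (w (r n) i j) e\<bar>) = (\<lambda>n. 1)"
    proof
      fix n
      have "(\<Sum>(i, j, e)\<in>I. \<bar>coeff (w (r n) i j) e\<bar>) = c (r n) * \<rho> (p (r n))"
        unfolding \<rho>_def sum_distrib_left case_prod_beta using \<rho>pos[of "r n"]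
        by (intro sum.cong) (auto simp: w_def c_def abs_mult)
      also have "\<dots> = 1"
        using \<rho>pos[of "r n"] by (simp add: c_def)
      finally show "(\<Sum>(i, j, e)\<in>I. \<bar>coeff (w (r n) i j) e\<bar>) = 1" .
    qed
    finally show False
      by (simp add: LIMSEQ_const_iff)
  qed
  then obtain M where "\<And>n. \<rho> n \<le> M"
    by blast
  then have bd: "\<bar>coeff (A n i j) e\<bar> \<le> M" if "i < d" "j < d" for n i j e
    using le_\<rho>[OF that, of n e] by (meson order_trans)
  obtain r B where r: "strict_mono (r :: nat \<Rightarrow> nat)"
    and B: "\<And>i j e. i < d \<Longrightarrow> j < d \<Longrightarrow> (\<lambda>n. coeff (A (r n) i j) e) \<longlonglongrightarrow> coeff (B i j) e"
    using bounded_matrices_limit[of d A K M, OF deg bd] by blast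
  have "char_pol d B = f"
    by (rule coeff_lim_unique[OF coeff_lim_char_pol[OF B] coeff_lim_subseq[OF lim r]])
  with r B show thesis
    by (rule that)
qed

subsection \<open>Characteristic polynomials of symmetric matrices are real rooted\<close>

lemma map_poly_char_pol:
  assumes "comm_ring_hom h"
  shows "map_poly h (char_pol d B) = char_pol d (\<lambda>i j. h (B i j))"
proof -
  interpret comm_ring_hom h
    by fact
  have "map_mat h (mat d d (\<lambda>(i, j). B i j)) = mat d d (\<lambda>(i, j). h (B i j))"
    by auto
  then show ?thesis
    unfolding char_pol_char_poly using char_poly_hom[of "mat d d (\<lambda>(i, j). B i j)" d] by simp
qed

text \<open>For an eigenvector v, the form v* A v is its own conjugate by symmetry and equals z
  times the positive number |v|^2.\<close>

lemma char_pol_symmetric_roots_real: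
  fixes A :: "nat \<Rightarrow> nat \<Rightarrow> real"
  assumes sym: "\<And>i j. i < d \<Longrightarrow> j < d \<Longrightarrow> A i j = A j i"
    and root: "poly (map_poly complex_of_real (char_pol d A)) z = 0"
  shows "z \<in> \<real>"
proof -
  have h: "comm_ring_hom complex_of_real"
    by unfold_locales auto
  define M where "M = mat d d (\<lambda>(i, j). complex_of_real (A i j))"
  have M: "M \<in> carrier_mat d d"
    by (simp add: M_def)
  have "poly (char_poly M) z = 0"
    using root unfolding map_poly_char_pol[OF h] by (simp add: char_pol_char_poly M_def)
  then obtain v where v: "v \<in> carrier_vec d" "v \<noteq> 0\<^sub>v d" "M *\<^sub>v v = z \<cdot>\<^sub>v v"
    using eigenvalue_root_char_poly[OF M] M unfolding eigenvalue_def eigenvector_def by auto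
  define u where "u = (\<lambda>i. vec_index v i)"
  have eq: "(\<Sum>j<d. complex_of_real (A i j) * u j) = z * u i" if "i < d" for i
  proof -
    have "(\<Sum>j<d. complex_of_real (A i j) * u j) = vec_index (M *\<^sub>v v) i"
      using that v(1) by (simp add: M_def u_def scalar_prod_def atLeast0LessThan)
    then show ?thesis
      using that v by (simp add: u_def)
  qed
  define q where "q = (\<Sum>i<d. \<Sum>j<d. complex_of_real (A i j) * (cnj (u i) * u j))"
  have "cnj q = (\<Sum>i<d. \<Sum>j<d. complex_of_real (A i j) * (u i * cnj (u j)))"
    by (simp add: q_def)
  also have "\<dots> = (\<Sum>j<d. \<Sum>i<d. complex_of_real (A i j) * (u i * cnj (u j)))"
    by (rule sum.swap)
  also have "\<dots> = q"
    unfolding q_def using sym by (intro sum.cong refl) (simp add: mult.commute)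
  finally have qr: "cnj q = q" .
  have qz: "q = z * complex_of_real (\<Sum>i<d. (cmod (u i))\<^sup>2)"
  proof -
    have "q = (\<Sum>i<d. cnj (u i) * (\<Sum>j<d. complex_of_real (A i j) * u j))"
      by (simp add: q_def sum_distrib_left mult_ac)
    also have "\<dots> = (\<Sum>i<d. z * complex_of_real ((cmod (u i))\<^sup>2))"
      unfolding complex_norm_square using eq by (intro sum.cong refl) simp
    finally show ?thesis
      by (simp add: sum_distrib_left)
  qed
  define s where "s = (\<Sum>i<d. (cmod (u i))\<^sup>2)"
  have "s \<noteq> 0"
  proof
    assume "s = 0"
    then have "\<forall>i\<in>{..<d}. (cmod (u i))\<^sup>2 = 0"
      unfolding s_def by (subst (asm) sum_nonneg_eq_0_iff) auto
    then have "v = 0\<^sub>v d"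
      using v(1) by (intro eq_vecI) (auto simp: u_def)
    with v(2) show False
      by simp
  qed
  moreover have "cnj z * complex_of_real s = z * complex_of_real s"
    using qr qz by (simp add: s_def[symmetric])
  ultimately have "cnj z = z"
    by simp
  then show ?thesis
    by (simp add: complex_is_Real_iff complex_eq_iff)
qed

lemma specialize_char_pol: "specialize_X x (char_pol d A) = char_pol d (\<lambda>i j. poly (A i j) x)"
proof -
  have "comm_ring_hom (\<lambda>a :: real poly. poly a x)"
    by unfold_locales auto
  then show ?thesis
    by (simp add: specialize_X_def map_poly_char_pol)
qed

text \<open>The weight bounds are those of \<open>top_form\<close>; the roots are real because
  evaluating \<open>A\<close> at a real x gives a real symmetric matrix.\<close>

lemma chi_map_in_H:
  assumes A: "A \<in> S_mats k d"
  shows "chi_map d A \<in> H_polys k d"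
proof -
  let ?A = "\<lambda>i j. A $$ (i, j)"
  have carr: "A \<in> carrier_mat d d" and symA: "transpose_mat A = A"
    and deg: "degree (?A i j) \<le> k" if "i < d" "j < d" for i j
    using A that by (auto simp: S_mats_def)
  have carr: "A \<in> carrier_mat d d" and symA: "transpose_mat A = A"
    using A by (auto simp: S_mats_def)
  have sym: "?A i j = ?A j i" if "i < d" "j < d" for i j
    using arg_cong[OF symA, of "\<lambda>M. M $$ (i, j)"] carr that by simp
  have f: "chi_map d A = char_pol d ?A"
    by (rule chi_map_eq_char_pol[OF carr])
  have top_form: "top_form k d (char_pol d ?A) (char_pol d (\<lambda>i j. coeff (?A i j) k))"
    by (intro top_form_char_pol) (simp add: top_coeff_def deg)
  have "char_pol d ?A = (\<Sum>i\<le>d. monom (coeff (char_pol d ?A) i) i)"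
    using char_pol_monic(1)[of d ?A] by (simp add: poly_as_sum_of_monoms')
  moreover have "\<forall>i\<le>d. degree (coeff (char_pol d ?A) i) \<le> k * (d - i)"
    using top_form by (simp add: top_form_def top_coeff_def)
  ultimately have "char_pol d ?A \<in> weighted_polys k d"
    unfolding weighted_polys_def by blast
  moreover have "T_real_rooted (char_pol d ?A)"
    unfolding T_real_rooted_def real_rooted_def specialize_char_pol
  proof (intro allI conjI impI)
    fix x z
    show "lead_coeff (char_pol d (\<lambda>i j. poly (?A i j) x)) = 1"
      by (simp add: char_pol_monic)
    assume "poly (cpoly (char_pol d (\<lambda>i j. poly (?A i j) x))) z = 0"
    then show "z \<in> \<real>"
      by (rule char_pol_symmetric_roots_real[rotated]) (simp only: sym)
  qed
  ultimately show ?thesis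
    using char_pol_monic(1) by (simp add: H_polys_def f)
qed

subsection \<open>Separating the roots of real rooted polynomials\<close>

definition linear_prod :: "nat \<Rightarrow> (nat \<Rightarrow> real) \<Rightarrow> real poly" where
  "linear_prod d r = (\<Prod>i<d. [:- r i, 1:])"

text \<open>The operator 1 - c d/dT of Nuij, which keeps roots real and splits multiple
  ones.\<close>

definition nuij :: "real \<Rightarrow> real poly \<Rightarrow> real poly" where
  "nuij c p = p - smult c (pderiv p)"

lemma degree_linear_prod: "degree (linear_prod d r) = d" and lead_linear_prod: "coeff (linear_prod d r) d = 1"
proof -
  have "degree (linear_prod d r) = d \<and> lead_coeff (linear_prod d r) = 1"
    unfolding linear_prod_def
  proof (induction d)
    case (Suc d)
    define P L where "P = (\<Prod>i<d. [:- r i, 1:])" and "L = [:- r d, 1:]"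
    have P: "degree P = d" "lead_coeff P = 1"
      unfolding P_def using Suc.IH by blast+
    have L: "degree L = 1" "lead_coeff L = 1" "L \<noteq> 0"
      by (simp_all add: L_def)
    from P have "P \<noteq> 0"
      by auto
    with L have "degree (P * L) = degree P + degree L"
      by (intro degree_mult_eq)
    then have "degree (P * L) = Suc d"
      using P(1) L(1) by simp
    moreover have "lead_coeff (P * L) = lead_coeff P * lead_coeff L"
      by (rule lead_coeff_mult)
    then have "lead_coeff (P * L) = 1"
      by (simp only: P(2) L(2) mult_1)
    ultimately have "degree (P * L) = Suc d \<and> lead_coeff (P * L) = 1"
      by blast
    then show ?case
      unfolding prod.lessThan_Suc P_def L_def .
  qed simp
  then show "degree (linear_prod d r) = d" "coeff (linear_prod d r) d = 1"
    by auto
qed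

lemma complex_roots_real_split:
  fixes p :: "real poly"
  assumes deg: "degree p = d" and lead: "coeff p d = 1"
    and real: "\<And>z. poly (map_poly complex_of_real p) z = 0 \<Longrightarrow> z \<in> \<real>"
  obtains r where "p = linear_prod d r"
proof -
  interpret ch: map_poly_inj_idom_hom complex_of_real ..
  obtain as where as: "smult (coeff (cpoly p) (degree (cpoly p))) (\<Prod>a\<leftarrow>as. [:- a, 1:]) = cpoly p"
    "length as = degree (cpoly p)"
    using fundamental_theorem_algebra_factorized by blast
  have p: "cpoly p = (\<Prod>a\<leftarrow>as. [:- a, 1:])" and len: "length as = d"
    using as deg lead by simp_all
  define r where "r = (\<lambda>i. Re (as ! i))"
  have "as ! i \<in> \<real>" if "i < d" for i
  proof (rule real)
    have "poly (\<Prod>a\<leftarrow>as. [:- a, 1:]) (as ! i) = 0"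
      using that len by (simp add: poly_prod_list prod_list_zero_iff image_iff)
    then show "poly (cpoly p) (as ! i) = 0"
      by (simp add: p)
  qed
  then have r: "as ! i = complex_of_real (r i)" if "i < d" for i
    using that by (simp add: r_def complex_is_Real_iff complex_eq_iff)
  have "cpoly p = (\<Prod>i<d. [:- (as ! i), 1:])"
    unfolding p prod.list_conv_set_nth by (simp add: len atLeast0LessThan)
  also have "\<dots> = (\<Prod>i<d. cpoly [:- r i, 1:])"
    using r by (intro prod.cong) auto
  also have "\<dots> = cpoly (linear_prod d r)"
    by (simp add: linear_prod_def ch.hom_prod)
  finally have "p = linear_prod d r"
    by simp
  then show thesis
    by (rule that)
qed

lemma log_derivative:
  fixes r :: "nat \<Rightarrow> 'a::field"
  assumes "\<And>i. i < d \<Longrightarrow> z \<noteq> r i"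
  shows "poly (pderiv (\<Prod>i<d. [:- r i, 1:])) z = poly (\<Prod>i<d. [:- r i, 1:]) z * (\<Sum>i<d. 1 / (z - r i))"
  using assms
proof (induction d)
  case (Suc d)
  define P where "P = (\<Prod>i<d. [:- r i, 1:])"
  have IH: "poly (pderiv P) z = poly P z * (\<Sum>i<d. 1 / (z - r i))"
    unfolding P_def by (rule Suc.IH) (use Suc.prems in auto)
  define L where "L = [:- r d, 1:]"
  have L: "pderiv L = 1" "poly L z = z - r d" "z - r d \<noteq> 0"
    using Suc.prems by (simp_all add: L_def pderiv_pCons)
  have "poly (pderiv (P * L)) z = poly P z + (z - r d) * poly (pderiv P) z"
    by (simp add: pderiv_mult L)
  also have "\<dots> = poly (P * L) z * ((\<Sum>i<d. 1 / (z - r i)) + 1 / (z - r d))"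
    using L(3) by (simp add: L(2) IH distrib_left)
  finally show ?case
    by (simp only: prod.lessThan_Suc sum.lessThan_Suc P_def L_def)
qed simp

text \<open>F'' / F is the square of F' / F plus the derivative of F' / F.\<close>

lemma log_derivative2:
  fixes r :: "nat \<Rightarrow> real"
  assumes "\<And>i. i < d \<Longrightarrow> z \<noteq> r i"
  shows "poly (pderiv (pderiv (linear_prod d r))) z
     = poly (linear_prod d r) z * ((\<Sum>i<d. 1 / (z - r i))\<^sup>2 - (\<Sum>i<d. 1 / (z - r i)\<^sup>2))"
  using assms
proof (induction d)
  case (Suc d)
  define P where "P = linear_prod d r"
  define L where "L = (\<Sum>i<d. 1 / (z - r i))"
  define Q where "Q = (\<Sum>i<d. 1 / (z - r i)\<^sup>2)"
  define e where "e = z - r d"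
  have e: "e \<noteq> 0"
    using Suc.prems by (simp add: e_def)
  have IH: "poly (pderiv (pderiv P)) z = poly P z * (L\<^sup>2 - Q)"
    unfolding P_def L_def Q_def by (rule Suc.IH) (use Suc.prems in auto)
  have D1: "poly (pderiv P) z = poly P z * L"
    unfolding P_def L_def linear_prod_def by (rule log_derivative) (use Suc.prems in auto)
  define M where "M = [:- r d, 1:]"
  have M: "pderiv M = 1" "poly M z = e"
    by (simp_all add: M_def e_def pderiv_pCons)
  have S: "linear_prod (Suc d) r = P * M"
    by (simp only: linear_prod_def P_def M_def prod.lessThan_Suc)
  have "poly (pderiv (pderiv (linear_prod (Suc d) r))) z = 2 * poly (pderiv P) z + e * poly (pderiv (pderiv P)) z"
    unfolding S by (simp add: pderiv_mult pderiv_add M)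
  also have "\<dots> = poly P z * e * ((L + 1 / e)\<^sup>2 - (Q + 1 / e\<^sup>2))"
    using e unfolding IH D1 by (simp add: field_simps power2_eq_square)
  finally show ?case
    unfolding S by (simp add: M L_def Q_def e_def[symmetric])
qed (simp add: linear_prod_def)

text \<open>At a non-real z, F - c F' = F (1 - c \<Sum> 1 / (z - r i)). All summands have imaginary
  parts of sign opposite to Im z, so the sum is non-real (or empty) and the bracket cannot
  vanish.\<close>

lemma nuij_real_rooted:
  assumes c: "c \<noteq> 0"
  obtains r' where "nuij c (linear_prod d r) = linear_prod d r'"
proof (rule complex_roots_real_split)
  interpret ch: map_poly_inj_idom_hom complex_of_real ..
  let ?F = "linear_prod d r"
  have pd: "degree (smult c (pderiv ?F)) < d" if "d \<noteq> 0"
    using degree_linear_prod[of d r] that by (simp add: degree_pderiv)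
  show "degree (nuij c ?F) = d"
  proof (cases "d = 0")
    case True
    then show ?thesis
      by (simp add: nuij_def linear_prod_def)
  next
    case False
    then show ?thesis
      unfolding nuij_def using pd degree_linear_prod[of d r]
      by (subst diff_conv_add_uminus, subst degree_add_eq_left) auto
  qed
  show "coeff (nuij c ?F) d = 1"
    using lead_linear_prod[of d r] degree_linear_prod[of d r]
    by (simp add: nuij_def coeff_pderiv coeff_eq_0)
  fix z assume root: "poly (cpoly (nuij c ?F)) z = 0"
  show "z \<in> \<real>"
  proof (rule ccontr)
    assume nz: "z \<notin> \<real>"
    then have im: "Im z \<noteq> 0"
      by (simp add: complex_is_Real_iff)
    have ne: "z \<noteq> complex_of_real (r i)" for i
      using nz by auto
    have F: "cpoly ?F = (\<Prod>i<d. [:- complex_of_real (r i), 1:])"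
      by (simp add: linear_prod_def ch.hom_prod)
    have F0: "poly (cpoly ?F) z \<noteq> 0"
      using ne by (simp add: F poly_prod)
    have "cpoly (nuij c ?F) = cpoly ?F - smult (complex_of_real c) (pderiv (cpoly ?F))"
      by (simp add: nuij_def ch.hom_minus of_real_hom.map_poly_pderiv of_real_hom.map_poly_hom_smult)
    moreover have "poly (pderiv (cpoly ?F)) z = poly (cpoly ?F) z * (\<Sum>i<d. 1 / (z - complex_of_real (r i)))"
      unfolding F by (rule log_derivative) (rule ne)
    ultimately have "poly (cpoly ?F) z * (1 - complex_of_real c * (\<Sum>i<d. 1 / (z - complex_of_real (r i)))) = 0"
      using root by (simp add: right_diff_distrib mult.left_commute)
    then have "complex_of_real c * (\<Sum>i<d. 1 / (z - complex_of_real (r i))) = 1"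
      using F0 by simp
    then have "Im (complex_of_real c * (\<Sum>i<d. 1 / (z - complex_of_real (r i)))) = 0" and "d \<noteq> 0"
      by (auto intro: Nat.gr0I)
    then have s0: "(\<Sum>i<d. Im (1 / (z - complex_of_real (r i)))) = 0"
      using c by simp
    have "Im (1 / (z - complex_of_real (r i))) = - Im z * (1 / (cmod (z - complex_of_real (r i)))\<^sup>2)" for i
      by (simp add: Im_divide cmod_def)
    then have "- Im z * (\<Sum>i<d. 1 / (cmod (z - complex_of_real (r i)))\<^sup>2) = 0"
      using s0 by (simp add: sum_distrib_left)
    then have "(\<Sum>i<d. 1 / (cmod (z - complex_of_real (r i)))\<^sup>2) = 0"
      using im by simp
    moreover have "(\<Sum>i<d. 1 / (cmod (z - complex_of_real (r i)))\<^sup>2) > 0"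
      using \<open>d \<noteq> 0\<close> ne by (intro sum_pos) auto
    ultimately show False
      by simp
  qed
qed

text \<open>A root of multiplicity m drops to m - 1. Where F does not vanish, put L = F' / F: a
  double root of F - c F' would give c L = 1 and then c \<Sum> 1 / (t - r i)^2 = 0, which is
  impossible. New roots are thus simple, whence the \<open>max 1\<close>.\<close>

lemma order_nuij:
  assumes c: "c \<noteq> 0" and ord: "\<And>t. order t (linear_prod d r) \<le> max 1 k" and eq: "nuij c (linear_prod d r) = linear_prod d r'"
  shows "order t (linear_prod d r') \<le> max 1 (k - 1)"
proof -
  let ?F = "linear_prod d r"
  have F0: "?F \<noteq> 0" and G0: "nuij c ?F \<noteq> 0"
    using lead_linear_prod[of d r] lead_linear_prod[of d r'] eq by auto
  show ?thesis
  proof (cases "poly ?F t = 0")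
    case True
    define m where "m = order t ?F"
    have m: "m > 0"
      using True F0 by (simp add: m_def order_gt_0_iff)
    obtain q where q: "?F = [:- t, 1:] ^ m * q" "\<not> [:- t, 1:] dvd q"
      using order_decomp[OF F0, of t] by (auto simp: m_def)
    then have qt: "poly q t \<noteq> 0"
      by (simp add: poly_eq_0_iff_dvd)
    obtain m' where m': "m = Suc m'"
      using m gr0_implies_Suc by blast
    define L where "L = [:- t, 1:]"
    define g where "g = L * q - smult c (smult (of_nat m) q + L * pderiv q)"
    have "pderiv L = 1"
      by (simp add: L_def pderiv_pCons)
    then have "pderiv (L ^ Suc m' * q) = L ^ m' * (smult (of_nat m) q + L * pderiv q)"
      unfolding pderiv_mult pderiv_power_Suc m' by (simp add: algebra_simps)
    then have "nuij c ?F = L ^ m' * g"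
      unfolding nuij_def q(1) L_def[symmetric] g_def
      by (simp add: m' right_diff_distrib mult_ac)
    moreover have "poly g t \<noteq> 0"
      using qt c m by (simp add: g_def L_def)
    ultimately have "order t (nuij c ?F) = m'"
      using G0 by (subst \<open>nuij c ?F = L ^ m' * g\<close>, subst order_mult)
        (auto simp: L_def order_power_n_n order_0I)
    moreover have "m' \<le> max 1 (k - 1)"
      using ord[of t] by (auto simp: m_def[symmetric] m')
    ultimately show ?thesis
      by (simp add: eq)
  next
    case False
    have ne: "t \<noteq> r i" if "i < d" for i
      using False that by (auto simp: linear_prod_def poly_prod)
    define L where "L = (\<Sum>i<d. 1 / (t - r i))"
    have D1: "poly (pderiv ?F) t = poly ?F t * L"
      unfolding L_def linear_prod_def by (rule log_derivative) (use ne in auto)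
    have D2: "poly (pderiv (pderiv ?F)) t = poly ?F t * (L\<^sup>2 - (\<Sum>i<d. 1 / (t - r i)\<^sup>2))"
      unfolding L_def by (rule log_derivative2) (use ne in auto)
    have "\<not> (poly (nuij c ?F) t = 0 \<and> poly (pderiv (nuij c ?F)) t = 0)"
    proof
      assume *: "poly (nuij c ?F) t = 0 \<and> poly (pderiv (nuij c ?F)) t = 0"
      then have "poly ?F t * (1 - c * L) = 0"
        by (simp add: nuij_def D1 algebra_simps)
      then have cL: "c * L = 1"
        using False by simp
      then have "d \<noteq> 0"
        by (auto simp: L_def intro: Nat.gr0I)
      have "poly ?F t * (L - c * (L\<^sup>2 - (\<Sum>i<d. 1 / (t - r i)\<^sup>2))) = 0"
        using * by (simp add: nuij_def pderiv_diff pderiv_smult D1 D2 algebra_simps)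
      then have "L - c * (L\<^sup>2 - (\<Sum>i<d. 1 / (t - r i)\<^sup>2)) = 0"
        using False by simp
      moreover have "c * L\<^sup>2 = L"
        using cL by (simp add: power2_eq_square mult.assoc[symmetric])
      ultimately have "c * (\<Sum>i<d. 1 / (t - r i)\<^sup>2) = 0"
        by (simp add: algebra_simps)
      moreover have "(\<Sum>i<d. 1 / (t - r i)\<^sup>2) > 0"
        using \<open>d \<noteq> 0\<close> ne by (intro sum_pos) auto
      ultimately show False
        using c by simp
    qed
    then have "order t (nuij c ?F) \<le> 1"
    proof (rule contrapos_np)
      assume "\<not> order t (nuij c ?F) \<le> 1"
      then have "[:- t, 1:] ^ 2 dvd nuij c ?F"
        by (intro order_divides[THEN iffD2]) auto
      then obtain k where "nuij c ?F = [:- t, 1:] ^ 2 * k"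
        by (elim dvdE)
      then show "poly (nuij c ?F) t = 0 \<and> poly (pderiv (nuij c ?F)) t = 0"
        by (simp add: power2_eq_square pderiv_mult pderiv_pCons del: mult_pCons_left mult_pCons_right)
    qed
    then show ?thesis
      by (simp add: eq)
  qed
qed

lemma nuij_iterate:
  assumes c: "c \<noteq> 0"
  shows "\<exists>r'. (nuij c ^^ n) (linear_prod d r) = linear_prod d r' \<and> (\<forall>t. order t (linear_prod d r') \<le> max 1 (d - n))"
proof (induction n)
  case 0
  have "order t (linear_prod d r) \<le> d" for t
    using order_degree[of "linear_prod d r" t] degree_linear_prod[of d r] lead_linear_prod[of d r] by fastforce
  then show ?case
    by (intro exI[of _ r]) (auto simp: le_max_iff_disj)
next
  case (Suc n)
  then obtain r1 where r1: "(nuij c ^^ n) (linear_prod d r) = linear_prod d r1" "\<And>t. order t (linear_prod d r1) \<le> max 1 (d - n)"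
    by blast
  obtain r2 where r2: "nuij c (linear_prod d r1) = linear_prod d r2"
    by (rule nuij_real_rooted[OF c])
  have "order t (linear_prod d r2) \<le> max 1 (d - Suc n)" for t
    using order_nuij[OF c r1(2) r2, of t] by simp
  moreover have "(nuij c ^^ Suc n) (linear_prod d r) = linear_prod d r2"
    by (simp add: r1 r2)
  ultimately show ?case
    by blast
qed

lemma nuij_separates:
  assumes c: "c \<noteq> 0"
  obtains r' where "(nuij c ^^ d) (linear_prod d r) = linear_prod d r'" "inj_on r' {..<d}"
proof -
  obtain r' where r': "(nuij c ^^ d) (linear_prod d r) = linear_prod d r'" "\<And>t. order t (linear_prod d r') \<le> max 1 (d - d)"
    using nuij_iterate[OF c] by blast
  have "inj_on r' {..<d}"
  proof (rule inj_onI, rule ccontr)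
    fix i j assume ij: "i \<in> {..<d}" "j \<in> {..<d}" "r' i = r' j" "i \<noteq> j"
    define L where "L = (\<lambda>i. [:- r' i, 1:])"
    have "linear_prod d r' = L i * (L j * (\<Prod>k\<in>{..<d} - {i} - {j}. L k))"
      unfolding linear_prod_def L_def[symmetric] using ij
      by (subst prod.remove[of _ i], simp, simp, subst prod.remove[of _ j]) auto
    also have "L j = L i"
      using ij by (simp add: L_def)
    also have "L i * (L i * (\<Prod>k\<in>{..<d} - {i} - {j}. L k)) = L i ^ 2 * (\<Prod>k\<in>{..<d} - {i} - {j}. L k)"
      by (simp only: power2_eq_square mult.assoc)
    finally have "[:- r' i, 1:] ^ 2 dvd linear_prod d r'"
      by (simp only: L_def dvd_triv_left)
    moreover have "linear_prod d r' \<noteq> 0"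
      using lead_linear_prod[of d r'] by auto
    ultimately have "2 \<le> order (r' i) (linear_prod d r')"
      by (simp only: order_divides) simp
    then show False
      using r'(2)[of "r' i"] by simp
  qed
  with r' show thesis
    by (intro that)
qed

lemma cpoly_linear_prod: "cpoly (linear_prod d r) = (\<Prod>i<d. [:- complex_of_real (r i), 1:])"
proof -
  interpret ch: map_poly_inj_idom_hom complex_of_real ..
  show ?thesis
    by (simp add: linear_prod_def ch.hom_prod)
qed

lemma linear_prod_no_double_root:
  assumes inj: "inj_on r {..<d}"
  shows "\<not> (poly (cpoly (linear_prod d r)) z = 0 \<and> poly (pderiv (cpoly (linear_prod d r))) z = 0)"
proof
  assume *: "poly (cpoly (linear_prod d r)) z = 0 \<and> poly (pderiv (cpoly (linear_prod d r))) z = 0"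
  then obtain i where i: "i < d" "z = complex_of_real (r i)"
    by (auto simp: cpoly_linear_prod poly_prod)
  define L where "L = (\<lambda>i. [:- complex_of_real (r i), 1:])"
  define Q where "Q = (\<Prod>k\<in>{..<d} - {i}. L k)"
  have "cpoly (linear_prod d r) = L i * Q"
    unfolding cpoly_linear_prod L_def[symmetric] Q_def using i by (intro prod.remove) auto
  moreover have "pderiv (L i) = 1" "poly (L i) z = 0"
    using i by (simp_all add: L_def pderiv_pCons)
  ultimately have "poly (pderiv (cpoly (linear_prod d r))) z = poly Q z"
    by (simp add: pderiv_mult)
  moreover have "poly Q z \<noteq> 0"
    using inj i by (auto simp: Q_def L_def poly_prod inj_on_def)
  ultimately show False
    using * by simp
qed

section \<open>Separation of roots, uniformly on bounded sets of polynomials\<close>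

lemma root_bound:
  fixes p :: "complex poly"
  assumes deg: "degree p \<le> d" and lead: "coeff p d = 1" and C: "\<And>i. i < d \<Longrightarrow> cmod (coeff p i) \<le> C"
    and root: "poly p z = 0" and C0: "C \<ge> 0"
  shows "cmod z \<le> 1 + real d * C"
proof (rule ccontr)
  assume "\<not> cmod z \<le> 1 + real d * C"
  then have big: "cmod z > 1 + real d * C" and z1: "cmod z > 1"
    using C0 by (auto simp: not_le intro: le_less_trans[rotated])
  have "poly p z = (\<Sum>i\<le>d. coeff p i * z ^ i)"
    unfolding poly_altdef using deg by (intro sum.mono_neutral_left) (auto simp: coeff_eq_0)
  also have "\<dots> = (\<Sum>i<d. coeff p i * z ^ i) + z ^ d"
    by (simp add: lessThan_Suc_atMost[symmetric] lead)
  finally have "z ^ d = - (\<Sum>i<d. coeff p i * z ^ i)"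
    using root by (simp add: eq_neg_iff_add_eq_0 add.commute)
  then have "cmod z ^ d = cmod (\<Sum>i<d. coeff p i * z ^ i)"
    by (metis norm_minus_cancel norm_power)
  also have "\<dots> \<le> (\<Sum>i<d. cmod (coeff p i * z ^ i))"
    by (rule norm_sum)
  also have "\<dots> \<le> (\<Sum>i<d. C * cmod z ^ (d - 1))"
    unfolding norm_mult norm_power using z1 C C0
    by (intro sum_mono mult_mono power_increasing) auto
  also have "\<dots> = (real d * C) * cmod z ^ (d - 1)"
    by simp
  finally have le: "cmod z ^ d \<le> (real d * C) * cmod z ^ (d - 1)" .
  show False
  proof (cases "d = 0")
    case True
    with le show False
      by simp
  next
    case False
    then have "cmod z ^ d = cmod z * cmod z ^ (d - 1)"
      by (simp add: power_eq_if)
    with le have "cmod z * cmod z ^ (d - 1) \<le> (real d * C) * cmod z ^ (d - 1)"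
      by simp
    then have "cmod z \<le> real d * C"
    proof (rule mult_right_le_imp_le)
      show "0 < cmod z ^ (d - 1)"
        using z1 by (intro zero_less_power) linarith
    qed
    with big show False
      by simp
  qed
qed

definition coeff_lim1 :: "(nat \<Rightarrow> real poly) \<Rightarrow> real poly \<Rightarrow> bool" where
  "coeff_lim1 g G \<longleftrightarrow> (\<forall>i. (\<lambda>n. coeff (g n) i) \<longlonglongrightarrow> coeff G i)"

lemma coeff_lim1_mult: "coeff_lim1 g G \<Longrightarrow> coeff_lim1 h H \<Longrightarrow> coeff_lim1 (\<lambda>n. g n * h n) (G * H)"
  by (auto simp: coeff_lim1_def coeff_mult intro!: tendsto_intros)

lemma coeff_lim1_linear_prod:
  assumes "\<And>i. i < d \<Longrightarrow> (\<lambda>n. r n i) \<longlonglongrightarrow> \<rho> i"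
  shows "coeff_lim1 (\<lambda>n. linear_prod d (r n)) (linear_prod d \<rho>)"
  using assms
proof (induction d)
  case 0
  then show ?case
    by (simp add: linear_prod_def coeff_lim1_def)
next
  case (Suc d)
  have "coeff_lim1 (\<lambda>n. [:- r n d, 1:]) [:- \<rho> d, 1:]"
    unfolding coeff_lim1_def
  proof
    fix i
    show "(\<lambda>n. coeff [:- r n d, 1:] i) \<longlonglongrightarrow> coeff [:- \<rho> d, 1:] i"
      using Suc.prems[of d] by (cases i) (auto intro!: tendsto_intros)
  qed
  with Suc show ?case
    unfolding linear_prod_def prod.lessThan_Suc by (intro coeff_lim1_mult) auto
qed

lemma coeff_lim1_nuij: "coeff_lim1 g G \<Longrightarrow> coeff_lim1 (\<lambda>n. nuij c (g n)) (nuij c G)"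
  by (auto simp: coeff_lim1_def nuij_def coeff_pderiv intro!: tendsto_intros)

lemma coeff_lim1_nuij_iterate: "coeff_lim1 g G \<Longrightarrow> coeff_lim1 (\<lambda>n. (nuij c ^^ m) (g n)) ((nuij c ^^ m) G)"
  by (induction m) (auto intro: coeff_lim1_nuij)

lemma coeff_lim1_poly:
  assumes "coeff_lim1 g G" "\<And>n. degree (g n) \<le> d" "degree G \<le> d" "w \<longlonglongrightarrow> z"
  shows "(\<lambda>n. poly (cpoly (g n)) (w n)) \<longlonglongrightarrow> poly (cpoly G) z"
proof -
  have e: "poly (cpoly p) u = (\<Sum>i\<le>d. complex_of_real (coeff p i) * u ^ i)" if "degree p \<le> d" for p u
    unfolding poly_altdef using that by (simp, intro sum.mono_neutral_left) (auto simp: coeff_eq_0)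
  show ?thesis
    unfolding e[OF assms(2)] e[OF assms(3)]
    using assms(1,4) by (intro tendsto_intros) (auto simp: coeff_lim1_def)
qed

lemma cpoly_pderiv: "pderiv (cpoly p) = cpoly (pderiv p)"
  by (rule poly_eqI) (simp add: coeff_pderiv)

text \<open>Compactness. Counterexamples with tolerance 1 / (n + 1) subconverge to
  \<open>nuij\<close> iterated on a real rooted polynomial, which has simple roots, while their
  double roots accumulate at a double root of it. The tolerance depends on \<open>c\<close>,
  \<open>C\<close> and \<open>d\<close> alone, which later gives one choice for all real x.\<close>

lemma uniform_no_double_root:
  assumes c: "c \<noteq> 0" and C0: "C \<ge> 0"
  shows "\<exists>e>0. \<forall>r P z. (\<forall>i<d. \<bar>coeff (linear_prod d r) i\<bar> \<le> C) \<longrightarrow> degree P \<le> d \<longrightarrow> coeff P d = 1 \<longrightarrow>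
    (\<forall>i<d. \<bar>coeff P i - coeff ((nuij c ^^ d) (linear_prod d r)) i\<bar> < e) \<longrightarrow>
    \<not> (poly (cpoly P) z = 0 \<and> poly (pderiv (cpoly P)) z = 0)"
proof (rule ccontr)
  assume neg: "\<not> ?thesis"
  have "\<exists>r P z. (\<forall>i<d. \<bar>coeff (linear_prod d r) i\<bar> \<le> C) \<and> degree P \<le> d \<and> coeff P d = 1 \<and>
    (\<forall>i<d. \<bar>coeff P i - coeff ((nuij c ^^ d) (linear_prod d r)) i\<bar> < 1 / (real n + 1)) \<and>
    poly (cpoly P) z = 0 \<and> poly (pderiv (cpoly P)) z = 0" for n
  proof -
    have "1 / (real n + 1) > 0"
      by simp
    with neg show ?thesis
      by blast
  qed
  then obtain r P z where r: "\<And>n i. i < d \<Longrightarrow> \<bar>coeff (linear_prod d (r n)) i\<bar> \<le> C"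
    and P: "\<And>n. degree (P n) \<le> d" "\<And>n. coeff (P n) d = 1"
    and close: "\<And>n i. i < d \<Longrightarrow> \<bar>coeff (P n) i - coeff ((nuij c ^^ d) (linear_prod d (r n))) i\<bar> < 1 / (real n + 1)"
    and z: "\<And>n. poly (cpoly (P n)) (z n) = 0" "\<And>n. poly (pderiv (cpoly (P n))) (z n) = 0"
    by metis
  \<comment> \<open>Bounded coefficients bound the roots, so the roots themselves subconverge and
    the limit is again a product of real linear factors.\<close>
  have rb: "\<bar>r n i\<bar> \<le> 1 + real d * C" if "i < d" for n i
  proof -
    have "poly (cpoly (linear_prod d (r n))) (complex_of_real (r n i)) = 0"
      using that by (auto simp: cpoly_linear_prod poly_prod)
    then have "cmod (complex_of_real (r n i)) \<le> 1 + real d * C"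
      using r C0 by (intro root_bound[of "cpoly (linear_prod d (r n))"]) (auto simp: degree_linear_prod lead_linear_prod)
    then show ?thesis
      by simp
  qed
  obtain s \<rho> where s: "strict_mono (s :: nat \<Rightarrow> nat)" and \<rho>: "\<And>i. i < d \<Longrightarrow> (\<lambda>n. r (s n) i) \<longlonglongrightarrow> \<rho> i"
  proof -
    have "\<exists>s. strict_mono (s :: nat \<Rightarrow> nat) \<and> (\<forall>i\<in>{..<d}. convergent (\<lambda>n. r (s n) i))"
      by (rule convergent_subseq_family) (use rb in auto)
    then obtain s where s: "strict_mono (s :: nat \<Rightarrow> nat)" "\<And>i. i < d \<Longrightarrow> convergent (\<lambda>n. r (s n) i)"
      by auto
    show thesis
      by (rule that[OF s(1), of "\<lambda>i. lim (\<lambda>n. r (s n) i)"]) (use s(2) in \<open>simp add: convergent_LIMSEQ_iff\<close>)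
  qed
  define G where "G = (nuij c ^^ d) (linear_prod d \<rho>)"
  obtain \<rho>' where \<rho>': "G = linear_prod d \<rho>'" "inj_on \<rho>' {..<d}"
    unfolding G_def by (rule nuij_separates[OF c])
  have cuQ: "coeff_lim1 (\<lambda>n. (nuij c ^^ d) (linear_prod d (r (s n)))) G"
    unfolding G_def by (intro coeff_lim1_nuij_iterate coeff_lim1_linear_prod \<rho>)
  have cuP: "coeff_lim1 (\<lambda>n. P (s n)) G"
    unfolding coeff_lim1_def
  proof
    fix i
    consider "i < d" | "i = d" | "i > d"
      by linarith
    then show "(\<lambda>n. coeff (P (s n)) i) \<longlonglongrightarrow> coeff G i"
    proof cases
      case 1
      have "(\<lambda>n. coeff (P (s n)) i - coeff ((nuij c ^^ d) (linear_prod d (r (s n)))) i) \<longlonglongrightarrow> 0"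
      proof (rule Lim_null_comparison)
        show "\<forall>\<^sub>F n in sequentially. norm (coeff (P (s n)) i - coeff ((nuij c ^^ d) (linear_prod d (r (s n)))) i) \<le> 1 / (real (s n) + 1)"
          using close[OF 1] by (auto intro!: always_eventually less_imp_le)
        have "(\<lambda>n. 1 / (real n + 1)) \<longlonglongrightarrow> 0"
          using LIMSEQ_inverse_real_of_nat by (simp add: inverse_eq_divide add.commute)
        from LIMSEQ_subseq_LIMSEQ[OF this s] show "(\<lambda>n. 1 / (real (s n) + 1)) \<longlonglongrightarrow> 0"
          by (simp add: o_def)
      qed
      from tendsto_add[OF this cuQ[unfolded coeff_lim1_def, rule_format, of i]] show ?thesis
        by simp
    next
      case 2
      then show ?thesis
        by (simp add: P \<rho>' lead_linear_prod)
    next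
      case 3
      then have "coeff (P (s n)) i = 0" for n
        using P(1)[of "s n"] by (intro coeff_eq_0) simp
      moreover have "coeff G i = 0"
        using 3 by (simp add: \<rho>' coeff_eq_0 degree_linear_prod)
      ultimately show ?thesis
        by simp
    qed
  qed
  have "\<exists>B. \<forall>n. \<forall>i<d. \<bar>coeff (P (s n)) i\<bar> \<le> B"
  proof -
    have "\<exists>B. \<forall>n. \<bar>coeff (P (s n)) i\<bar> \<le> B" for i
    proof -
      have "Bseq (\<lambda>n. coeff (P (s n)) i)"
        using cuP by (intro convergent_imp_Bseq) (auto simp: coeff_lim1_def convergent_def)
      then show ?thesis
        by (auto simp: Bseq_def)
    qed
    then obtain B where B: "\<And>i n. \<bar>coeff (P (s n)) i\<bar> \<le> B i"
      by metis
    have "\<bar>coeff (P (s n)) i\<bar> \<le> (\<Sum>i<d. B i)" if "i < d" for n i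
    proof -
      have "B i \<le> (\<Sum>i<d. B i)"
        using that B by (intro member_le_sum) (auto intro: order_trans[OF abs_ge_zero])
      with B[of n i] show ?thesis
        by simp
    qed
    then show ?thesis
      by blast
  qed
  then obtain B where B: "\<And>n i. i < d \<Longrightarrow> \<bar>coeff (P (s n)) i\<bar> \<le> B"
    by blast
  have "cmod (z (s n)) \<le> 1 + real d * max 0 B" for n
    using P z B by (intro root_bound[of "cpoly (P (s n))"]) (auto intro: order_trans[OF B])
  then have "bounded (range (\<lambda>n. z (s n)))"
    by (intro boundedI) auto
  then obtain w t where t: "strict_mono (t :: nat \<Rightarrow> nat)" "((\<lambda>n. z (s n)) \<circ> t) \<longlonglongrightarrow> w"
    using bounded_imp_convergent_subsequence by blast
  have zt: "(\<lambda>n. z (s (t n))) \<longlonglongrightarrow> w"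
    using t(2) by (simp add: o_def)
  have cuPt: "coeff_lim1 (\<lambda>n. P (s (t n))) G"
    using cuP LIMSEQ_subseq_LIMSEQ[OF _ t(1)] unfolding coeff_lim1_def o_def by blast
  have dG: "degree G \<le> d"
    by (simp add: \<rho>' degree_linear_prod)
  have "(\<lambda>n. poly (cpoly (P (s (t n)))) (z (s (t n)))) \<longlonglongrightarrow> poly (cpoly G) w"
    by (rule coeff_lim1_poly[OF cuPt P(1) dG zt])
  then have 1: "poly (cpoly G) w = 0"
    by (simp add: z LIMSEQ_const_iff)
  have "(\<lambda>n. poly (cpoly (pderiv (P (s (t n))))) (z (s (t n)))) \<longlonglongrightarrow> poly (cpoly (pderiv G)) w"
  proof (rule coeff_lim1_poly[OF _ _ _ zt])
    show "coeff_lim1 (\<lambda>n. pderiv (P (s (t n)))) (pderiv G)"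
      using cuPt by (auto simp: coeff_lim1_def coeff_pderiv intro!: tendsto_intros)
    show "degree (pderiv (P (s (t n)))) \<le> d" for n
      using P(1)[of "s (t n)"] by (simp add: degree_pderiv)
    show "degree (pderiv G) \<le> d"
      using dG by (simp add: degree_pderiv)
  qed
  then have 2: "poly (pderiv (cpoly G)) w = 0"
    unfolding cpoly_pderiv[symmetric] by (simp add: z LIMSEQ_const_iff)
  show False
    using linear_prod_no_double_root[OF \<rho>'(2), of w] 1 2 by (simp add: \<rho>'(1))
qed

subsection \<open>Removing non-real singular points by a small perturbation\<close>

definition ccpoly :: "real poly poly \<Rightarrow> complex poly poly" where
  "ccpoly f = map_poly cpoly f"

lemma coeff_ccpoly: "coeff (ccpoly f) i = cpoly (coeff f i)"
  by (simp add: ccpoly_def coeff_map_poly)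

lemma degree_ccpoly: "degree (ccpoly f) = degree f"
proof -
  interpret ch: map_poly_inj_idom_hom complex_of_real ..
  show ?thesis
    by (simp add: ccpoly_def degree_map_poly)
qed

lemma ccpoly_add: "ccpoly (f + g) = ccpoly f + ccpoly g"
  by (intro poly_eqI) (simp add: coeff_ccpoly of_real_hom.map_poly_hom_add)

definition ev0 :: "real poly poly \<Rightarrow> complex \<Rightarrow> complex \<Rightarrow> complex" where
  "ev0 f x t = poly (poly (ccpoly f) [:t:]) x"
definition evT :: "real poly poly \<Rightarrow> complex \<Rightarrow> complex \<Rightarrow> complex" where
  "evT f x t = poly (poly (pderiv (ccpoly f)) [:t:]) x"
definition evX :: "real poly poly \<Rightarrow> complex \<Rightarrow> complex \<Rightarrow> complex" where
  "evX f x t = poly (pderiv (poly (ccpoly f) [:t:])) x"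

lemma singular_ev: "singular (ccpoly f) x t \<longleftrightarrow> ev0 f x t = 0 \<and> evT f x t = 0 \<and> evX f x t = 0"
  by (simp add: singular_def ev0_def evT_def evX_def)

lemma ev_add:
  "ev0 (f + g) x t = ev0 f x t + ev0 g x t"
  "evT (f + g) x t = evT f x t + evT g x t"
  "evX (f + g) x t = evX f x t + evX g x t"
  by (simp_all add: ev0_def evT_def evX_def ccpoly_add pderiv_add)

lemma poly_eq_sum_le:
  fixes p :: "'a::comm_ring_1 poly"
  assumes "degree p \<le> n"
  shows "poly p x = (\<Sum>i\<le>n. coeff p i * x ^ i)"
  unfolding poly_altdef using assms by (intro sum.mono_neutral_left) (auto simp: coeff_eq_0)

lemma poly_cpoly_sum:
  assumes "degree a \<le> D"
  shows "poly (cpoly a) x = (\<Sum>j\<le>D. complex_of_real (coeff a j) * x ^ j)"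
  using poly_eq_sum_le[of "cpoly a" D x] assms by simp

text \<open>With one fixed index range, joint differentiability in (s, x, t) follows from that of
  the coefficients. In the two derivatives the last terms of the range have zero
  coefficients.\<close>

lemma ev_sums:
  assumes d: "degree f \<le> d" and D: "\<And>i. degree (coeff f i) \<le> D"
  shows "ev0 f x t = (\<Sum>i\<le>d. \<Sum>j\<le>D. complex_of_real (coeff (coeff f i) j) * x ^ j * t ^ i)"
    and "evT f x t = (\<Sum>i\<le>d. \<Sum>j\<le>D. complex_of_real (real (Suc i) * coeff (coeff f (Suc i)) j) * x ^ j * t ^ i)"
    and "evX f x t = (\<Sum>i\<le>d. \<Sum>j\<le>D. complex_of_real (real (Suc j) * coeff (coeff f i) (Suc j)) * x ^ j * t ^ i)"
proof -
  have F: "poly (ccpoly f) [:t:] = (\<Sum>i\<le>d. cpoly (coeff f i) * [:t:] ^ i)"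
    by (subst poly_eq_sum_le[of _ d]) (use d in \<open>auto simp: degree_ccpoly coeff_ccpoly\<close>)
  show "ev0 f x t = (\<Sum>i\<le>d. \<Sum>j\<le>D. complex_of_real (coeff (coeff f i) j) * x ^ j * t ^ i)"
    unfolding ev0_def F by (simp add: poly_sum poly_cpoly_sum[OF D] sum_distrib_right)
  have "poly (pderiv (ccpoly f)) [:t:] = (\<Sum>i\<le>d. coeff (pderiv (ccpoly f)) i * [:t:] ^ i)"
    by (rule poly_eq_sum_le) (use d in \<open>simp add: degree_pderiv degree_ccpoly\<close>)
  also have "\<dots> = (\<Sum>i\<le>d. smult (of_nat (Suc i)) (cpoly (coeff f (Suc i))) * [:t:] ^ i)"
    by (intro sum.cong refl) (simp add: coeff_pderiv coeff_ccpoly of_nat_poly)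
  finally show "evT f x t = (\<Sum>i\<le>d. \<Sum>j\<le>D. complex_of_real (real (Suc i) * coeff (coeff f (Suc i)) j) * x ^ j * t ^ i)"
    unfolding evT_def by (simp add: poly_sum poly_cpoly_sum[OF D] sum_distrib_right sum_distrib_left mult_ac)
  have c: "pderiv ([:t:] ^ i) = 0" for i
    by (simp add: poly_const_pow pderiv_pCons)
  have "evX f x t = (\<Sum>i\<le>d. poly (cpoly (pderiv (coeff f i))) x * t ^ i)"
    unfolding evX_def F higher_pderiv_sum[of 1, simplified]
    by (simp add: poly_sum pderiv_mult c cpoly_pderiv mult.commute)
  also have "\<dots> = (\<Sum>i\<le>d. (\<Sum>j\<le>D. complex_of_real (coeff (pderiv (coeff f i)) j) * x ^ j) * t ^ i)"
  proof -
    have dp: "degree (pderiv (coeff f i)) \<le> D" for i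
      using D[of i] by (simp add: degree_pderiv)
    show ?thesis
      by (subst poly_cpoly_sum[OF dp]) (rule refl)
  qed
  finally show "evX f x t = (\<Sum>i\<le>d. \<Sum>j\<le>D. complex_of_real (real (Suc j) * coeff (coeff f i) (Suc j)) * x ^ j * t ^ i)"
    by (simp add: coeff_pderiv sum_distrib_right)
qed

text \<open>Six real coefficients packed into three complex numbers, so that the parameters form a
  euclidean space of dimension 6, to be compared with the dimension 5 of the triples (s, x,
  t).\<close>

definition perturb :: "complex \<times> complex \<times> complex \<Rightarrow> real poly poly" where
  "perturb p = [:[:Re (fst p), Im (fst p), Re (fst (snd p)), Im (fst (snd p)):], [:Re (snd (snd p)), Im (snd (snd p)):]:]"

lemma ev_perturb:
  fixes x t :: complex
  assumes p: "p = (Complex a0 a1, Complex a2 a3, Complex b0 b1)"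
  shows "ev0 (perturb p) x t = complex_of_real a0 + complex_of_real a1 * x + complex_of_real a2 * x\<^sup>2 + complex_of_real a3 * x ^ 3 + (complex_of_real b0 + complex_of_real b1 * x) * t"
    "evT (perturb p) x t = complex_of_real b0 + complex_of_real b1 * x"
    "evX (perturb p) x t = complex_of_real a1 + 2 * complex_of_real a2 * x + 3 * complex_of_real a3 * x\<^sup>2 + complex_of_real b1 * t"
proof -
  have cc: "ccpoly (perturb p) = [:[:of_real a0, of_real a1, of_real a2, of_real a3:], [:of_real b0, of_real b1:]:]"
    by (intro poly_eqI) (simp add: coeff_ccpoly perturb_def p coeff_pCons coeff_map_poly split: nat.splits)
  show "ev0 (perturb p) x t = complex_of_real a0 + complex_of_real a1 * x + complex_of_real a2 * x\<^sup>2 + complex_of_real a3 * x ^ 3 + (complex_of_real b0 + complex_of_real b1 * x) * t"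
    "evT (perturb p) x t = complex_of_real b0 + complex_of_real b1 * x"
    "evX (perturb p) x t = complex_of_real a1 + 2 * complex_of_real a2 * x + 3 * complex_of_real a3 * x\<^sup>2 + complex_of_real b1 * t"
    unfolding ev0_def evT_def evX_def cc
    by (simp_all add: pderiv_pCons pderiv_mult pderiv_smult algebra_simps power2_eq_square power3_eq_cube)
qed

text \<open>The six real parameters of \<open>perturb p\<close> are determined by the 1-jet
  \<open>(V, VT, VX)\<close> that it has to cancel at a point \<open>(x, t)\<close> with \<open>Im x \<noteq> 0\<close>.\<close>

definition solve_jet :: "complex \<Rightarrow> complex \<Rightarrow> complex \<Rightarrow> complex \<Rightarrow> complex \<Rightarrow> complex \<times> complex \<times> complex" where
  "solve_jet x t V VT VX =
    (let u = Re x; v = Im x;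
         b1 = - Im VT / v; b0 = - Re VT - b1 * u;
         \<alpha> = - V + VT * t; \<beta> = - VX - of_real b1 * t;
         c3 = (Im \<alpha> / v - Re \<beta>) / (2 * v\<^sup>2); c2 = Im \<beta> / (2 * v);
         c1 = Im \<alpha> / v + c3 * v\<^sup>2; c0 = Re \<alpha> + c2 * v\<^sup>2
     in (Complex (c0 - u * c1 + u\<^sup>2 * c2 - u ^ 3 * c3) (c1 - 2 * u * c2 + 3 * u\<^sup>2 * c3),
         Complex (c2 - 3 * u * c3) c3, Complex b0 b1))"

text \<open>The imaginary part of \<open>VT\<close> yields \<open>b1\<close>, its real part then
  \<open>b0\<close>. What remains are the values \<alpha> = a(x) and \<beta> = a'(x), four real
  equations for the cubic a.\<close>

lemma solve_jet:
  assumes v: "Im x \<noteq> 0"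
    and eq: "V + ev0 (perturb p) x t = 0" "VT + evT (perturb p) x t = 0" "VX + evX (perturb p) x t = 0"
  shows "p = solve_jet x t V VT VX"
proof -
  obtain a0 a1 a2 a3 b0 b1 where p: "p = (Complex a0 a1, Complex a2 a3, Complex b0 b1)"
    by (metis complex.exhaust prod.exhaust)
  define u where "u = Re x"
  define w where "w = Im x"
  have w0: "w \<noteq> 0"
    using v by (simp add: w_def)
  have x: "x = Complex u w"
    by (simp add: u_def w_def)
  have VT: "VT = - (of_real b0 + of_real b1 * x)"
    using eq(2)[unfolded ev_perturb(2)[OF p, of x t]] by (simp only: eq_neg_iff_add_eq_0)
  \<comment> \<open>Taylor coefficients of a at u = Re x. There x - u is purely imaginary, so real
    and imaginary parts separate even from odd powers.\<close>
  define c3 where "c3 = a3"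
  define c2 where "c2 = a2 + 3 * u * a3"
  define c1 where "c1 = a1 + 2 * u * a2 + 3 * u\<^sup>2 * a3"
  define c0 where "c0 = a0 + u * a1 + u\<^sup>2 * a2 + u ^ 3 * a3"
  have a: "a3 = c3" "a2 = c2 - 3 * u * c3" "a1 = c1 - 2 * u * c2 + 3 * u\<^sup>2 * c3"
    "a0 = c0 - u * c1 + u\<^sup>2 * c2 - u ^ 3 * c3"
    by (simp_all add: c0_def c1_def c2_def c3_def algebra_simps power2_eq_square power3_eq_cube)
  have b1: "- Im VT / w = b1"
    using w0 by (simp add: VT x)
  have b0: "- Re VT - b1 * u = b0"
    by (simp add: VT x)
  define \<alpha> where "\<alpha> = - V + VT * t"
  define \<beta> where "\<beta> = - VX - of_real b1 * t"
  have V: "V = - (complex_of_real a0 + complex_of_real a1 * x + complex_of_real a2 * x\<^sup>2 + complex_of_real a3 * x ^ 3 + (complex_of_real b0 + complex_of_real b1 * x) * t)"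
    using eq(1)[unfolded ev_perturb[OF p]] by (simp only: eq_neg_iff_add_eq_0)
  have VX: "VX = - (complex_of_real a1 + 2 * complex_of_real a2 * x + 3 * complex_of_real a3 * x\<^sup>2 + complex_of_real b1 * t)"
    using eq(3)[unfolded ev_perturb[OF p]] by (simp only: eq_neg_iff_add_eq_0)
  have al: "\<alpha> = complex_of_real a0 + complex_of_real a1 * x + complex_of_real a2 * x\<^sup>2 + complex_of_real a3 * x ^ 3"
    unfolding \<alpha>_def V VT by (simp add: algebra_simps)
  have be: "\<beta> = complex_of_real a1 + 2 * complex_of_real a2 * x + 3 * complex_of_real a3 * x\<^sup>2"
    unfolding \<beta>_def VX by (simp add: algebra_simps)
  have e: "Re \<alpha> = c0 - c2 * w\<^sup>2" "Im \<alpha> = w * (c1 - c3 * w\<^sup>2)"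
    unfolding al x c0_def c1_def c2_def c3_def
    by (simp_all add: algebra_simps power2_eq_square power3_eq_cube)
  have e': "Re \<beta> = c1 - 3 * c3 * w\<^sup>2" "Im \<beta> = 2 * c2 * w"
    unfolding be x c1_def c2_def c3_def
    by (simp_all add: algebra_simps power2_eq_square)
  have k: "(Im \<alpha> / w - Re \<beta>) / (2 * w\<^sup>2) = c3" "Im \<beta> / (2 * w) = c2"
    "Im \<alpha> / w + c3 * w\<^sup>2 = c1" "Re \<alpha> + c2 * w\<^sup>2 = c0"
    using w0 by (simp_all add: e e' field_simps)
  show ?thesis
    unfolding solve_jet_def Let_def u_def[symmetric] w_def[symmetric] b1 b0 \<alpha>_def[symmetric] \<beta>_def[symmetric] k p a ..
qed

lemma differentiable_Re': "g differentiable (at q) \<Longrightarrow> (\<lambda>q. Re (g q)) differentiable (at q)"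
  by (rule differentiable_compose[of Re]) (auto intro: bounded_linear_imp_differentiable bounded_linear_Re)

lemma differentiable_Im': "g differentiable (at q) \<Longrightarrow> (\<lambda>q. Im (g q)) differentiable (at q)"
  by (rule differentiable_compose[of Im]) (auto intro: bounded_linear_imp_differentiable bounded_linear_Im)

lemma differentiable_of_real': "g differentiable (at q) \<Longrightarrow> (\<lambda>q. complex_of_real (g q)) differentiable (at q)"
  by (rule differentiable_compose[of complex_of_real]) (auto intro: bounded_linear_imp_differentiable bounded_linear_of_real)

lemma differentiable_Complex':
  assumes "g differentiable (at q)" "h differentiable (at q)"
  shows "(\<lambda>q. Complex (g q) (h q)) differentiable (at q)"
  unfolding Complex_eq by (intro derivative_intros differentiable_of_real' assms)

lemma differentiable_solve_jet:
  fixes x t V VT VX :: "'a::real_normed_vector \<Rightarrow> complex"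
  assumes "x differentiable (at q)" "t differentiable (at q)" "V differentiable (at q)"
    "VT differentiable (at q)" "VX differentiable (at q)" "Im (x q) \<noteq> 0"
  shows "(\<lambda>q. solve_jet (x q) (t q) (V q) (VT q) (VX q)) differentiable (at q)"
  unfolding solve_jet_def Let_def
  by (intro differentiable_Pair differentiable_Complex' differentiable_add differentiable_diff differentiable_minus
      differentiable_mult differentiable_divide differentiable_power differentiable_const
      differentiable_Re' differentiable_Im' differentiable_of_real' assms) (use assms(6) in auto)

lemma differentiable_triple:
  fixes q :: "real \<times> complex \<times> complex"
  shows "(\<lambda>q. fst q) differentiable (at q)" "(\<lambda>q. fst (snd q)) differentiable (at q)"
    "(\<lambda>q. snd (snd q)) differentiable (at q)"
  by (auto intro!: bounded_linear_imp_differentiable bounded_linear_fst bounded_linear_snd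
      bounded_linear_compose[OF bounded_linear_fst bounded_linear_snd]
      bounded_linear_compose[OF bounded_linear_snd bounded_linear_snd])

text \<open>A failing parameter is \<open>solve_jet\<close> of the jet of \<open>f s\<close> at some
  (s, x, t) with x non-real. The failing ones thus form the image of a subset of a 5-dimensional
  space under a differentiable map into dimension 6, which is negligible, whereas a ball is
  not.\<close>

theorem generic_perturbation:
  fixes f :: "real \<Rightarrow> real poly poly"
  assumes diff: "\<And>i j s. (\<lambda>s. coeff (coeff (f s) i) j) differentiable (at s)"
    and d: "\<And>s. degree (f s) \<le> d" and D: "\<And>s i. degree (coeff (f s) i) \<le> D" and e: "e > 0"
  obtains p where "norm p < e" "\<And>s x t. Im x \<noteq> 0 \<Longrightarrow> \<not> singular (ccpoly (f s + perturb p)) x t"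
proof -
  define S where "S = {q :: real \<times> complex \<times> complex. Im (fst (snd q)) \<noteq> 0}"
  define \<Phi> where "\<Phi> = (\<lambda>q :: real \<times> complex \<times> complex. solve_jet (fst (snd q)) (snd (snd q))
     (ev0 (f (fst q)) (fst (snd q)) (snd (snd q))) (evT (f (fst q)) (fst (snd q)) (snd (snd q)))
     (evX (f (fst q)) (fst (snd q)) (snd (snd q))))"
  have dsum: "(\<lambda>q :: real \<times> complex \<times> complex. \<Sum>i\<le>d. \<Sum>j\<le>D. complex_of_real (h i j (fst q)) * fst (snd q) ^ j * snd (snd q) ^ i)
      differentiable (at q)" if h: "\<And>i j s. h i j differentiable (at s)" for h :: "nat \<Rightarrow> nat \<Rightarrow> real \<Rightarrow> real" and q
  proof -
    have "(\<lambda>q :: real \<times> complex \<times> complex. h i j (fst q)) differentiable (at q)" for i j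
      by (rule differentiable_compose[of "h i j" fst]) (use h differentiable_triple in auto)
    then show ?thesis
      by (intro differentiable_sum ballI finite_atMost differentiable_mult differentiable_power differentiable_of_real' differentiable_triple)
  qed
  have "\<Phi> differentiable_on S"
  proof (rule differentiable_at_imp_differentiable_on)
    fix q assume "q \<in> S"
    then show "\<Phi> differentiable (at q)"
      unfolding \<Phi>_def ev_sums[OF d D]
      by (intro differentiable_solve_jet differentiable_triple dsum differentiable_mult differentiable_const diff)
         (auto simp: S_def)
  qed
  then have neg: "negligible (\<Phi> ` S)"
    by (intro negligible_differentiable_image_lowdim) simp
  have "\<not> ball 0 e \<subseteq> \<Phi> ` S"
  proof
    assume "ball 0 e \<subseteq> \<Phi> ` S"
    with neg have "negligible (ball (0 :: complex \<times> complex \<times> complex) e)"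
      by (rule negligible_subset)
    moreover have "ball (0 :: complex \<times> complex \<times> complex) e \<noteq> {}"
      using e by simp
    ultimately show False
      using open_not_negligible[OF open_ball] by blast
  qed
  then obtain p where "p \<in> ball 0 e" and "p \<notin> \<Phi> ` S"
    by blast
  then have p: "norm p < e" "p \<notin> \<Phi> ` S"
    by simp_all
  show thesis
  proof (rule that[OF p(1)])
    fix s x t assume x: "Im x \<noteq> 0"
    show "\<not> singular (ccpoly (f s + perturb p)) x t"
    proof
      assume "singular (ccpoly (f s + perturb p)) x t"
      then have "p = solve_jet x t (ev0 (f s) x t) (evT (f s) x t) (evX (f s) x t)"
        unfolding singular_ev ev_add using x by (intro solve_jet) auto
      then have "p = \<Phi> (s, x, t)"
        by (simp add: \<Phi>_def)
      moreover have "(s, x, t) \<in> S"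
        using x by (simp add: S_def)
      ultimately show False
        using p(2) by blast
    qed
  qed
qed

subsection \<open>Local surjectivity of the characteristic polynomial map\<close>

definition diag_top :: "nat \<Rightarrow> nat \<Rightarrow> (nat \<Rightarrow> real) \<Rightarrow> (nat \<Rightarrow> nat \<Rightarrow> real poly) \<Rightarrow> bool" where
  "diag_top K d r A \<longleftrightarrow> (\<forall>i<d. \<forall>j<d. A i j = A j i) \<and> (\<forall>i<d. \<forall>j<d. top_coeff K (A i j) (if i = j then r i else 0))"

lemma char_pol_diag_linear_prod: "char_pol d (\<lambda>i j. if i = j then r i else 0) = linear_prod d r"
  by (simp add: char_pol_diag linear_prod_def)

lemma top_form_diag_top: "diag_top K d r A \<Longrightarrow> top_form K d (char_pol d A) (linear_prod d r)"
  unfolding char_pol_diag_linear_prod[symmetric] by (rule top_form_char_pol) (simp add: diag_top_def)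

definition polyfun_coeffs :: "nat \<Rightarrow> ((nat \<Rightarrow> real) \<Rightarrow> real poly poly) \<Rightarrow> bool" where
  "polyfun_coeffs n g \<longleftrightarrow> (\<forall>i j. polyfun n (\<lambda>c. coeff (coeff (g c) i) j))"

lemma polyfun_coeffs_const: "polyfun_coeffs n (\<lambda>c. G)"
  by (simp add: polyfun_coeffs_def polyfun_const)

lemma polyfun_coeffs_add: "polyfun_coeffs n g \<Longrightarrow> polyfun_coeffs n h \<Longrightarrow> polyfun_coeffs n (\<lambda>c. g c + h c)"
  by (simp add: polyfun_coeffs_def polyfun_add)

lemma polyfun_coeffs_mult: "polyfun_coeffs n g \<Longrightarrow> polyfun_coeffs n h \<Longrightarrow> polyfun_coeffs n (\<lambda>c. g c * h c)"
  by (auto simp: polyfun_coeffs_def coeff_mult coeff_sum intro!: polyfun_sum polyfun_mult)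

lemma polyfun_coeffs_sum: "(\<And>x. x \<in> A \<Longrightarrow> polyfun_coeffs n (\<lambda>c. g c x)) \<Longrightarrow> polyfun_coeffs n (\<lambda>c. sum (g c) A)"
  by (induction A rule: infinite_finite_induct) (auto intro: polyfun_coeffs_const polyfun_coeffs_add)

lemma polyfun_coeffs_prod: "(\<And>x. x \<in> A \<Longrightarrow> polyfun_coeffs n (\<lambda>c. g c x)) \<Longrightarrow> polyfun_coeffs n (\<lambda>c. prod (g c) A)"
  by (induction A rule: infinite_finite_induct) (auto intro: polyfun_coeffs_const polyfun_coeffs_mult)

lemma polyfun_coeffs_char_pol:
  assumes "\<And>i j e. i < d \<Longrightarrow> j < d \<Longrightarrow> polyfun n (\<lambda>c. coeff (A c i j) e)"
  shows "polyfun_coeffs n (\<lambda>c. char_pol d (A c))"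
proof -
  have entry: "polyfun_coeffs n (\<lambda>c. E - [:A c i j:])" if "i < d" "j < d" for i j and E :: "real poly poly"
  proof -
    have "polyfun n (\<lambda>c. coeff (coeff E a) e + (- 1) * (if a = 0 then coeff (A c i j) e else 0))" for a e
    proof (cases "a = 0")
      case True
      show ?thesis
        unfolding if_P[OF True] by (intro polyfun_add polyfun_mult polyfun_const assms that)
    next
      case False
      show ?thesis
        unfolding if_not_P[OF False] by (rule polyfun_const)
    qed
    moreover have "coeff (coeff (E - [:A c i j:]) a) e = coeff (coeff E a) e + (- 1) * (if a = 0 then coeff (A c i j) e else 0)" for c a e
      by (cases a) auto
    ultimately show ?thesis
      unfolding polyfun_coeffs_def by presburger
  qed
  show ?thesis
    unfolding char_pol_def char_mat_def det_mat_expand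
    by (intro polyfun_coeffs_sum polyfun_coeffs_mult polyfun_coeffs_const polyfun_coeffs_prod entry) (auto simp: permutes_in_image)
qed

lemma nonderogatory_cong:
  assumes "nonderogatory d A" "\<And>i j. i < d \<Longrightarrow> j < d \<Longrightarrow> A i j = B i j"
  shows "nonderogatory d B"
proof -
  have "(\<Sum>k<d. poly (B i k) x * S k j) = (\<Sum>k<d. poly (A i k) x * S k j)" if "i < d" for i j x and S :: "nat \<Rightarrow> nat \<Rightarrow> complex"
    using that assms(2) by (intro sum.cong) auto
  note eq = this
  show ?thesis
    unfolding nonderogatory_def
  proof (intro allI impI)
    fix x z S i j
    assume *: "\<forall>i<d. \<forall>j<d. S i j = - S j i" "\<forall>i<d. \<forall>j<d. (\<Sum>k<d. poly (B i k) x * S k j) = z * S i j"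
      "i < d" "j < d"
    have "\<forall>i<d. \<forall>j<d. (\<Sum>k<d. poly (A i k) x * S k j) = z * S i j"
    proof (intro allI impI)
      fix i j assume ij: "i < d" "j < d"
      then have "(\<Sum>k<d. poly (B i k) x * S k j) = z * S i j"
        using *(2) by blast
      then show "(\<Sum>k<d. poly (A i k) x * S k j) = z * S i j"
        using eq[OF ij(1), of x S j] by simp
    qed
    with assms(1) *(1,3,4) show "S i j = 0"
      unfolding nonderogatory_def by blast
  qed
qed

text \<open>The unknown coefficients of the entries \<open>(i, j)\<close>, \<open>i \<le> j\<close>, and the free coefficients of the
  characteristic polynomial are both indexed by the pairs \<open>(i, e)\<close> with \<open>i < d\<close> and \<open>e < K (d - i)\<close>;
  on the matrix side, \<open>(i, (j - i) K + e)\<close> stands for the coefficient of \<open>X^e\<close> in the entry \<open>(i, j)\<close>.\<close>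

lemma char_pol_local_surj:
  assumes A: "diag_top K d r A" and inj: "inj_on r {..<d}" and K: "K > 0"
    and reg: "nonderogatory d (\<lambda>i j. cpoly (A i j))"
  shows "\<exists>\<epsilon>>0. \<forall>G. top_form K d G (linear_prod d r) \<longrightarrow> (\<forall>i j. \<bar>coeff (coeff G i) j - coeff (coeff (char_pol d A) i) j\<bar> < \<epsilon>) \<longrightarrow>
    (\<exists>A'. diag_top K d r A' \<and> char_pol d A' = G)"
proof -
  define I where "I = (SIGMA i:{..<d}. {..<K * (d - i)})"
  define n where "n = card I"
  have "finite I"
    by (simp add: I_def)
  then obtain \<phi> where \<phi>: "bij_betw \<phi> {..<n} I"
    using ex_bij_betw_nat_finite unfolding n_def atLeast0LessThan by blast
  define \<psi> where "\<psi> = inv_into {..<n} \<phi>"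
  have \<psi>: "\<psi> p < n" "\<phi> (\<psi> p) = p" if "p \<in> I" for p
    using bij_betw_inv_into_right[OF \<phi> that] bij_betw_apply[OF bij_betw_inv_into[OF \<phi>] that]
    by (auto simp: \<psi>_def)
  have \<phi>I: "\<phi> l \<in> I" and \<psi>\<phi>: "\<psi> (\<phi> l) = l" if "l < n" for l
    using bij_betw_apply[OF \<phi>] bij_betw_inv_into_left[OF \<phi>] that by (auto simp: \<psi>_def)
  \<comment> \<open>Ordering the pair by \<open>min\<close> and \<open>max\<close> makes the entries
    (i, j) and (j, i) share their coordinates, so \<open>N\<close> is symmetric.\<close>
  define ix where "ix = (\<lambda>i j e. \<psi> (min i j, (max i j - min i j) * K + e))"
  have ixI: "(min i j, (max i j - min i j) * K + e) \<in> I" if "i < d" "j < d" "e < K" for i j e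
  proof -
    have "(max i j - min i j) * K + e < (max i j - min i j + 1) * K"
      using that by simp
    also have "\<dots> \<le> (d - min i j) * K"
      using that by (intro mult_right_mono) auto
    finally show ?thesis
      using that by (simp add: I_def mult.commute)
  qed
  define N where "N = (\<lambda>c :: nat \<Rightarrow> real. \<lambda>i j. \<Sum>e<K. monom (c (ix i j e)) e)"
  define M where "M = (\<lambda>c i j. (if i = j then monom (r i) K else 0) + N c i j)"
  have Ncoeff: "coeff (N c i j) e = (if e < K then c (ix i j e) else 0)" for c i j e
    by (simp add: N_def coeff_sum)
  have Nsym: "N c i j = N c j i" for c i j
    by (simp add: N_def ix_def min.commute max.commute)
  have Ndeg: "degree (N c i j) < K" for c i j
  proof -
    have "degree (N c i j) \<le> K - 1"
      by (rule degree_le) (auto simp: Ncoeff)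
    with K show ?thesis
      by simp
  qed
  have Msym: "M c i j = M c j i" for c i j
    by (simp add: M_def Nsym)
  have Mut: "top_coeff K (M c i j) (if i = j then r i else 0)" for c i j
    unfolding M_def top_coeff_def using Ndeg[of c i j]
    by (auto simp: degree_monom_eq coeff_eq_0 less_imp_le intro!: degree_add_le degree_monom_le)
  have Mtop: "diag_top K d r (M c)" for c
    unfolding diag_top_def using Msym Mut by blast
  have Mline: "M (\<lambda>l. c l + s * v l) i j = M c i j + smult s (N v i j)" for c v s i j
    by (rule poly_eqI) (simp add: M_def Ncoeff)
  \<comment> \<open>The coordinates of \<open>A\<close>: division of the second index by
    \<open>K\<close> recovers j - i as quotient and the exponent as remainder.\<close>
  define a where "a = (\<lambda>l. coeff (A (fst (\<phi> l)) (fst (\<phi> l) + snd (\<phi> l) div K)) (snd (\<phi> l) mod K))"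
  have Ma: "M a i j = A i j" if ij: "i < d" "j < d" for i j
  proof (rule poly_eqI)
    fix e
    have utA: "top_coeff K (A i j) (if i = j then r i else 0)"
      using A ij by (simp add: diag_top_def)
    consider "e < K" | "e = K" | "e > K"
      by linarith
    then show "coeff (M a i j) e = coeff (A i j) e"
    proof cases
      case 1
      have "a (ix i j e) = coeff (A (min i j) (max i j)) e"
        unfolding a_def ix_def \<psi>(2)[OF ixI[OF ij 1]] using 1 by simp
      also have "\<dots> = coeff (A i j) e"
        using A ij by (cases "i \<le> j") (auto simp: diag_top_def min_def max_def)
      finally show ?thesis
        using 1 by (simp add: M_def Ncoeff)
    next
      case 2
      then show ?thesis
        using utA by (simp add: M_def Ncoeff top_coeff_def)
    next
      case 3
      then have "coeff (A i j) e = 0"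
        using utA by (intro coeff_eq_0) (auto simp: top_coeff_def)
      then show ?thesis
        using 3 by (simp add: M_def Ncoeff)
    qed
  qed
  define F where "F = (\<lambda>l c. coeff (coeff (char_pol d (M c)) (fst (\<phi> l))) (snd (\<phi> l)))"
  have pfM: "polyfun_coeffs n (\<lambda>c. char_pol d (M c))"
  proof (rule polyfun_coeffs_char_pol)
    fix i j e assume ij: "i < d" "j < d"
    have "polyfun n (\<lambda>c. coeff (if i = j then monom (r i) K else 0) e + (if e < K then c (ix i j e) else 0))"
    proof (cases "e < K")
      case True
      then have "ix i j e < n"
        unfolding ix_def by (intro \<psi>(1) ixI ij)
      with True show ?thesis
        by (auto intro!: polyfun_add polyfun_const polyfun_coord)
    qed (auto intro: polyfun_const)
    then show "polyfun n (\<lambda>c. coeff (M c i j) e)"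
      by (simp add: M_def Ncoeff)
  qed
  \<comment> \<open>A coefficient outside \<open>I\<close> lies beyond the weight bound, hence is
    zero, or is the top one, prescribed by \<open>linear_prod d r\<close>.\<close>
  have fixed: "coeff (coeff (char_pol d (M c)) i) j = coeff (coeff (char_pol d (M a)) i) j" if nI: "(i, j) \<notin> I" for c i j
  proof -
    have top_form: "top_form K d (char_pol d (M c)) (linear_prod d r)" for c
      by (rule top_form_diag_top[OF Mtop])
    consider "i > d" | "i \<le> d" "j > K * (d - i)" | "i \<le> d" "j = K * (d - i)"
      using nI by (cases "i < d") (auto simp: I_def not_less le_less)
    then show ?thesis
    proof cases
      case 1
      then show ?thesis
        using top_form by (simp add: top_form_def)
    next
      case 2
      then have "degree (coeff (char_pol d (M c)) i) < j" for c
        using top_form[of c] by (auto simp: top_form_def top_coeff_def intro: le_less_trans)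
      then show ?thesis
        by (simp add: coeff_eq_0)
    next
      case 3
      then show ?thesis
        using top_form[of c] top_form[of a] by (simp add: top_form_def top_coeff_def)
    qed
  qed
  have "\<exists>e>0. \<forall>y. (\<forall>l<n. \<bar>y l - F l a\<bar> < e) \<longrightarrow> (\<exists>x. \<forall>l<n. F l x = y l)"
  proof (rule local_surjectivity)
    show "polyfun n (F l)" for l
      using pfM unfolding F_def polyfun_coeffs_def by blast
    fix v assume v: "\<And>l. l < n \<Longrightarrow> ((\<lambda>s. F l (\<lambda>k. a k + s * v k)) has_real_derivative 0) (at 0)"
    have null: "line_deriv (\<lambda>s. char_pol d (\<lambda>i j. M a i j + smult s (N v i j))) 0"
      unfolding line_deriv_def
    proof (intro allI)
      fix i j
      have "((\<lambda>s. coeff (coeff (char_pol d (M (\<lambda>k. a k + s * v k))) i) j) has_real_derivative 0) (at 0)"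
      proof (cases "(i, j) \<in> I")
        case True
        then show ?thesis
          using v[OF \<psi>(1)[OF True]] by (simp add: F_def \<psi>(2))
      next
        case False
        show ?thesis
          unfolding fixed[OF False, of "\<lambda>k. a k + _ * v k"] by (rule DERIV_const)
      qed
      then show "((\<lambda>s. coeff (coeff (char_pol d (\<lambda>i j. M a i j + smult s (N v i j))) i) j) has_real_derivative coeff (coeff 0 i) j) (at 0)"
        by (simp add: Mline[abs_def] )
    qed
    have regM: "nonderogatory d (\<lambda>i j. cpoly (M a i j))"
      by (rule nonderogatory_cong[OF reg]) (simp add: Ma)
    have N0: "N v i j = 0" if "i < d" "j < d" for i j
      by (rule null_direction_zero[OF null Mut inj Msym Nsym Ndeg regM that])
    show "\<forall>l<n. v l = 0"
    proof (intro allI impI)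
      fix l assume l: "l < n"
      obtain i q where p: "\<phi> l = (i, q)"
        by (cases "\<phi> l")
      have iq: "i < d" "q < K * (d - i)"
        using \<phi>I[OF l] by (auto simp: p I_def)
      then have "q div K < d - i"
        by (simp add: less_mult_imp_div_less mult.commute)
      then have j: "i + q div K < d"
        by simp
      have "v (ix i (i + q div K) (q mod K)) = coeff (N v i (i + q div K)) (q mod K)"
        using K by (simp add: Ncoeff)
      also have "\<dots> = 0"
        using N0[OF iq(1) j] by simp
      also have "ix i (i + q div K) (q mod K) = \<psi> (\<phi> l)"
        by (simp add: ix_def p)
      finally show "v l = 0"
        by (simp add: \<psi>\<phi>[OF l])
    qed
  qed
  then obtain e where e: "e > 0" "\<And>y. (\<forall>l<n. \<bar>y l - F l a\<bar> < e) \<Longrightarrow> \<exists>x. \<forall>l<n. F l x = y l"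
    by blast
  have chpA: "char_pol d (M a) = char_pol d A"
    by (rule char_pol_cong[OF Ma])
  show ?thesis
  proof (intro exI[of _ e] conjI e(1) allI impI)
    fix G assume tG: "top_form K d G (linear_prod d r)"
      and close: "\<forall>i j. \<bar>coeff (coeff G i) j - coeff (coeff (char_pol d A) i) j\<bar> < e"
    have "\<exists>x. \<forall>l<n. F l x = coeff (coeff G (fst (\<phi> l))) (snd (\<phi> l))"
      by (rule e(2)) (use close in \<open>simp add: F_def chpA\<close>)
    then obtain x where x: "\<And>l. l < n \<Longrightarrow> F l x = coeff (coeff G (fst (\<phi> l))) (snd (\<phi> l))"
      by blast
    have "char_pol d (M x) = G"
    proof (intro poly_eqI)
      fix i j
      have tM: "top_form K d (char_pol d (M x)) (linear_prod d r)"
        by (rule top_form_diag_top[OF Mtop])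
      consider "(i, j) \<in> I" | "i > d" | "i \<le> d" "j > K * (d - i)" | "i \<le> d" "j = K * (d - i)"
        using linorder_less_linear[of j "K * (d - i)"]
        by (cases "i < d") (auto simp: I_def not_less le_less)
      then show "coeff (coeff (char_pol d (M x)) i) j = coeff (coeff G i) j"
      proof cases
        case 1
        then show ?thesis
          using x[OF \<psi>(1)[OF 1]] by (simp add: F_def \<psi>(2))
      next
        case 2
        then show ?thesis
          using tM tG by (simp add: top_form_def)
      next
        case 3
        then have "degree (coeff (char_pol d (M x)) i) < j" "degree (coeff G i) < j"
          using tM tG by (auto simp: top_form_def top_coeff_def intro: le_less_trans)
        then show ?thesis
          by (simp add: coeff_eq_0)
      next
        case 4
        then show ?thesis
          using tM tG by (simp add: top_form_def top_coeff_def)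
      qed
    qed
    then show "\<exists>A'. diag_top K d r A' \<and> char_pol d A' = G"
      using Mtop by blast
  qed
qed

text \<open>Continuity method: the parameters \<open>s\<close> with \<open>F s\<close> in the image form a closed and open subset of
  \<open>[0, 1]\<close>.\<close>

lemma path_in_image:
  fixes F :: "real \<Rightarrow> real poly poly"
  assumes inj: "inj_on r {..<d}" and K: "K > 0"
    and top_form: "\<And>s. top_form K d (F s) (linear_prod d r)"
    and cont: "\<And>i j. continuous_on UNIV (\<lambda>s. coeff (coeff (F s) i) j)"
    and nonsing: "\<And>s x t. s \<in> {0..1} \<Longrightarrow> \<not> singular (ccpoly (F s)) x t"
    and start: "\<exists>A. diag_top K d r A \<and> char_pol d A = F 0"
  shows "\<exists>A. diag_top K d r A \<and> char_pol d A = F 1"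
proof -
  define X where "X = {s \<in> {0..1}. \<exists>A. diag_top K d r A \<and> char_pol d A = F s}"
  have lim: "coeff_lim (\<lambda>n. F (s n)) (F l)" if "s \<longlonglongrightarrow> l" for s l
    unfolding coeff_lim_def
  proof (intro allI)
    fix i j
    show "(\<lambda>n. coeff (coeff (F (s n)) i) j) \<longlonglongrightarrow> coeff (coeff (F l) i) j"
      by (rule continuous_on_tendsto_compose[OF cont that]) auto
  qed
  have "closed X"
    unfolding closed_sequential_limits
  proof (intro allI impI, elim conjE)
    fix s l assume s: "\<forall>n. s n \<in> X" "s \<longlonglongrightarrow> l"
    have l: "l \<in> {0..1}"
      using s closed_sequentially[of "{0..1::real}" s l] by (auto simp: X_def)
    have "\<exists>A. diag_top K d r A \<and> char_pol d A = F (s n)" for n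
      using s(1) by (auto simp: X_def)
    then obtain A where A: "\<And>n. diag_top K d r (A n)" "\<And>n. char_pol d (A n) = F (s n)"
      by metis
    have A1: "A n i j = A n j i" if "i < d" "j < d" for n i j
      using A(1)[of n] that by (simp add: diag_top_def)
    have A2: "degree (A n i j) \<le> K" if "i < d" "j < d" for n i j
      using A(1)[of n] that by (auto simp: diag_top_def top_coeff_def)
    have A3: "coeff_lim (\<lambda>n. char_pol d (A n)) (F l)"
      unfolding A(2) by (rule lim[OF s(2)])
    obtain q B where q: "strict_mono (q :: nat \<Rightarrow> nat)"
      and B: "\<And>i j e. i < d \<Longrightarrow> j < d \<Longrightarrow> (\<lambda>n. coeff (A (q n) i j) e) \<longlonglongrightarrow> coeff (B i j) e"
      and FB: "char_pol d B = F l"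
      using char_pol_limit[of d A K "F l", OF A1 A2 A3] by blast
    have "B i j = B j i" if "i < d" "j < d" for i j
    proof (rule poly_eqI)
      fix e
      have "(\<lambda>n. coeff (A (q n) i j) e) = (\<lambda>n. coeff (A (q n) j i) e)"
        using A(1) that by (simp add: diag_top_def)
      from B[OF that, of e, unfolded this] B[OF that(2,1), of e] show "coeff (B i j) e = coeff (B j i) e"
        by (rule LIMSEQ_unique)
    qed
    moreover have "top_coeff K (B i j) (if i = j then r i else 0)" if "i < d" "j < d" for i j
    proof -
      have utA: "top_coeff K (A (q n) i j) (if i = j then r i else 0)" for n
        using A(1)[of "q n"] that by (simp add: diag_top_def)
      have "coeff (B i j) e = 0" if "e > K" for e
      proof -
        have "coeff (A (q n) i j) e = 0" for n
          using utA[of n] that by (intro coeff_eq_0) (auto simp: top_coeff_def)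
        then show ?thesis
          using B[OF \<open>i < d\<close> \<open>j < d\<close>, of e] by (simp add: LIMSEQ_const_iff)
      qed
      then have "degree (B i j) \<le> K"
        by (intro degree_le) auto
      moreover have "coeff (B i j) K = (if i = j then r i else 0)"
        using B[OF that, of K] utA by (simp add: top_coeff_def LIMSEQ_const_iff)
      ultimately show ?thesis
        by (simp add: top_coeff_def)
    qed
    ultimately have "diag_top K d r B"
      by (simp add: diag_top_def)
    with FB l show "l \<in> X"
      by (auto simp: X_def)
  qed
  then have "closedin (top_of_set {0..1}) X"
    by (rule closed_subset[rotated]) (auto simp: X_def)
  moreover have "openin (top_of_set {0..1}) X"
    unfolding openin_contains_ball
  proof (intro conjI ballI)
    show "X \<subseteq> {0..1}"
      by (auto simp: X_def)
    fix s assume "s \<in> X"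
    then obtain A where s: "s \<in> {0..1}" and A: "diag_top K d r A" "char_pol d A = F s"
      by (auto simp: X_def)
    have h: "comm_ring_hom cpoly"
    proof -
      interpret ch: map_poly_inj_idom_hom complex_of_real ..
      show ?thesis ..
    qed
    have "nonderogatory d (\<lambda>i j. cpoly (A i j))"
    proof (rule nonderogatory_if_nonsingular)
      fix x z
      have "char_pol d (\<lambda>i j. cpoly (A i j)) = ccpoly (F s)"
        unfolding ccpoly_def A(2)[symmetric] map_poly_char_pol[OF h] ..
      then show "\<not> singular (char_pol d (\<lambda>i j. cpoly (A i j))) x z"
        using nonsing[OF s] by simp
    qed
    from char_pol_local_surj[OF A(1) inj K this] obtain \<epsilon> where \<epsilon>: "\<epsilon> > 0"
      "\<And>G. top_form K d G (linear_prod d r) \<Longrightarrow> (\<forall>i j. \<bar>coeff (coeff G i) j - coeff (coeff (F s) i) j\<bar> < \<epsilon>) \<Longrightarrow>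
         \<exists>A'. diag_top K d r A' \<and> char_pol d A' = G"
      unfolding A(2) by blast
    \<comment> \<open>Only coefficients with i \<le> d and j \<le> K d can be nonzero, so a minimum
      over finitely many radii suffices.\<close>
    have "\<forall>p\<in>{..d} \<times> {..K * d}. \<exists>\<delta>>0. \<forall>u. dist u s < \<delta> \<longrightarrow> \<bar>coeff (coeff (F u) (fst p)) (snd p) - coeff (coeff (F s) (fst p)) (snd p)\<bar> < \<epsilon>"
    proof
      fix p :: "nat \<times> nat"
      have "\<exists>\<delta>>0. \<forall>u\<in>UNIV. dist u s < \<delta> \<longrightarrow> dist (coeff (coeff (F u) (fst p)) (snd p)) (coeff (coeff (F s) (fst p)) (snd p)) < \<epsilon>"
        using cont[of "fst p" "snd p"] \<epsilon>(1) unfolding continuous_on_iff by blast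
      then show "\<exists>\<delta>>0. \<forall>u. dist u s < \<delta> \<longrightarrow> \<bar>coeff (coeff (F u) (fst p)) (snd p) - coeff (coeff (F s) (fst p)) (snd p)\<bar> < \<epsilon>"
        by (simp add: dist_real_def)
    qed
    from bchoice[OF this] obtain D where D0: "\<forall>p\<in>{..d} \<times> {..K * d}. D p > 0 \<and> (\<forall>u. dist u s < D p \<longrightarrow>
        \<bar>coeff (coeff (F u) (fst p)) (snd p) - coeff (coeff (F s) (fst p)) (snd p)\<bar> < \<epsilon>)"
      by (elim exE)
    have D: "D p > 0"
      "\<And>u. dist u s < D p \<Longrightarrow> \<bar>coeff (coeff (F u) (fst p)) (snd p) - coeff (coeff (F s) (fst p)) (snd p)\<bar> < \<epsilon>"
      if "p \<in> {..d} \<times> {..K * d}" for p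
      using D0[rule_format, OF that] by blast+
    define \<delta> where "\<delta> = Min (D ` ({..d} \<times> {..K * d}))"
    have \<delta>: "\<delta> > 0"
      unfolding \<delta>_def using D(1) by (subst Min_gr_iff) auto
    have "u \<in> X" if u: "u \<in> {0..1}" "dist u s < \<delta>" for u
    proof -
      have "\<bar>coeff (coeff (F u) i) j - coeff (coeff (F s) i) j\<bar> < \<epsilon>" for i j
      proof (cases "i \<le> d \<and> j \<le> K * d")
        case True
        then have "\<delta> \<le> D (i, j)"
          unfolding \<delta>_def by (intro Min_le) auto
        with u True D(2)[of "(i, j)" u] show ?thesis
          by simp
      next
        case False
        have "coeff (coeff (F w) i) j = 0" for w
        proof (cases "i \<le> d")
          case True
          have "degree (coeff (F w) i) \<le> K * (d - i)"
            using top_form[of w] True by (auto simp: top_form_def top_coeff_def)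
          also have "\<dots> \<le> K * d"
            by simp
          also have "\<dots> < j"
            using False True by simp
          finally show ?thesis
            by (rule coeff_eq_0)
        qed (use top_form[of w] in \<open>simp add: top_form_def\<close>)
        then show ?thesis
          using \<epsilon>(1) by simp
      qed
      then show ?thesis
        using \<epsilon>(2)[OF top_form] u(1) by (auto simp: X_def)
    qed
    then show "\<exists>e>0. ball s e \<inter> {0..1} \<subseteq> X"
      using \<delta> by (intro exI[of _ \<delta>]) (auto simp: dist_commute)
  qed
  moreover have "0 \<in> X"
    using start by (simp add: X_def)
  ultimately have "X = {0..1}"
    using connected_Icc[of "0::real" 1] unfolding connected_clopen by blast
  then have "1 \<in> X"
    by simp
  then show ?thesis
    by (simp add: X_def)
qed

subsection \<open>Approximation by polynomials in the image\<close>

text \<open>Substitution T = L T' and division by L^d: for L \<noteq> 0 a monic polynomial of degree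
  d stays monic and its roots are divided by L.\<close>

definition rescale :: "nat \<Rightarrow> real \<Rightarrow> real poly \<Rightarrow> real poly" where
  "rescale d L p = smult (1 / L ^ d) (p \<circ>\<^sub>p [:0, L:])"

lemma coeff_rescale: "coeff (rescale d L p) i = L ^ i * coeff p i / L ^ d"
  by (simp add: rescale_def coeff_pcompose_linear)

lemma rescale_double_root:
  assumes L: "L \<noteq> 0" and t: "poly (cpoly p) t = 0" "poly (pderiv (cpoly p)) t = 0"
  shows "poly (cpoly (rescale d L p)) (t / of_real L) = 0 \<and> poly (pderiv (cpoly (rescale d L p))) (t / of_real L) = 0"
proof -
  have "cpoly (rescale d L p) = smult (of_real (1 / L ^ d)) (cpoly p \<circ>\<^sub>p [:0, of_real L:])"
    by (intro poly_eqI) (simp add: coeff_rescale coeff_pcompose_linear)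
  with L t show ?thesis
    by (simp add: pderiv_smult pderiv_pcompose poly_pcompose)
qed

lemma coeff_specialize: "coeff (specialize_X x f) i = poly (coeff f i) x"
  by (simp add: specialize_X_def coeff_map_poly)

lemma poly_poly_eq: "poly (poly G [:t:]) x = poly (map_poly (\<lambda>a. poly a x) G) t"
  by (induction G) (auto simp: map_poly_pCons)

lemma singular_real_double_root:
  assumes "singular (ccpoly F) (complex_of_real x) t"
  shows "poly (cpoly (specialize_X x F)) t = 0" "poly (pderiv (cpoly (specialize_X x F))) t = 0"
proof -
  have e: "poly (cpoly a) (complex_of_real x) = complex_of_real (poly a x)" for a
    by (simp add: of_real_hom.poly_map_poly)
  have "map_poly (\<lambda>a. poly a (complex_of_real x)) (ccpoly F) = cpoly (specialize_X x F)"
    by (intro poly_eqI) (simp add: coeff_map_poly coeff_ccpoly coeff_specialize e)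
  then show "poly (cpoly (specialize_X x F)) t = 0"
    using assms by (simp add: singular_def poly_poly_eq)
  have "map_poly (\<lambda>a. poly a (complex_of_real x)) (pderiv (ccpoly F)) = pderiv (cpoly (specialize_X x F))"
    by (intro poly_eqI) (simp add: coeff_map_poly coeff_ccpoly coeff_specialize e coeff_pderiv of_nat_poly)
  then show "poly (pderiv (cpoly (specialize_X x F))) t = 0"
    using assms by (simp add: singular_def poly_poly_eq)
qed

section \<open>The root separating operator over the polynomial ring in X\<close>

definition nuijX :: "real poly \<Rightarrow> real \<Rightarrow> real poly poly \<Rightarrow> real poly poly" where
  "nuijX l c g = g - smult (smult c l) (pderiv g)"

lemma rescale_nuijX:
  "rescale d (poly l x) (specialize_X x (nuijX l c g)) = nuij c (rescale d (poly l x) (specialize_X x g))"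
  by (intro poly_eqI)
     (simp add: coeff_rescale coeff_specialize nuijX_def nuij_def coeff_pderiv algebra_simps diff_divide_distrib)

lemma rescale_nuijX_iterate:
  "rescale d (poly l x) (specialize_X x ((nuijX l c ^^ n) g)) = (nuij c ^^ n) (rescale d (poly l x) (specialize_X x g))"
  by (induction n) (simp_all add: rescale_nuijX)

lemma top_form_smult:
  assumes "top_coeff K a u" "top_form K e g h"
  shows "top_form K (Suc e) (smult a g) (smult u h)"
proof -
  have "top_form K 1 [:a:] [:u:]"
    using assms(1) by (auto simp: top_form_def top_coeff_def coeff_pCons split: nat.splits)
  from top_form_mult[OF this assms(2)] show ?thesis
    by simp
qed

lemma top_form_pderiv:
  assumes "top_form K (Suc e) g h"
  shows "top_form K e (pderiv g) (pderiv h)"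
  unfolding top_form_def
proof (intro conjI allI impI)
  show "coeff (pderiv g) i = 0" "coeff (pderiv h) i = 0" if "i > e" for i
    using assms that by (auto simp: top_form_def coeff_pderiv)
  show "top_coeff (K * (e - i)) (coeff (pderiv g) i) (coeff (pderiv h) i)" if "i \<le> e" for i
  proof -
    have "top_coeff (K * (e - i)) (coeff g (Suc i)) (coeff h (Suc i))"
      using assms that by (auto simp: top_form_def)
    then show ?thesis
      by (auto simp: top_coeff_def coeff_pderiv of_nat_poly intro: order_trans[OF degree_mult_le])
  qed
qed

text \<open>The factor \<open>l\<close> has weight 1 and makes up for the weight lost by d/dT; as
  its leading coefficient is 1, leading forms undergo plain \<open>nuij c\<close>.\<close>

lemma top_form_nuijX:
  assumes "top_coeff K l 1" "top_form K d g h" "d > 0"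
  shows "top_form K d (nuijX l c g) (nuij c h)"
proof -
  obtain e where e: "d = Suc e"
    using assms(3) gr0_implies_Suc by blast
  have "top_coeff K (smult c l) c"
    using assms(1) by (auto simp: top_coeff_def)
  from top_form_smult[OF this top_form_pderiv[OF assms(2)[unfolded e]]] assms(2) show ?thesis
    unfolding nuijX_def nuij_def e by (intro top_form_diff)
qed

lemma top_form_nuijX_iterate:
  assumes "top_coeff K l 1" "top_form K d g h" "d > 0"
  shows "top_form K d ((nuijX l c ^^ n) g) ((nuij c ^^ n) h)"
  by (induction n) (auto intro: top_form_nuijX assms)

lemma coeff_nuijX:
  "coeff (coeff (nuijX l c g) i) j
     = coeff (coeff g i) j - c * (\<Sum>b\<le>j. coeff l b * (real (Suc i) * coeff (coeff g (Suc i)) (j - b)))"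
proof -
  have "coeff (pderiv g) i = smult (real (Suc i)) (coeff g (Suc i))"
    by (simp add: coeff_pderiv of_nat_poly)
  then show ?thesis
    by (simp add: nuijX_def coeff_mult sum_distrib_left mult_ac)
qed

lemma coeff_lim_nuijX:
  assumes "coeff_lim g G" "c \<longlonglongrightarrow> 0"
  shows "coeff_lim (\<lambda>n. nuijX l (c n) (g n)) G"
  unfolding coeff_lim_def
proof (intro allI)
  fix i j
  have "(\<lambda>n. coeff (coeff (g n) i) j - c n * (\<Sum>b\<le>j. coeff l b * (real (Suc i) * coeff (coeff (g n) (Suc i)) (j - b))))
      \<longlonglongrightarrow> coeff (coeff G i) j - 0 * (\<Sum>b\<le>j. coeff l b * (real (Suc i) * coeff (coeff G (Suc i)) (j - b)))"
    using assms by (intro tendsto_intros) (auto simp: coeff_lim_def)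
  then show "(\<lambda>n. coeff (coeff (nuijX l (c n) (g n)) i) j) \<longlonglongrightarrow> coeff (coeff G i) j"
    by (simp only: coeff_nuijX mult_zero_left diff_zero)
qed

lemma coeff_lim_nuijX_iterate:
  assumes "c \<longlonglongrightarrow> 0"
  shows "coeff_lim (\<lambda>n. (nuijX l (c n) ^^ m) f) f"
  by (induction m) (auto intro: coeff_lim_const coeff_lim_nuijX assms)

lemma differentiable_nuijX:
  assumes "\<And>i j. (\<lambda>s. coeff (coeff (g s) i) j) differentiable (at (s :: real))"
  shows "(\<lambda>s. coeff (coeff (nuijX l c (g s)) i) j) differentiable (at s)"
  unfolding coeff_nuijX
  by (intro differentiable_diff differentiable_mult differentiable_const differentiable_sum
      ballI finite_atMost assms)

lemma differentiable_nuijX_iterate: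
  assumes "\<And>i j. (\<lambda>s. coeff (coeff (g s) i) j) differentiable (at (s :: real))"
  shows "(\<lambda>s. coeff (coeff ((nuijX l c ^^ n) (g s)) i) j) differentiable (at s)"
  by (induction n arbitrary: i j) (simp_all add: assms differentiable_nuijX)

text \<open>The value t = 0, with 0^0 = 1, is included: the path starts there, with all roots at
  zero.\<close>

lemma coeff_linear_prod_scale:
  assumes "i \<le> d"
  shows "coeff (linear_prod d (\<lambda>i. t * r i)) i = t ^ (d - i) * coeff (linear_prod d r) i"
proof (cases "t = 0")
  case True
  have "linear_prod d (\<lambda>i. 0) = monom 1 d"
    by (simp add: linear_prod_def monom_altdef)
  moreover have "0 ^ (d - i) * coeff (linear_prod d r) i = coeff (monom 1 d) i"
    using assms lead_linear_prod[of d r] by (cases "i = d") auto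
  ultimately show ?thesis
    using True by simp
next
  case False
  have e: "(\<lambda>i j. if i = j then t * r i else 0) = (\<lambda>i j. t * (if i = j then r i else 0))"
    by (intro ext) simp
  have "coeff (linear_prod d (\<lambda>i. t * r i)) i * t ^ i = t ^ d * coeff (linear_prod d r) i"
    using coeff_char_pol_smult[of d t "\<lambda>i j. if i = j then r i else 0" i] unfolding e[symmetric] char_pol_diag_linear_prod .
  moreover have "t ^ d = t ^ (d - i) * t ^ i"
    using assms by (simp add: power_add[symmetric])
  ultimately show ?thesis
    using False by simp
qed

lemma poly_growth:
  fixes a :: "real poly" and x :: real
  assumes "degree a \<le> 2 * n"
  shows "\<bar>poly a x\<bar> \<le> (\<Sum>j\<le>2 * n. \<bar>coeff a j\<bar>) * (1 + x\<^sup>2) ^ n"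
proof -
  have pow: "\<bar>x\<bar> ^ j \<le> (1 + x\<^sup>2) ^ n" if "j \<le> 2 * n" for j
  proof -
    have "\<bar>x\<bar> ^ j \<le> (max 1 \<bar>x\<bar>) ^ j"
      by (intro power_mono) auto
    also have "\<dots> \<le> (max 1 \<bar>x\<bar>) ^ (2 * n)"
      using that by (intro power_increasing) auto
    also have "\<dots> = ((max 1 \<bar>x\<bar>)\<^sup>2) ^ n"
      by (rule power_mult)
    also have "\<dots> \<le> (1 + x\<^sup>2) ^ n"
      by (intro power_mono) (auto simp: max_def)
    finally show ?thesis .
  qed
  have "\<bar>poly a x\<bar> = \<bar>\<Sum>j\<le>2 * n. coeff a j * x ^ j\<bar>"
    by (simp only: poly_eq_sum_le[OF assms])
  also have "\<dots> \<le> (\<Sum>j\<le>2 * n. \<bar>coeff a j * x ^ j\<bar>)"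
    by (rule sum_abs)
  also have "\<dots> \<le> (\<Sum>j\<le>2 * n. \<bar>coeff a j\<bar> * (1 + x\<^sup>2) ^ n)"
    unfolding abs_mult power_abs using pow by (intro sum_mono mult_left_mono) auto
  finally show ?thesis
    by (simp only: sum_distrib_right)
qed

lemma norm_triple_le:
  fixes p :: "complex \<times> complex \<times> complex"
  shows "norm (fst p) \<le> norm p" "norm (fst (snd p)) \<le> norm p" "norm (snd (snd p)) \<le> norm p"
proof -
  have fs: "norm (fst q) \<le> norm q" "norm (snd q) \<le> norm q" for q :: "'a::real_normed_vector \<times> 'b::real_normed_vector"
    using norm_fst_le[of "fst q" "snd q"] norm_snd_le[of "snd q" "fst q"] by simp_all
  show "norm (fst p) \<le> norm p"
    by (rule fs)
  show "norm (fst (snd p)) \<le> norm p"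
    by (rule order_trans[OF fs(1) fs(2)])
  show "norm (snd (snd p)) \<le> norm p"
    by (rule order_trans[OF fs(2) fs(2)])
qed

lemma coeff_perturb_le: "\<bar>coeff (coeff (perturb p) i) j\<bar> \<le> norm p"
proof -
  have "\<bar>Re z\<bar> \<le> norm p \<and> \<bar>Im z\<bar> \<le> norm p" if "norm z \<le> norm p" for z :: complex
    using that abs_Re_le_cmod[of z] abs_Im_le_cmod[of z] by linarith
  then show ?thesis
    using norm_triple_le[of p] by (auto simp: perturb_def coeff_pCons split: nat.splits)
qed

lemma coeff_perturb:
  "coeff (perturb p) 0 = [:Re (fst p), Im (fst p), Re (fst (snd p)), Im (fst (snd p)):]"
  "coeff (perturb p) 1 = [:Re (snd (snd p)), Im (snd (snd p)):]"
  "i > 1 \<Longrightarrow> coeff (perturb p) i = 0"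
  by (simp_all add: perturb_def coeff_eq_0)

lemma degree_perturb: "degree (coeff (perturb p) i) \<le> 3" "degree (coeff (perturb p) 1) \<le> 1"
proof -
  have lin: "degree [:a, b:] \<le> 1" for a b :: real
    by simp
  have cub: "degree [:a, b, c, e:] \<le> 3" for a b c e :: real
    by simp
  show "degree (coeff (perturb p) 1) \<le> 1"
    unfolding coeff_perturb by (rule lin)
  consider "i = 0" | "i = 1" | "i > 1"
    by linarith
  then show "degree (coeff (perturb p) i) \<le> 3"
  proof cases
    case 1
    show ?thesis
      unfolding 1 coeff_perturb by (rule cub)
  next
    case 2
    show ?thesis
      unfolding 2 coeff_perturb by (rule order_trans[OF lin]) simp
  next
    case 3
    then show ?thesis
      by (simp add: coeff_perturb(3))
  qed
qed

text \<open>The perturbation stays strictly below the leading form, 3 < K d and 1 < K (d - 1). For d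
  = 1 the term b(X) T would alter the coefficient of T^d.\<close>

lemma top_form_perturb:
  assumes "d \<ge> 2" "K \<ge> 4"
  shows "top_form K d (perturb p) 0"
  unfolding top_form_def
proof (intro conjI allI impI)
  fix i
  show "coeff (perturb p) i = 0" if "i > d"
    using coeff_perturb(3) that assms by simp
  show "coeff (0 :: real poly) i = 0"
    by simp
  show "top_coeff (K * (d - i)) (coeff (perturb p) i) (coeff 0 i)" if "i \<le> d"
  proof -
    consider "i = 0" | "i = 1" | "i > 1"
      by linarith
    then show ?thesis
    proof cases
      case 1
      have "3 < K * d"
        using assms mult_le_mono[of 4 K 2 d] by simp
      then have "degree (coeff (perturb p) i) < K * (d - i)"
        using degree_perturb(1)[of p i] 1 by simp
      then show ?thesis
        by (simp add: top_coeff_def coeff_eq_0)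
    next
      case 2
      have "4 * 1 \<le> K * (d - 1)"
        by (intro mult_le_mono) (use assms in auto)
      then have "degree (coeff (perturb p) i) < K * (d - i)"
        using degree_perturb(2)[of p] 2 by simp
      then show ?thesis
        by (simp add: top_coeff_def coeff_eq_0)
    next
      case 3
      then show ?thesis
        by (simp add: coeff_perturb(3) top_coeff_0)
    qed
  qed
qed

text \<open>All \<eta> up to \<sigma> are covered because rescaling at a real x turns the
  off-diagonal constant \<sigma> into \<sigma> / L for some L \<ge> 1.\<close>

lemma tridiagonal_near:
  fixes r :: "nat \<Rightarrow> real"
  assumes e: "e > 0"
  obtains \<sigma> where "\<sigma> > 0" "\<And>\<eta> i. \<bar>\<eta>\<bar> \<le> \<sigma> \<Longrightarrow> i < d \<Longrightarrow>
    \<bar>coeff (char_pol d (\<lambda>i j. if i = j then r i else if j = Suc i \<or> i = Suc j then \<eta> else 0)) i - coeff (linear_prod d r) i\<bar> < e"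
proof -
  define T where "T = (\<lambda>\<eta> i j. if i = j then r i else if j = Suc i \<or> i = Suc j then \<eta> else 0)"
  have h: "comm_ring_hom (\<lambda>a :: real. [:a:])"
    by unfold_locales (auto simp: one_pCons)
  \<comment> \<open>Real entries are embedded as constant polynomials and \<eta> is the single
    coordinate \<open>c 0\<close>, so that \<open>polyfun_coeffs_char_pol\<close> applies.\<close>
  have "polyfun_coeffs 1 (\<lambda>c. char_pol d (\<lambda>i j. [:T (c 0) i j:]))"
  proof (rule polyfun_coeffs_char_pol)
    fix i j e
    have "polyfun 1 (\<lambda>c. T (c 0) i j)"
      by (cases "i = j"; cases "j = Suc i \<or> i = Suc j") (auto simp: T_def intro: polyfun_const polyfun_coord)
    then show "polyfun 1 (\<lambda>c. coeff [:T (c 0) i j:] e)"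
      by (cases e) (auto intro: polyfun_const)
  qed
  moreover have "char_pol d (\<lambda>i j. [:T \<eta> i j:]) = map_poly (\<lambda>a. [:a:]) (char_pol d (T \<eta>))" for \<eta>
    by (simp add: map_poly_char_pol[OF h])
  ultimately have pfc: "polyfun 1 (\<lambda>c. coeff (coeff (map_poly (\<lambda>a. [:a:]) (char_pol d (T (c 0)))) i) 0)" for i
    unfolding polyfun_coeffs_def by simp
  then have pfc: "polyfun 1 (\<lambda>c. coeff (char_pol d (T (c 0))) i)" for i
    by (simp add: coeff_map_poly)
  have "\<exists>\<delta>>0. \<forall>\<eta>. \<bar>\<eta>\<bar> \<le> \<delta> \<longrightarrow> \<bar>coeff (char_pol d (T \<eta>)) i - coeff (char_pol d (T 0)) i\<bar> < e" for i
  proof -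
    obtain \<delta> where "\<delta> > 0" and \<delta>: "\<And>x :: nat \<Rightarrow> real. (\<forall>k<1. \<bar>x k - 0\<bar> \<le> \<delta>) \<Longrightarrow>
        \<bar>coeff (char_pol d (T (x 0))) i - coeff (char_pol d (T 0)) i\<bar> < e"
      using polyfun_near[OF pfc[of i] e, of "\<lambda>k. 0"] by blast
    show ?thesis
    proof (intro exI conjI allI impI)
      show "\<delta> > 0"
        by fact
      fix \<eta> :: real assume "\<bar>\<eta>\<bar> \<le> \<delta>"
      then show "\<bar>coeff (char_pol d (T \<eta>)) i - coeff (char_pol d (T 0)) i\<bar> < e"
        using \<delta>[of "\<lambda>k. \<eta>"] by simp
    qed
  qed
  then obtain D where D: "\<And>i. D i > 0" "\<And>i \<eta>. \<bar>\<eta>\<bar> \<le> D i \<Longrightarrow> \<bar>coeff (char_pol d (T \<eta>)) i - coeff (char_pol d (T 0)) i\<bar> < e"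
    by metis
  define \<sigma> where "\<sigma> = Min (insert 1 (D ` {..<d}))"
  have \<sigma>: "\<sigma> > 0"
    unfolding \<sigma>_def using D(1) by (subst Min_gr_iff) auto
  have T0: "char_pol d (T 0) = linear_prod d r"
    unfolding char_pol_diag_linear_prod[symmetric] by (rule char_pol_cong) (simp add: T_def)
  show thesis
  proof (rule that[OF \<sigma>])
    fix \<eta> i assume "\<bar>\<eta>\<bar> \<le> \<sigma>" "i < d"
    moreover from this have "\<sigma> \<le> D i"
      unfolding \<sigma>_def by (intro Min_le) auto
    ultimately have "\<bar>coeff (char_pol d (T \<eta>)) i - coeff (linear_prod d r) i\<bar> < e"
      using D(2)[of \<eta> i] by (simp add: T0)
    then show "\<bar>coeff (char_pol d (\<lambda>i j. if i = j then r i else if j = Suc i \<or> i = Suc j then \<eta> else 0)) i - coeff (linear_prod d r) i\<bar> < e"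
      by (simp only: T_def)
  qed
qed

lemma H_polys_facts:
  assumes f: "f \<in> H_polys k d"
  shows "degree f = d" "coeff f d = 1" "\<And>i. i \<le> d \<Longrightarrow> degree (coeff f i) \<le> k * (d - i)"
    "\<And>x. real_rooted (specialize_X x f)"
proof -
  obtain a where a: "f = (\<Sum>i\<le>d. monom (a i) i)" "\<And>i. i \<le> d \<Longrightarrow> degree (a i) \<le> k * (d - i)"
    using f by (auto simp: H_polys_def weighted_polys_def)
  have c: "coeff f i = a i" if "i \<le> d" for i
    using that by (simp add: a coeff_sum)
  show deg: "degree f = d"
    using f by (simp add: H_polys_def)
  show "degree (coeff f i) \<le> k * (d - i)" if "i \<le> d" for i
    using a(2)[OF that] c[OF that] by simp
  show rr: "real_rooted (specialize_X x f)" for x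
    using f by (auto simp: H_polys_def T_real_rooted_def)
  \<comment> \<open>The coefficient of T^d has weight 0, so it is a constant that can be read off at
    X = 0.\<close>
  have "degree (coeff f d) = 0"
    using a(2)[of d] c[of d] by simp
  then obtain b where b: "coeff f d = [:b:]"
    by (rule degree_eq_zeroE)
  have lead: "lead_coeff (specialize_X 0 f) = 1"
    using rr[of 0] by (simp add: real_rooted_def)
  show "coeff f d = 1"
  proof (cases "b = 0")
    case True
    then have "lead_coeff f = 0"
      using b deg by simp
    then have "f = 0"
      by simp
    with lead show ?thesis
      by (simp add: specialize_X_def)
  next
    case False
    have "degree (specialize_X 0 f) \<le> d"
      by (intro degree_le) (simp add: coeff_specialize coeff_eq_0 deg)
    moreover have "coeff (specialize_X 0 f) d = b"
      by (simp add: coeff_specialize b)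
    ultimately have "degree (specialize_X 0 f) = d"
      using False le_degree[of "specialize_X 0 f" d] by simp
    with lead \<open>coeff (specialize_X 0 f) d = b\<close> show ?thesis
      by (simp add: b one_pCons)
  qed
qed

text \<open>Substituting \<open>T = (1 + x^2)^m T'\<close> turns the operator \<open>1 - c (1 + X^2)^m d/dT\<close> into
  \<open>1 - c d/dT'\<close> and makes all coefficients bounded, uniformly in \<open>x\<close>.\<close>

lemma approximation_in_image:
  fixes f :: "real poly poly"
  assumes f: "f \<in> H_polys k d" and d: "d \<ge> 2" and c: "c \<noteq> 0" and \<eta>: "\<eta> > 0"
  defines "m \<equiv> k + 2"
  defines "l \<equiv> [:1, 0, 1:] ^ m"
  shows "\<exists>A p. (\<forall>i<d. \<forall>j<d. A i j = A j i) \<and> (\<forall>i<d. \<forall>j<d. degree (A i j) \<le> 2 * m) \<and>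
    norm p < \<eta> \<and> char_pol d A = (nuijX l c ^^ d) f + perturb p"
proof -
  \<comment> \<open>As K > k, every term of \<open>f\<close> except T^d lies strictly below weight
    d, so the leading form does not change along the path. Moreover K \<ge> 4, as
    \<open>top_form_perturb\<close> requires.\<close>
  define K where "K = 2 * m"
  have K: "K > 0" "K \<ge> 4" "K > k"
    by (simp_all add: K_def m_def)
  have d0: "d > 0"
    using d by simp
  have pl: "poly l x = (1 + x\<^sup>2) ^ m" for x
    by (simp add: l_def power2_eq_square)
  have pl1: "poly l x \<ge> 1" for x
    unfolding pl by (rule one_le_power) simp
  have utl: "top_coeff K l 1"
  proof -
    have "top_coeff 2 [:1, 0, 1:] (1 :: real)"
      by (simp add: top_coeff_def numeral_2_eq_2)
    then have "top_coeff (2 * card {..<m}) (\<Prod>i<m. [:1, 0, 1:]) (\<Prod>i<m. 1 :: real)"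
      by (intro top_coeff_prod)
    then show ?thesis
      by (simp add: l_def K_def)
  qed
  note F = H_polys_facts[OF f]
  \<comment> \<open>s^d f(X, T / s) without division, so that s = 0 gives T^d.\<close>
  define fs where "fs = (\<lambda>s :: real. \<Sum>i\<le>d. monom (smult (s ^ (d - i)) (coeff f i)) i)"
  have cfs: "coeff (fs s) i = (if i \<le> d then smult (s ^ (d - i)) (coeff f i) else 0)" for s i
    by (simp add: fs_def coeff_sum)
  have fs1: "fs 1 = f"
    by (rule poly_eqI) (simp add: cfs coeff_eq_0 F(1))
  have fs_diff: "(\<lambda>s. coeff (coeff (fs s) i) j) differentiable (at s)" for i j s
    by (cases "i \<le> d") (simp_all add: cfs)
  have top_form_fs: "top_form K d (fs s) (monom 1 d)" for s
    unfolding top_form_def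
  proof (intro conjI allI impI)
    show "coeff (fs s) i = 0" "coeff (monom 1 d :: real poly) i = 0" if "i > d" for i
      using that by (simp_all add: cfs)
    show "top_coeff (K * (d - i)) (coeff (fs s) i) (coeff (monom 1 d) i)" if "i \<le> d" for i
    proof (cases "i = d")
      case True
      then show ?thesis
        by (simp add: cfs F(2) top_coeff_def)
    next
      case False
      then have "k * (d - i) < K * (d - i)"
        using that K by simp
      from F(3)[OF that] this have "degree (coeff f i) < K * (d - i)"
        by (rule le_less_trans)
      then show ?thesis
        using that False by (simp add: cfs top_coeff_def coeff_eq_0 le_less_trans[OF degree_smult_le])
    qed
  qed
  \<comment> \<open>A bound for the rescaled coefficients at all real x and all s in [0, 1]:
    coefficient i grows at most like (1 + x^2)^(m (d - i)), which is exactly what rescaling divides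
    out.\<close>
  define C where "C = (\<Sum>i\<le>d. \<Sum>j\<le>2 * (m * (d - i)). \<bar>coeff (coeff f i) j\<bar>)"
  have C0: "C \<ge> 0"
    unfolding C_def by (intro sum_nonneg) auto
  have rescale_fs: "\<exists>\<rho>. rescale d (poly l x) (specialize_X x (fs s)) = linear_prod d \<rho> \<and> (\<forall>i<d. \<bar>coeff (linear_prod d \<rho>) i\<bar> \<le> C)"
    if s: "s \<in> {0..1}" for s x
  proof -
    define L where "L = poly l x"
    have L: "L \<ge> 1"
      unfolding L_def by (rule pl1)
    have rr: "real_rooted (specialize_X x f)"
      by (rule F(4))
    have degs: "degree (specialize_X x f) = d"
    proof (rule antisym)
      show "degree (specialize_X x f) \<le> d"
        by (intro degree_le) (simp add: coeff_specialize coeff_eq_0 F(1))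
      show "d \<le> degree (specialize_X x f)"
        by (rule le_degree) (simp add: coeff_specialize F(2))
    qed
    obtain r where r: "specialize_X x f = linear_prod d r"
    proof (rule complex_roots_real_split[OF degs])
      show "coeff (specialize_X x f) d = 1"
        by (simp add: coeff_specialize F(2))
      show "z \<in> \<real>" if "poly (cpoly (specialize_X x f)) z = 0" for z
        using rr that by (simp add: real_rooted_def)
    qed
    define \<rho> where "\<rho> = (\<lambda>i. s / L * r i)"
    have cr: "coeff (linear_prod d \<rho>) i = (s / L) ^ (d - i) * poly (coeff f i) x" if "i \<le> d" for i
    proof -
      have "coeff (linear_prod d r) i = poly (coeff f i) x"
        unfolding r[symmetric] by (rule coeff_specialize)
      then show ?thesis
        unfolding \<rho>_def coeff_linear_prod_scale[OF that] by simp
    qed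
    have "rescale d L (specialize_X x (fs s)) = linear_prod d \<rho>"
    proof (rule poly_eqI)
      fix i
      show "coeff (rescale d L (specialize_X x (fs s))) i = coeff (linear_prod d \<rho>) i"
      proof (cases "i \<le> d")
        case True
        have "L ^ d = L ^ i * L ^ (d - i)"
          using True by (simp add: power_add[symmetric])
        then show ?thesis
          using L True by (simp add: cr coeff_rescale coeff_specialize cfs power_divide)
      next
        case False
        then show ?thesis
          by (simp add: coeff_rescale coeff_specialize cfs coeff_eq_0 degree_linear_prod)
      qed
    qed
    moreover have "\<bar>coeff (linear_prod d \<rho>) i\<bar> \<le> C" if i: "i < d" for i
    proof -
      have "degree (coeff f i) \<le> 2 * (m * (d - i))"
      proof -
        have "k * (d - i) \<le> 2 * (m * (d - i))"
          unfolding mult.assoc[symmetric] by (intro mult_right_mono) (simp_all add: m_def)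
        from order_trans[OF F(3) this] i show ?thesis
          by simp
      qed
      from poly_growth[OF this, of x]
      have "\<bar>poly (coeff f i) x\<bar> \<le> (\<Sum>j\<le>2 * (m * (d - i)). \<bar>coeff (coeff f i) j\<bar>) * L ^ (d - i)"
        by (simp add: L_def pl power_mult)
      also have "\<dots> \<le> C * L ^ (d - i)"
        unfolding C_def using i L
        by (intro mult_right_mono member_le_sum[of i "{..d}" "\<lambda>i. \<Sum>j\<le>2 * (m * (d - i)). \<bar>coeff (coeff f i) j\<bar>"] sum_nonneg) auto
      finally have b: "\<bar>poly (coeff f i) x\<bar> / L ^ (d - i) \<le> C"
        using L by (simp add: pos_divide_le_eq)
      have "\<bar>coeff (linear_prod d \<rho>) i\<bar> = s ^ (d - i) * (\<bar>poly (coeff f i) x\<bar> / L ^ (d - i))"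
        using s L i by (simp add: cr abs_mult power_divide)
      also have "\<dots> \<le> 1 * (\<bar>poly (coeff f i) x\<bar> / L ^ (d - i))"
        using s L by (intro mult_right_mono power_le_one) auto
      finally show ?thesis
        using b by simp
    qed
    ultimately show ?thesis
      unfolding L_def by blast
  qed
  \<comment> \<open>One \<open>e\<close> for all x and s. Half of it is spent on the tridiagonal
    correction, half on the generic perturbation.\<close>
  obtain e where e: "e > 0" and simple: "\<And>r P z. (\<forall>i<d. \<bar>coeff (linear_prod d r) i\<bar> \<le> C) \<Longrightarrow> degree P \<le> d \<Longrightarrow> coeff P d = 1 \<Longrightarrow>
    (\<forall>i<d. \<bar>coeff P i - coeff ((nuij c ^^ d) (linear_prod d r)) i\<bar> < e) \<Longrightarrow>
    \<not> (poly (cpoly P) z = 0 \<and> poly (pderiv (cpoly P)) z = 0)"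
    using uniform_no_double_root[OF c C0, of d] by blast
  have mon: "linear_prod d (\<lambda>i. 0) = monom 1 d"
    by (simp add: linear_prod_def monom_altdef)
  \<comment> \<open>The common leading form of the path. Its distinct roots are the diagonal entries
    of the fixed leading term.\<close>
  obtain r where r: "(nuij c ^^ d) (monom 1 d) = linear_prod d r" "inj_on r {..<d}"
    using nuij_separates[OF c, of d "\<lambda>i. 0"] unfolding mon by blast
  define g where "g = (\<lambda>s. (nuijX l c ^^ d) (fs s))"
  have top_form_g: "top_form K d (g s) (linear_prod d r)" for s
    unfolding g_def r(1)[symmetric] by (intro top_form_nuijX_iterate utl top_form_fs d0)
  have g_diff: "(\<lambda>s. coeff (coeff (g s) i) j) differentiable (at s)" for i j s
    unfolding g_def by (intro differentiable_nuijX_iterate fs_diff)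
  obtain \<sigma> where \<sigma>: "\<sigma> > 0" and near: "\<And>\<eta> i. \<bar>\<eta>\<bar> \<le> \<sigma> \<Longrightarrow> i < d \<Longrightarrow>
    \<bar>coeff (char_pol d (\<lambda>i j. if i = j then r i else if j = Suc i \<or> i = Suc j then \<eta> else 0)) i - coeff (linear_prod d r) i\<bar> < e / 2"
    using tridiagonal_near[of "e / 2" d r] e by auto
  \<comment> \<open>The diagonal matrix alone would be zero at the non-real zeros of
    \<open>l\<close> and hence derogatory there, as d \<ge> 2. The constant \<sigma> beside the
    diagonal prevents this.\<close>
  define A1 where "A1 = (\<lambda>i j. if i = j then smult (r i) l else if j = Suc i \<or> i = Suc j then [:\<sigma>:] else 0)"
  have top1: "diag_top K d r A1"
  proof -
    have "top_coeff K (smult a l) a" for a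
      using utl by (auto simp: top_coeff_def)
    moreover have "top_coeff K [:\<sigma>:] 0"
      using K by (simp add: top_coeff_def coeff_eq_0)
    ultimately show ?thesis
      by (auto simp: diag_top_def A1_def top_coeff_0)
  qed
  have reg1: "nonderogatory d (\<lambda>i j. cpoly (A1 i j))"
  proof (rule nonderogatory_cong)
    show "nonderogatory d (\<lambda>i j. if i = j then cpoly (smult (r i) l) else if j = Suc i \<or> i = Suc j then [:complex_of_real \<sigma>:] else 0)"
      using \<sigma> by (intro nonderogatory_tridiagonal) simp
    have "cpoly [:\<sigma>:] = [:complex_of_real \<sigma>:]"
      by (rule poly_eqI) (simp add: coeff_map_poly coeff_pCons split: nat.splits)
    then show "(if i = j then cpoly (smult (r i) l) else if j = Suc i \<or> i = Suc j then [:complex_of_real \<sigma>:] else 0)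
        = cpoly (A1 i j)" for i j
      by (auto simp: A1_def)
  qed
  obtain \<epsilon> where \<epsilon>: "\<epsilon> > 0" "\<And>G. top_form K d G (linear_prod d r) \<Longrightarrow> (\<forall>i j. \<bar>coeff (coeff G i) j - coeff (coeff (char_pol d A1) i) j\<bar> < \<epsilon>) \<Longrightarrow>
    \<exists>A'. diag_top K d r A' \<and> char_pol d A' = G"
    using char_pol_local_surj[OF top1 r(2) K(1) reg1] by blast
  define p' where "p' = char_pol d A1 - g 0"
  have top_form_p': "top_form K d p' 0"
    using top_form_diff[OF top_form_diag_top[OF top1] top_form_g[of 0]] by (simp add: p'_def)
  \<comment> \<open>The correction makes the path start exactly at \<open>char_pol d A1\<close>; it
    fades out and leaves \<open>g 1\<close> at s = 1.\<close>
  define F0 where "F0 = (\<lambda>s. g s + smult [:1 - s:] p')"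
  have top_form_F0: "top_form K d (F0 s) (linear_prod d r)" for s
  proof -
    have "top_form K d (smult [:1 - s:] p') 0"
      using top_form_p' by (auto simp: top_form_def top_coeff_def)
    from top_form_add[OF top_form_g this] show ?thesis
      by (simp add: F0_def)
  qed
  have F0_diff: "(\<lambda>s. coeff (coeff (F0 s) i) j) differentiable (at s)" for i j s
    by (simp add: F0_def) (intro differentiable_add differentiable_mult differentiable_diff differentiable_const differentiable_ident g_diff)
  have F0_deg: "degree (F0 s) \<le> d" "degree (coeff (F0 s) i) \<le> K * d" for s i
  proof -
    show "degree (F0 s) \<le> d"
      using top_form_F0[of s] by (intro degree_le) (simp add: top_form_def)
    show "degree (coeff (F0 s) i) \<le> K * d"
    proof (cases "i \<le> d")
      case True
      then have "degree (coeff (F0 s) i) \<le> K * (d - i)"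
        using top_form_F0[of s] by (simp add: top_form_def top_coeff_def)
      also have "\<dots> \<le> K * d"
        by simp
      finally show ?thesis .
    next
      case False
      then show ?thesis
        using top_form_F0[of s] by (simp add: top_form_def)
    qed
  qed
  \<comment> \<open>\<open>\<eta>\<close> is the required closeness, \<open>\<epsilon>\<close> keeps
    the perturbed start within reach of local surjectivity at \<open>A1\<close>, and
    \<open>e / 10\<close> turns the bound \<open>5 * norm p\<close> below into e / 2.\<close>
  define \<delta> where "\<delta> = min \<eta> (min (e / 10) \<epsilon>)"
  have "\<delta> > 0"
    using \<eta> e \<epsilon>(1) by (simp add: \<delta>_def)
  obtain p where p: "norm p < \<delta>" and generic: "\<And>s x t. Im x \<noteq> 0 \<Longrightarrow> \<not> singular (ccpoly (F0 s + perturb p)) x t"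
    using generic_perturbation[of F0 d "K * d" \<delta>, OF F0_diff F0_deg \<open>\<delta> > 0\<close>] by blast
  define G where "G = (\<lambda>s. F0 s + perturb p)"
  have top_form_G: "top_form K d (G s) (linear_prod d r)" for s
    using top_form_add[OF top_form_F0[of s] top_form_perturb[OF d K(2), of p]] by (simp add: G_def)
  have no_double: "\<not> (poly (cpoly (rescale d (poly l x) (specialize_X x (G s)))) z = 0 \<and>
      poly (pderiv (cpoly (rescale d (poly l x) (specialize_X x (G s))))) z = 0)" if s: "s \<in> {0..1}" for s x z
  proof -
    define L where "L = poly l x"
    have L: "L \<ge> 1"
      unfolding L_def by (rule pl1)
    let ?R = "\<lambda>F. rescale d L (specialize_X x F)"
    obtain \<rho> where \<rho>: "?R (fs s) = linear_prod d \<rho>" "\<forall>i<d. \<bar>coeff (linear_prod d \<rho>) i\<bar> \<le> C"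
      using rescale_fs[OF s, of x] unfolding L_def by blast
    have Rg: "?R (g s) = (nuij c ^^ d) (linear_prod d \<rho>)"
      unfolding g_def L_def rescale_nuijX_iterate \<rho>(1)[unfolded L_def] ..
    have Rg0: "?R (g 0) = linear_prod d r"
    proof -
      have "?R (fs 0) = monom 1 d"
      proof (rule poly_eqI)
        fix i
        show "coeff (?R (fs 0)) i = coeff (monom 1 d) i"
          using L by (cases i d rule: linorder_cases) (simp_all add: coeff_rescale coeff_specialize cfs F(2))
      qed
      then show ?thesis
        unfolding g_def L_def rescale_nuijX_iterate r(1)[symmetric] by simp
    qed
    have RA: "?R (char_pol d A1) = char_pol d (\<lambda>i j. if i = j then r i else if j = Suc i \<or> i = Suc j then \<sigma> / L else 0)" (is "_ = char_pol d ?T")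
    proof (rule poly_eqI)
      fix i
      have "(\<lambda>i j. poly (A1 i j) x) = (\<lambda>i j. L * ?T i j)"
        using L by (intro ext) (simp add: A1_def L_def)
      then have "coeff (specialize_X x (char_pol d A1)) i * L ^ i = L ^ d * coeff (char_pol d ?T) i"
        unfolding specialize_char_pol by (simp only: coeff_char_pol_smult)
      then show "coeff (?R (char_pol d A1)) i = coeff (char_pol d ?T) i"
        using L by (simp add: coeff_rescale mult.commute)
    qed
    have coeffG: "coeff (?R (G s)) i = coeff ((nuij c ^^ d) (linear_prod d \<rho>)) i
        + (1 - s) * (coeff (char_pol d ?T) i - coeff (linear_prod d r) i) + L ^ i * poly (coeff (perturb p) i) x / L ^ d" for i
    proof -
      have "coeff (?R (G s)) i = coeff (?R (g s)) i + (1 - s) * (coeff (?R (char_pol d A1)) i - coeff (?R (g 0)) i)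
          + L ^ i * poly (coeff (perturb p) i) x / L ^ d"
        using L by (simp add: coeff_rescale coeff_specialize G_def F0_def p'_def field_simps)
      then show ?thesis
        unfolding Rg Rg0 RA .
    qed
    \<comment> \<open>A polynomial of degree at most 3 is estimated by (1 + x^2)^2 with five
      coefficients (j \<le> 4), and L^(d - i) absorbs this growth since m (d - i) \<ge> 2.\<close>
    have perturb_small: "\<bar>L ^ i * poly (coeff (perturb p) i) x / L ^ d\<bar> \<le> e / 2" if i: "i < d" for i
    proof -
      have "\<bar>poly (coeff (perturb p) i) x\<bar> \<le> (\<Sum>j\<le>2 * 2. \<bar>coeff (coeff (perturb p) i) j\<bar>) * (1 + x\<^sup>2) ^ 2"
        by (rule poly_growth) (use degree_perturb(1)[of p i] in simp)
      also have "\<dots> \<le> (\<Sum>j\<le>2 * (2::nat). norm p) * (1 + x\<^sup>2) ^ 2"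
        by (intro mult_right_mono sum_mono coeff_perturb_le) auto
      also have "\<dots> = 5 * norm p * (1 + x\<^sup>2) ^ 2"
        by simp
      also have "\<dots> \<le> 5 * norm p * L ^ (d - i)"
      proof (intro mult_left_mono)
        have "(1 + x\<^sup>2) ^ 2 \<le> (1 + x\<^sup>2) ^ (m * (d - i))"
        proof (rule power_increasing)
          have "2 * 1 \<le> m * (d - i)"
            by (intro mult_le_mono) (use i in \<open>auto simp: m_def\<close>)
          then show "2 \<le> m * (d - i)"
            by simp
        qed simp
        then show "(1 + x\<^sup>2) ^ 2 \<le> L ^ (d - i)"
          by (simp add: L_def pl power_mult)
      qed simp
      finally have "\<bar>poly (coeff (perturb p) i) x\<bar> / L ^ (d - i) \<le> 5 * norm p"
        using L by (simp add: pos_divide_le_eq)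
      moreover have "L ^ d = L ^ i * L ^ (d - i)"
        using i by (simp add: power_add[symmetric])
      then have "\<bar>L ^ i * poly (coeff (perturb p) i) x / L ^ d\<bar> = \<bar>poly (coeff (perturb p) i) x\<bar> / L ^ (d - i)"
        using L by (simp add: abs_mult)
      moreover have "norm p < e / 10"
        using p by (simp add: \<delta>_def)
      ultimately show ?thesis
        by linarith
    qed
    show ?thesis
      unfolding L_def[symmetric]
    proof (rule simple[OF \<rho>(2)])
      have G0: "coeff (G s) i = 0" if "i > d" for i
        using top_form_G[of s] that by (simp add: top_form_def)
      show "degree (?R (G s)) \<le> d"
        by (intro degree_le) (simp add: coeff_rescale coeff_specialize G0)
      have "coeff (G s) d = 1"
      proof -
        have "top_coeff (K * (d - d)) (coeff (G s) d) (coeff (linear_prod d r) d)"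
          using top_form_G[of s] unfolding top_form_def by blast
        then have u: "degree (coeff (G s) d) = 0" "coeff (coeff (G s) d) 0 = 1"
          by (simp_all add: top_coeff_def lead_linear_prod)
        obtain b where "coeff (G s) d = [:b:]"
          by (rule degree_eq_zeroE[OF u(1)])
        with u(2) show ?thesis
          by (simp add: one_pCons)
      qed
      then show "coeff (?R (G s)) d = 1"
        using L by (simp add: coeff_rescale coeff_specialize)
      show "\<forall>i<d. \<bar>coeff (?R (G s)) i - coeff ((nuij c ^^ d) (linear_prod d \<rho>)) i\<bar> < e"
      proof (intro allI impI)
        fix i assume i: "i < d"
        have "\<bar>\<sigma> / L\<bar> \<le> \<sigma>"
          using \<sigma> L by (simp add: pos_divide_le_eq)
        from near[OF this i] have t: "\<bar>coeff (char_pol d ?T) i - coeff (linear_prod d r) i\<bar> < e / 2" .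
        have "\<bar>(1 - s) * (coeff (char_pol d ?T) i - coeff (linear_prod d r) i)\<bar> \<le> 1 * \<bar>coeff (char_pol d ?T) i - coeff (linear_prod d r) i\<bar>"
          unfolding abs_mult using s by (intro mult_right_mono) auto
        then have u: "\<bar>(1 - s) * (coeff (char_pol d ?T) i - coeff (linear_prod d r) i)\<bar> \<le> \<bar>coeff (char_pol d ?T) i - coeff (linear_prod d r) i\<bar>"
          by (simp only: mult_1)
        have split: "\<bar>a + u + v - a\<bar> < e" if "\<bar>u\<bar> \<le> w" "w < e / 2" "\<bar>v\<bar> \<le> e / 2" for a u v w :: real
          using that by linarith
        show "\<bar>coeff (?R (G s)) i - coeff ((nuij c ^^ d) (linear_prod d \<rho>)) i\<bar> < e"
          unfolding coeffG by (rule split[OF u t perturb_small[OF i]])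
      qed
    qed
  qed
  have "\<exists>A. diag_top K d r A \<and> char_pol d A = G 1"
  proof (rule path_in_image[OF r(2) K(1) top_form_G])
    show "continuous_on UNIV (\<lambda>s. coeff (coeff (G s) i) j)" for i j
    proof -
      have "(\<lambda>s. coeff (coeff (F0 s) i) j) differentiable_on UNIV"
        using F0_diff by (simp add: differentiable_on_def)
      then have "continuous_on UNIV (\<lambda>s. coeff (coeff (F0 s) i) j)"
        by (rule differentiable_imp_continuous_on)
      then show ?thesis
        by (auto simp: G_def intro!: continuous_intros)
    qed
    show "\<not> singular (ccpoly (G s)) x t" if s: "s \<in> {0..1}" for s x t
    proof (cases "Im x = 0")
      case False
      then show ?thesis
        unfolding G_def by (rule generic)
    next
      case True
      then have x: "x = complex_of_real (Re x)"
        by (simp add: complex_eq_iff)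
      show ?thesis
      proof
        assume "singular (ccpoly (G s)) x t"
        then have "singular (ccpoly (G s)) (complex_of_real (Re x)) t"
          using x by simp
        from singular_real_double_root[OF this]
        have "poly (cpoly (rescale d (poly l (Re x)) (specialize_X (Re x) (G s)))) (t / of_real (poly l (Re x))) = 0 \<and>
          poly (pderiv (cpoly (rescale d (poly l (Re x)) (specialize_X (Re x) (G s))))) (t / of_real (poly l (Re x))) = 0"
          using pl1[of "Re x"] by (intro rescale_double_root) auto
        with no_double[OF s] show False
          by blast
      qed
    qed
    show "\<exists>A. diag_top K d r A \<and> char_pol d A = G 0"
    proof (rule \<epsilon>(2)[OF top_form_G])
      have "G 0 = char_pol d A1 + perturb p"
        by (simp add: G_def F0_def p'_def one_pCons[symmetric])
      moreover have "norm p < \<epsilon>"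
        using p by (simp add: \<delta>_def)
      then have "\<bar>coeff (coeff (perturb p) i) j\<bar> < \<epsilon>" for i j
        by (rule le_less_trans[OF coeff_perturb_le])
      ultimately show "\<forall>i j. \<bar>coeff (coeff (G 0) i) j - coeff (coeff (char_pol d A1) i) j\<bar> < \<epsilon>"
        by simp
    qed
  qed
  then obtain A where A: "diag_top K d r A" "char_pol d A = G 1"
    by blast
  have "char_pol d A = (nuijX l c ^^ d) f + perturb p"
    unfolding A(2) by (simp add: G_def F0_def g_def fs1)
  moreover have "norm p < \<eta>"
    using p by (simp add: \<delta>_def)
  moreover have "\<forall>i<d. \<forall>j<d. A i j = A j i" "\<forall>i<d. \<forall>j<d. degree (A i j) \<le> 2 * m"
    using A(1) by (auto simp: diag_top_def top_coeff_def K_def)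
  ultimately show ?thesis
    by blast
qed

text \<open>The approximating matrices have degree at most 2 (k + 2) independently of n, so they
  subconverge as the operator tends to the identity. The sharp bound \<open>k\<close> is recovered
  for the limit by \<open>degree_bound_automatic\<close>.\<close>

lemma real_rooted_is_char_pol:
  assumes f: "f \<in> H_polys k d" and d: "d \<ge> 2"
  obtains A where "\<And>i j. i < d \<Longrightarrow> j < d \<Longrightarrow> A i j = A j i" "\<And>i j. i < d \<Longrightarrow> j < d \<Longrightarrow> degree (A i j) \<le> k"
    "char_pol d A = f"
proof -
  define m where "m = k + 2"
  define l where "l = [:1, 0, 1 :: real:] ^ m"
  define c where "c = (\<lambda>n. 1 / (real n + 1))"
  have c0: "c \<longlonglongrightarrow> 0"
    using LIMSEQ_inverse_real_of_nat by (simp add: c_def inverse_eq_divide add.commute)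
  have "\<exists>A p. (\<forall>i<d. \<forall>j<d. A i j = A j i) \<and> (\<forall>i<d. \<forall>j<d. degree (A i j) \<le> 2 * m) \<and>
    norm p < c n \<and> char_pol d A = (nuijX l (c n) ^^ d) f + perturb p" for n
    unfolding l_def m_def by (rule approximation_in_image[OF f d]) (auto simp: c_def)
  then obtain A p where A: "\<And>n. \<forall>i<d. \<forall>j<d. A n i j = A n j i" "\<And>n. \<forall>i<d. \<forall>j<d. degree (A n i j) \<le> 2 * m"
    and p: "\<And>n. norm (p n) < c n" and chpA: "\<And>n. char_pol d (A n) = (nuijX l (c n) ^^ d) f + perturb (p n)"
    by metis
  have "coeff_lim (\<lambda>n. perturb (p n)) 0"
    unfolding coeff_lim_def
  proof (intro allI)
    fix i j
    have "\<bar>coeff (coeff (perturb (p n)) i) j\<bar> \<le> c n" for n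
      using coeff_perturb_le[of "p n" i j] p[of n] by linarith
    then have "(\<lambda>n. coeff (coeff (perturb (p n)) i) j) \<longlonglongrightarrow> 0"
      by (intro Lim_null_comparison[OF _ c0]) simp
    then show "(\<lambda>n. coeff (coeff (perturb (p n)) i) j) \<longlonglongrightarrow> coeff (coeff 0 i) j"
      by simp
  qed
  from coeff_lim_add[OF coeff_lim_nuijX_iterate[OF c0, where l = l and m = d and f = f] this]
  have lim: "coeff_lim (\<lambda>n. char_pol d (A n)) f"
    unfolding chpA by simp
  obtain q B where q: "strict_mono (q :: nat \<Rightarrow> nat)"
    and B: "\<And>i j e. i < d \<Longrightarrow> j < d \<Longrightarrow> (\<lambda>n. coeff (A (q n) i j) e) \<longlonglongrightarrow> coeff (B i j) e"
    and chpB: "char_pol d B = f"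
    using char_pol_limit[of d A "2 * m" f] A lim by blast
  have sym: "B i j = B j i" if "i < d" "j < d" for i j
  proof (rule poly_eqI)
    fix e
    have "(\<lambda>n. coeff (A (q n) i j) e) = (\<lambda>n. coeff (A (q n) j i) e)"
      using A(1) that by simp
    from B[OF that, of e, unfolded this] B[OF that(2,1), of e] show "coeff (B i j) e = coeff (B j i) e"
      by (rule LIMSEQ_unique)
  qed
  have "degree (B i j) \<le> k" if "i < d" "j < d" for i j
  proof (rule degree_bound_automatic[of d B])
    show "degree (coeff (char_pol d B) a) \<le> k * (d - a)" if "a \<le> d" for a
      unfolding chpB by (rule H_polys_facts(3)[OF f that])
  qed (use sym that in auto)
  with sym chpB show thesis
    by (intro that)
qed

lemma H_polys_subset_image:
  assumes f: "f \<in> H_polys k d"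
  shows "f \<in> chi_map d ` S_mats k d"
proof -
  note F = H_polys_facts[OF f]
  have "\<exists>A. (\<forall>i<d. \<forall>j<d. A i j = A j i) \<and> (\<forall>i<d. \<forall>j<d. degree (A i j) \<le> k) \<and> char_pol d A = f"
  proof -
    \<comment> \<open>The perturbation argument works from d = 2 on; for smaller d the matrix is
      empty or is read off from \<open>f\<close>.\<close>
    consider "d = 0" | "d = 1" | "d \<ge> 2"
      by linarith
    then show ?thesis
    proof cases
      case 1
      have "char_pol d (\<lambda>i j. 0) = f"
      proof (rule poly_eqI)
        fix i
        show "coeff (char_pol d (\<lambda>i j. 0)) i = coeff f i"
          using 1 char_pol_monic[of d "\<lambda>i j. 0 :: real poly"] F(1,2) by (cases i) (auto simp: coeff_eq_0)
      qed
      with 1 show ?thesis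
        by (intro exI[of _ "\<lambda>i j. 0"]) simp
    next
      case 2
      have "char_pol d (\<lambda>i j. - coeff f 0) = [:coeff f 0, 1:]"
        using char_pol_diag[of 1 "\<lambda>i. - coeff f 0"] char_pol_cong[of 1 "\<lambda>i j. - coeff f 0" "\<lambda>i j. if i = j then - coeff f 0 else 0"]
        by (simp add: 2)
      also have "\<dots> = f"
        using F(1,2) 2 by (intro poly_eqI) (auto simp: coeff_pCons coeff_eq_0 split: nat.splits)
      finally show ?thesis
        using F(3)[of 0] 2 by (intro exI[of _ "\<lambda>i j. - coeff f 0"]) simp
    next
      case 3
      show ?thesis
        by (rule real_rooted_is_char_pol[OF f 3]) blast
    qed
  qed
  then obtain A where A: "\<And>i j. i < d \<Longrightarrow> j < d \<Longrightarrow> A i j = A j i" "\<And>i j. i < d \<Longrightarrow> j < d \<Longrightarrow> degree (A i j) \<le> k"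
    "char_pol d A = f"
    by blast
  define M where "M = mat d d (\<lambda>(i, j). A i j)"
  have "M \<in> S_mats k d"
    using A(1,2) by (auto simp: S_mats_def M_def)
  moreover have "chi_map d M = char_pol d (\<lambda>i j. M $$ (i, j))"
    by (rule chi_map_eq_char_pol) (simp add: M_def)
  then have "chi_map d M = f"
    unfolding A(3)[symmetric] by (simp add: M_def cong: char_pol_cong)
  ultimately show ?thesis
    by blast
qed

theorem theorem26:
  fixes k d :: nat
  shows "H_polys k d = chi_map d ` S_mats k d"
  using chi_map_in_H H_polys_subset_image by blast

end
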